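(* The affine coordinate ring $R_\Pi$ of $\Pi_{\mathbb A}^{15}$ is a unique factorization domain.
   Context: Over $\mathbb C$. **Definition of $\Pi_{\mathbb A}^{15}$.** $\mathbb A_\Pi$ is the affine $19$-space with coordinates $p_1,\dots,p_4,u_1,u_2,s_1,s_2,s_3,t_1,t_2,t_{123},t_{124},t_{125},t_{126},t_{135},t_{136},t_{245},t_{246}$. Abbreviate $D=p_1p_4-p_2p_3$; $U_1=p_1^2+t_1p_2^2+p_2u_1$, $U_2=2p_1p_3+2t_1p_2p_4+p_4u_1+p_2u_2$, $U_3=p_3^2+t_1p_4^2+p_4u_2$; $I_1=t_2p_2^2+p_1u_1$, $I_2=2t_2p_2p_4+p_3u_1+p_1u_2$, $I_3=t_2p_4^2+p_3u_2$; $A_1=t_1p_2u_1-t_2p_1p_2+u_1^2$, $A_2=t_1(p_4u_1+p_2u_2)-t_2(p_2p_3+p_1p_4)+2u_1u_2$, $A_3=t_1p_4u_2-t_2p_3p_4+u_2^2$; $\alpha=t_{136}^2-t_{135}t_{245}$, $\beta=t_{135}t_{246}-t_{136}t_{245}$, $\gamma=t_{245}^2-t_{136}t_{246}$; $a_0=t_{123}t_{136}-t_{124}t_{135}$, $a_1=t_{123}t_{245}-t_{124}t_{136}$, $a_2=t_{123}t_{246}-t_{124}t_{245}$; $b_0=t_{125}t_{136}-t_{126}t_{135}$, $b_1=t_{125}t_{245}-t_{126}t_{136}$, $b_2=t_{125}t_{246}-t_{126}t_{245}$. $\Pi_{\mathbb A}^{15}$ is the closed subscheme defined by $F_1=\dots=F_9=0$,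 where $F_1=u_1s_1-p_1s_2-p_2s_3-t_{126}D-(t_{136}U_1+t_{245}U_2+t_{246}U_3)$, $F_2=u_2s_1-p_3s_2-p_4s_3+t_{125}D+t_{135}U_1+t_{136}U_2+t_{245}U_3$, $F_3=-t_2p_2s_1+(t_1p_2+u_1)s_2-p_1s_3-t_{124}D-(t_{136}I_1+t_{245}I_2+t_{246}I_3)$, $F_4=-t_2p_4s_1+(t_1p_4+u_2)s_2-p_3s_3+t_{123}D+t_{135}I_1+t_{136}I_2+t_{245}I_3$, $F_5=-t_2p_1s_1+(t_1p_1-t_2p_2)s_2+(t_1p_2+u_1)s_3+t_{123}U_1+t_{124}(p_1p_3+t_1p_2p_4+p_2u_2)-t_{125}I_1-t_{126}(t_2p_2p_4+p_1u_2)-(t_{136}A_1+t_{245}A_2+t_{246}A_3)$, $F_6=-t_2p_3s_1+(t_1p_3-t_2p_4)s_2+(t_1p_4+u_2)s_3+t_{123}(p_1p_3+t_1p_2p_4+p_4u_1)+t_{124}U_3-t_{125}(t_2p_2p_4+p_3u_1)-t_{126}I_3+t_{135}A_1+t_{136}A_2+t_{245}A_3$, $F_7=s_1s_3-s_2^2+(t_{123}p_2+t_{124}p_4)s_1-(t_{125}p_2+t_{126}p_4)s_2+\alpha(p_1^2-2p_2u_1-t_1p_2^2)+\gamma(p_3^2-2p_4u_2-t_1p_4^2)+\beta(p_2u_2+p_4u_1-p_1p_3+t_1p_2p_4)+a_0p_2^2+2a_1p_2p_4+a_2p_4^2-b_0p_1p_2-b_1(p_1p_4+p_2p_3)-b_2p_3p_4$,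 $F_8=s_2s_3+t_1s_1s_2-t_2s_1^2+(t_{123}p_1+t_{124}p_3)s_1-(t_{125}p_1+t_{126}p_3)s_2+\alpha(-2p_1u_1-2t_1p_1p_2+t_2p_2^2)+\gamma(-2p_3u_2-2t_1p_3p_4+t_2p_4^2)+\beta\big(p_1u_2+p_3u_1+t_1(p_1p_4+p_2p_3)-t_2p_2p_4\big)-b_0p_1^2-2b_1p_1p_3-b_2p_3^2+a_0p_1p_2+a_1(p_1p_4+p_2p_3)+a_2p_3p_4$, $F_9=s_3^2+t_1s_2^2-t_2s_1s_2+(t_{123}u_1+t_{124}u_2)s_1-(t_{125}u_1+t_{126}u_2)s_2-\alpha(2t_2p_1p_2+u_1^2)+\beta\big(t_2(p_2p_3+p_1p_4)+u_1u_2\big)-\gamma(2t_2p_3p_4+u_2^2)-t_1(a_0p_2^2+2a_1p_2p_4+a_2p_4^2)+t_2(b_0p_2^2+2b_1p_2p_4+b_2p_4^2)-a_0p_1^2-2a_1p_1p_3-a_2p_3^2+(t_{124}t_{125}-t_{123}t_{126})D$. $R_\Pi$ is the quotient of the polynomial ring in the $19$ coordinates by the ideal $(F_1,\dots,F_9)$. *)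

theory Defs
  imports
    Complex_Main
    "HOL-Library.Poly_Mapping"
    "HOL-Algebra.Ring_Divisibility"
    "HOL-Algebra.QuotRing"
    "HOL-Algebra.Algebraic_Closure_Type"
begin

datatype coord =
  Vp1 | Vp2 | Vp3 | Vp4
  | Vu1 | Vu2
  | Vs1 | Vs2 | Vs3
  | Vt1 | Vt2
  | Vt123 | Vt124 | Vt125 | Vt126 | Vt135 | Vt136 | Vt245 | Vt246

text \<open>The polynomial ring over the complex numbers in the nineteen coordinates: a polynomial is a
  finitely supported map from exponent vectors to coefficients, multiplied by convolution.\<close>

type_synonym cpoly = "(coord \<Rightarrow>\<^sub>0 nat) \<Rightarrow>\<^sub>0 complex"

definition coord_poly :: "coord \<Rightarrow> cpoly" where
  "coord_poly v = Poly_Mapping.single (Poly_Mapping.single v 1) 1"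

abbreviation p\<^sub>1 :: cpoly where "p\<^sub>1 \<equiv> coord_poly Vp1"
abbreviation p\<^sub>2 :: cpoly where "p\<^sub>2 \<equiv> coord_poly Vp2"
abbreviation p\<^sub>3 :: cpoly where "p\<^sub>3 \<equiv> coord_poly Vp3"
abbreviation p\<^sub>4 :: cpoly where "p\<^sub>4 \<equiv> coord_poly Vp4"
abbreviation u\<^sub>1 :: cpoly where "u\<^sub>1 \<equiv> coord_poly Vu1"
abbreviation u\<^sub>2 :: cpoly where "u\<^sub>2 \<equiv> coord_poly Vu2"
abbreviation s\<^sub>1 :: cpoly where "s\<^sub>1 \<equiv> coord_poly Vs1"
abbreviation s\<^sub>2 :: cpoly where "s\<^sub>2 \<equiv> coord_poly Vs2"
abbreviation s\<^sub>3 :: cpoly where "s\<^sub>3 \<equiv> coord_poly Vs3"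
abbreviation t\<^sub>1 :: cpoly where "t\<^sub>1 \<equiv> coord_poly Vt1"
abbreviation t\<^sub>2 :: cpoly where "t\<^sub>2 \<equiv> coord_poly Vt2"
abbreviation t\<^sub>1\<^sub>2\<^sub>3 :: cpoly where "t\<^sub>1\<^sub>2\<^sub>3 \<equiv> coord_poly Vt123"
abbreviation t\<^sub>1\<^sub>2\<^sub>4 :: cpoly where "t\<^sub>1\<^sub>2\<^sub>4 \<equiv> coord_poly Vt124"
abbreviation t\<^sub>1\<^sub>2\<^sub>5 :: cpoly where "t\<^sub>1\<^sub>2\<^sub>5 \<equiv> coord_poly Vt125"
abbreviation t\<^sub>1\<^sub>2\<^sub>6 :: cpoly where "t\<^sub>1\<^sub>2\<^sub>6 \<equiv> coord_poly Vt126"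
abbreviation t\<^sub>1\<^sub>3\<^sub>5 :: cpoly where "t\<^sub>1\<^sub>3\<^sub>5 \<equiv> coord_poly Vt135"
abbreviation t\<^sub>1\<^sub>3\<^sub>6 :: cpoly where "t\<^sub>1\<^sub>3\<^sub>6 \<equiv> coord_poly Vt136"
abbreviation t\<^sub>2\<^sub>4\<^sub>5 :: cpoly where "t\<^sub>2\<^sub>4\<^sub>5 \<equiv> coord_poly Vt245"
abbreviation t\<^sub>2\<^sub>4\<^sub>6 :: cpoly where "t\<^sub>2\<^sub>4\<^sub>6 \<equiv> coord_poly Vt246"

definition D :: cpoly where
  "D = p\<^sub>1 * p\<^sub>4 - p\<^sub>2 * p\<^sub>3"

definition U\<^sub>1 :: cpoly where
  "U\<^sub>1 = p\<^sub>1\<^sup>2 + t\<^sub>1 * p\<^sub>2\<^sup>2 + p\<^sub>2 * u\<^sub>1"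

definition U\<^sub>2 :: cpoly where
  "U\<^sub>2 = 2 * p\<^sub>1 * p\<^sub>3 + 2 * t\<^sub>1 * p\<^sub>2 * p\<^sub>4 + p\<^sub>4 * u\<^sub>1 + p\<^sub>2 * u\<^sub>2"

definition U\<^sub>3 :: cpoly where
  "U\<^sub>3 = p\<^sub>3\<^sup>2 + t\<^sub>1 * p\<^sub>4\<^sup>2 + p\<^sub>4 * u\<^sub>2"

definition I\<^sub>1 :: cpoly where
  "I\<^sub>1 = t\<^sub>2 * p\<^sub>2\<^sup>2 + p\<^sub>1 * u\<^sub>1"

definition I\<^sub>2 :: cpoly where
  "I\<^sub>2 = 2 * t\<^sub>2 * p\<^sub>2 * p\<^sub>4 + p\<^sub>3 * u\<^sub>1 + p\<^sub>1 * u\<^sub>2"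

definition I\<^sub>3 :: cpoly where
  "I\<^sub>3 = t\<^sub>2 * p\<^sub>4\<^sup>2 + p\<^sub>3 * u\<^sub>2"

definition A\<^sub>1 :: cpoly where
  "A\<^sub>1 = t\<^sub>1 * p\<^sub>2 * u\<^sub>1 - t\<^sub>2 * p\<^sub>1 * p\<^sub>2 + u\<^sub>1\<^sup>2"

definition A\<^sub>2 :: cpoly where
  "A\<^sub>2 = t\<^sub>1 * (p\<^sub>4 * u\<^sub>1 + p\<^sub>2 * u\<^sub>2) - t\<^sub>2 * (p\<^sub>2 * p\<^sub>3 + p\<^sub>1 * p\<^sub>4)
     + 2 * u\<^sub>1 * u\<^sub>2"

definition A\<^sub>3 :: cpoly where
  "A\<^sub>3 = t\<^sub>1 * p\<^sub>4 * u\<^sub>2 - t\<^sub>2 * p\<^sub>3 * p\<^sub>4 + u\<^sub>2\<^sup>2"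

definition \<alpha> :: cpoly where
  "\<alpha> = t\<^sub>1\<^sub>3\<^sub>6\<^sup>2 - t\<^sub>1\<^sub>3\<^sub>5 * t\<^sub>2\<^sub>4\<^sub>5"

definition \<beta> :: cpoly where
  "\<beta> = t\<^sub>1\<^sub>3\<^sub>5 * t\<^sub>2\<^sub>4\<^sub>6 - t\<^sub>1\<^sub>3\<^sub>6 * t\<^sub>2\<^sub>4\<^sub>5"

definition \<gamma> :: cpoly where
  "\<gamma> = t\<^sub>2\<^sub>4\<^sub>5\<^sup>2 - t\<^sub>1\<^sub>3\<^sub>6 * t\<^sub>2\<^sub>4\<^sub>6"

definition a\<^sub>0 :: cpoly where
  "a\<^sub>0 = t\<^sub>1\<^sub>2\<^sub>3 * t\<^sub>1\<^sub>3\<^sub>6 - t\<^sub>1\<^sub>2\<^sub>4 * t\<^sub>1\<^sub>3\<^sub>5"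

definition a\<^sub>1 :: cpoly where
  "a\<^sub>1 = t\<^sub>1\<^sub>2\<^sub>3 * t\<^sub>2\<^sub>4\<^sub>5 - t\<^sub>1\<^sub>2\<^sub>4 * t\<^sub>1\<^sub>3\<^sub>6"

definition a\<^sub>2 :: cpoly where
  "a\<^sub>2 = t\<^sub>1\<^sub>2\<^sub>3 * t\<^sub>2\<^sub>4\<^sub>6 - t\<^sub>1\<^sub>2\<^sub>4 * t\<^sub>2\<^sub>4\<^sub>5"

definition b\<^sub>0 :: cpoly where
  "b\<^sub>0 = t\<^sub>1\<^sub>2\<^sub>5 * t\<^sub>1\<^sub>3\<^sub>6 - t\<^sub>1\<^sub>2\<^sub>6 * t\<^sub>1\<^sub>3\<^sub>5"

definition b\<^sub>1 :: cpoly where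
  "b\<^sub>1 = t\<^sub>1\<^sub>2\<^sub>5 * t\<^sub>2\<^sub>4\<^sub>5 - t\<^sub>1\<^sub>2\<^sub>6 * t\<^sub>1\<^sub>3\<^sub>6"

definition b\<^sub>2 :: cpoly where
  "b\<^sub>2 = t\<^sub>1\<^sub>2\<^sub>5 * t\<^sub>2\<^sub>4\<^sub>6 - t\<^sub>1\<^sub>2\<^sub>6 * t\<^sub>2\<^sub>4\<^sub>5"

definition F\<^sub>1 :: cpoly where
  "F\<^sub>1 = u\<^sub>1 * s\<^sub>1 - p\<^sub>1 * s\<^sub>2 - p\<^sub>2 * s\<^sub>3 - t\<^sub>1\<^sub>2\<^sub>6 * D - (t\<^sub>1\<^sub>3\<^sub>6 * U\<^sub>1 + t\<^sub>2\<^sub>4\<^sub>5 * U\<^sub>2 + t\<^sub>2\<^sub>4\<^sub>6 * U\<^sub>3)"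

definition F\<^sub>2 :: cpoly where
  "F\<^sub>2 = u\<^sub>2 * s\<^sub>1 - p\<^sub>3 * s\<^sub>2 - p\<^sub>4 * s\<^sub>3 + t\<^sub>1\<^sub>2\<^sub>5 * D + t\<^sub>1\<^sub>3\<^sub>5 * U\<^sub>1
     + t\<^sub>1\<^sub>3\<^sub>6 * U\<^sub>2 + t\<^sub>2\<^sub>4\<^sub>5 * U\<^sub>3"

definition F\<^sub>3 :: cpoly where
  "F\<^sub>3 = -t\<^sub>2 * p\<^sub>2 * s\<^sub>1 + (t\<^sub>1 * p\<^sub>2 + u\<^sub>1) * s\<^sub>2 - p\<^sub>1 * s\<^sub>3 - t\<^sub>1\<^sub>2\<^sub>4 * D
     - (t\<^sub>1\<^sub>3\<^sub>6 * I\<^sub>1 + t\<^sub>2\<^sub>4\<^sub>5 * I\<^sub>2 + t\<^sub>2\<^sub>4\<^sub>6 * I\<^sub>3)"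

definition F\<^sub>4 :: cpoly where
  "F\<^sub>4 = -t\<^sub>2 * p\<^sub>4 * s\<^sub>1 + (t\<^sub>1 * p\<^sub>4 + u\<^sub>2) * s\<^sub>2 - p\<^sub>3 * s\<^sub>3 + t\<^sub>1\<^sub>2\<^sub>3 * D
     + t\<^sub>1\<^sub>3\<^sub>5 * I\<^sub>1 + t\<^sub>1\<^sub>3\<^sub>6 * I\<^sub>2 + t\<^sub>2\<^sub>4\<^sub>5 * I\<^sub>3"

definition F\<^sub>5 :: cpoly where
  "F\<^sub>5 = -t\<^sub>2 * p\<^sub>1 * s\<^sub>1 + (t\<^sub>1 * p\<^sub>1 - t\<^sub>2 * p\<^sub>2) * s\<^sub>2 + (t\<^sub>1 * p\<^sub>2 + u\<^sub>1) * s\<^sub>3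
     + t\<^sub>1\<^sub>2\<^sub>3 * U\<^sub>1 + t\<^sub>1\<^sub>2\<^sub>4 * (p\<^sub>1 * p\<^sub>3 + t\<^sub>1 * p\<^sub>2 * p\<^sub>4 + p\<^sub>2 * u\<^sub>2)
     - t\<^sub>1\<^sub>2\<^sub>5 * I\<^sub>1 - t\<^sub>1\<^sub>2\<^sub>6 * (t\<^sub>2 * p\<^sub>2 * p\<^sub>4 + p\<^sub>1 * u\<^sub>2)
     - (t\<^sub>1\<^sub>3\<^sub>6 * A\<^sub>1 + t\<^sub>2\<^sub>4\<^sub>5 * A\<^sub>2 + t\<^sub>2\<^sub>4\<^sub>6 * A\<^sub>3)"

definition F\<^sub>6 :: cpoly where
  "F\<^sub>6 = -t\<^sub>2 * p\<^sub>3 * s\<^sub>1 + (t\<^sub>1 * p\<^sub>3 - t\<^sub>2 * p\<^sub>4) * s\<^sub>2 + (t\<^sub>1 * p\<^sub>4 + u\<^sub>2) * s\<^sub>3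
     + t\<^sub>1\<^sub>2\<^sub>3 * (p\<^sub>1 * p\<^sub>3 + t\<^sub>1 * p\<^sub>2 * p\<^sub>4 + p\<^sub>4 * u\<^sub>1)
     + t\<^sub>1\<^sub>2\<^sub>4 * U\<^sub>3 - t\<^sub>1\<^sub>2\<^sub>5 * (t\<^sub>2 * p\<^sub>2 * p\<^sub>4 + p\<^sub>3 * u\<^sub>1)
     - t\<^sub>1\<^sub>2\<^sub>6 * I\<^sub>3 + t\<^sub>1\<^sub>3\<^sub>5 * A\<^sub>1 + t\<^sub>1\<^sub>3\<^sub>6 * A\<^sub>2
     + t\<^sub>2\<^sub>4\<^sub>5 * A\<^sub>3"

definition F\<^sub>7 :: cpoly where
  "F\<^sub>7 = s\<^sub>1 * s\<^sub>3 - s\<^sub>2\<^sup>2 + (t\<^sub>1\<^sub>2\<^sub>3 * p\<^sub>2 + t\<^sub>1\<^sub>2\<^sub>4 * p\<^sub>4) * s\<^sub>1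
     - (t\<^sub>1\<^sub>2\<^sub>5 * p\<^sub>2 + t\<^sub>1\<^sub>2\<^sub>6 * p\<^sub>4) * s\<^sub>2 + \<alpha> * (p\<^sub>1\<^sup>2 - 2 * p\<^sub>2 * u\<^sub>1 - t\<^sub>1 * p\<^sub>2\<^sup>2)
     + \<gamma> * (p\<^sub>3\<^sup>2 - 2 * p\<^sub>4 * u\<^sub>2 - t\<^sub>1 * p\<^sub>4\<^sup>2) + \<beta> * (p\<^sub>2 * u\<^sub>2 + p\<^sub>4 * u\<^sub>1 - p\<^sub>1 * p\<^sub>3 + t\<^sub>1 * p\<^sub>2 * p\<^sub>4)
     + a\<^sub>0 * p\<^sub>2\<^sup>2 + 2 * a\<^sub>1 * p\<^sub>2 * p\<^sub>4 + a\<^sub>2 * p\<^sub>4\<^sup>2 - b\<^sub>0 * p\<^sub>1 * p\<^sub>2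
     - b\<^sub>1 * (p\<^sub>1 * p\<^sub>4 + p\<^sub>2 * p\<^sub>3) - b\<^sub>2 * p\<^sub>3 * p\<^sub>4"

definition F\<^sub>8 :: cpoly where
  "F\<^sub>8 = s\<^sub>2 * s\<^sub>3 + t\<^sub>1 * s\<^sub>1 * s\<^sub>2 - t\<^sub>2 * s\<^sub>1\<^sup>2 + (t\<^sub>1\<^sub>2\<^sub>3 * p\<^sub>1 + t\<^sub>1\<^sub>2\<^sub>4 * p\<^sub>3) * s\<^sub>1
     - (t\<^sub>1\<^sub>2\<^sub>5 * p\<^sub>1 + t\<^sub>1\<^sub>2\<^sub>6 * p\<^sub>3) * s\<^sub>2 + \<alpha> * (-2 * p\<^sub>1 * u\<^sub>1 - 2 * t\<^sub>1 * p\<^sub>1 * p\<^sub>2 + t\<^sub>2 * p\<^sub>2\<^sup>2)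
     + \<gamma> * (-2 * p\<^sub>3 * u\<^sub>2 - 2 * t\<^sub>1 * p\<^sub>3 * p\<^sub>4 + t\<^sub>2 * p\<^sub>4\<^sup>2)
     + \<beta> * (p\<^sub>1 * u\<^sub>2 + p\<^sub>3 * u\<^sub>1 + t\<^sub>1 * (p\<^sub>1 * p\<^sub>4 + p\<^sub>2 * p\<^sub>3) - t\<^sub>2 * p\<^sub>2 * p\<^sub>4)
     - b\<^sub>0 * p\<^sub>1\<^sup>2 - 2 * b\<^sub>1 * p\<^sub>1 * p\<^sub>3 - b\<^sub>2 * p\<^sub>3\<^sup>2 + a\<^sub>0 * p\<^sub>1 * p\<^sub>2
     + a\<^sub>1 * (p\<^sub>1 * p\<^sub>4 + p\<^sub>2 * p\<^sub>3) + a\<^sub>2 * p\<^sub>3 * p\<^sub>4"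

definition F\<^sub>9 :: cpoly where
  "F\<^sub>9 = s\<^sub>3\<^sup>2 + t\<^sub>1 * s\<^sub>2\<^sup>2 - t\<^sub>2 * s\<^sub>1 * s\<^sub>2 + (t\<^sub>1\<^sub>2\<^sub>3 * u\<^sub>1 + t\<^sub>1\<^sub>2\<^sub>4 * u\<^sub>2) * s\<^sub>1
     - (t\<^sub>1\<^sub>2\<^sub>5 * u\<^sub>1 + t\<^sub>1\<^sub>2\<^sub>6 * u\<^sub>2) * s\<^sub>2 - \<alpha> * (2 * t\<^sub>2 * p\<^sub>1 * p\<^sub>2 + u\<^sub>1\<^sup>2)
     + \<beta> * (t\<^sub>2 * (p\<^sub>2 * p\<^sub>3 + p\<^sub>1 * p\<^sub>4) + u\<^sub>1 * u\<^sub>2) - \<gamma> * (2 * t\<^sub>2 * p\<^sub>3 * p\<^sub>4 + u\<^sub>2\<^sup>2)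
     - t\<^sub>1 * (a\<^sub>0 * p\<^sub>2\<^sup>2 + 2 * a\<^sub>1 * p\<^sub>2 * p\<^sub>4 + a\<^sub>2 * p\<^sub>4\<^sup>2)
     + t\<^sub>2 * (b\<^sub>0 * p\<^sub>2\<^sup>2 + 2 * b\<^sub>1 * p\<^sub>2 * p\<^sub>4 + b\<^sub>2 * p\<^sub>4\<^sup>2)
     - a\<^sub>0 * p\<^sub>1\<^sup>2 - 2 * a\<^sub>1 * p\<^sub>1 * p\<^sub>3 - a\<^sub>2 * p\<^sub>3\<^sup>2 + (t\<^sub>1\<^sub>2\<^sub>4 * t\<^sub>1\<^sub>2\<^sub>5 - t\<^sub>1\<^sub>2\<^sub>3 * t\<^sub>1\<^sub>2\<^sub>6) * D"

definition cpoly_ring :: "cpoly ring" where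
  "cpoly_ring = ring_of_type_algebra"

definition ideal_\<Pi> :: "cpoly set" where
  "ideal_\<Pi> = Idl\<^bsub>cpoly_ring\<^esub> {F\<^sub>1, F\<^sub>2, F\<^sub>3, F\<^sub>4, F\<^sub>5, F\<^sub>6, F\<^sub>7, F\<^sub>8, F\<^sub>9}"

definition R_\<Pi> :: "cpoly set ring" where
  "R_\<Pi> = cpoly_ring Quot ideal_\<Pi>"

end

theory Submission
  imports Defs
begin

text \<open>Write I for the ideal of the nine equations and R for the quotient ring. Each of the four equations
F1, ..., F4 contains exactly one of the coordinates t126, t125, t124, t123, and only in the summand
D t126, D t125, D t124 or D t123, up to sign. Where D is invertible they therefore determine these
four coordinates, and the other five equations are consequences, because D F5, ..., D F9 are
combinations of F1, ..., F4. Hence R[1/D] is the localization at D of the polynomial ring in the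
fifteen remaining coordinates, which is factorial, and the argument of Nagata applies: R is
factorial once it is a domain in which D is prime and in which proper divisors cannot descend
forever.

The last condition holds because the coordinates can be given positive weights for which all
equations are homogeneous: the degree is additive on R, and elements of degree 0 are constants. The
other two conditions rest on two facts: D is a nonzerodivisor on R, so that R is a subring of R[1/D]
(ideal_Pi_prime); and a suitable polynomial E is a nonzerodivisor on R/(D), where E is chosen such
that R/(D) with E inverted is again a localization of a polynomial ring, now in fourteen variables
(ideal_D_prime).

To see that D and E are nonzerodivisors, let B be the polynomial ring in the fourteen coordinates p
and t. The products u_i s_j and s_2 s_2, s_2 s_3, s_3 s_3 can be rewritten by the nine equations, so
every element of R is represented by s_1 g_1 + s_2 g_2 + s_3 g_3 + h with g_i in B[s_1] and h in
B[u_1, u_2] (normal_form). The g_i are uniquely determined (s_part_eq_0): the points with D nonzero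
contain curves along which (s_1, s_2, s_3) goes to infinity in the direction (1, x, x^2), for each
root x of x^3 + t_1 x = t_2, and the three roots give three independent conditions on the leading
coefficients of the g_i. The polynomial h is determined up to multiples of a single polynomial F10,
the result of eliminating the s_i from the equations (F10_dvd_if_in_ideal_Pi). So, as a B-module, R
is the direct sum of three copies of B[s_1] and of B[u_1, u_2]/(F10), and it remains to prove
regularity in polynomial rings, where F10 is a cubic in u_1 with leading coefficient t135
(D_dvd_F10_mult, F10_regular_span2).

Identities between polynomials are certified by expansion. Arguments at generic points are carried
out at the complex points of dense open sets, so that no function fields are needed.\<close>

section \<open>Polynomials, evaluation and the zero test\<close>

abbreviation \<xi> :: "coord \<Rightarrow> cpoly" where "\<xi> \<equiv> coord_poly"

text \<open>Without subscripts, the long identities below are easier to read.\<close>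
abbreviation "p1 \<equiv> p\<^sub>1"
abbreviation "p2 \<equiv> p\<^sub>2"
abbreviation "p3 \<equiv> p\<^sub>3"
abbreviation "p4 \<equiv> p\<^sub>4"
abbreviation "u1 \<equiv> u\<^sub>1"
abbreviation "u2 \<equiv> u\<^sub>2"
abbreviation "s1 \<equiv> s\<^sub>1"
abbreviation "s2 \<equiv> s\<^sub>2"
abbreviation "s3 \<equiv> s\<^sub>3"
abbreviation "t1 \<equiv> t\<^sub>1"
abbreviation "t2 \<equiv> t\<^sub>2"
abbreviation "t123 \<equiv> t\<^sub>1\<^sub>2\<^sub>3"
abbreviation "t124 \<equiv> t\<^sub>1\<^sub>2\<^sub>4"
abbreviation "t125 \<equiv> t\<^sub>1\<^sub>2\<^sub>5"
abbreviation "t126 \<equiv> t\<^sub>1\<^sub>2\<^sub>6"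
abbreviation "t135 \<equiv> t\<^sub>1\<^sub>3\<^sub>5"
abbreviation "t136 \<equiv> t\<^sub>1\<^sub>3\<^sub>6"
abbreviation "t245 \<equiv> t\<^sub>2\<^sub>4\<^sub>5"
abbreviation "t246 \<equiv> t\<^sub>2\<^sub>4\<^sub>6"
abbreviation "F1 \<equiv> F\<^sub>1"
abbreviation "F2 \<equiv> F\<^sub>2"
abbreviation "F3 \<equiv> F\<^sub>3"
abbreviation "F4 \<equiv> F\<^sub>4"
abbreviation "F5 \<equiv> F\<^sub>5"
abbreviation "F6 \<equiv> F\<^sub>6"
abbreviation "F7 \<equiv> F\<^sub>7"
abbreviation "F8 \<equiv> F\<^sub>8"
abbreviation "F9 \<equiv> F\<^sub>9"
abbreviation "equations \<equiv> {F1, F2, F3, F4, F5, F6, F7, F8, F9}"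

lemma UNIV_coord: "UNIV = {Vp1, Vp2, Vp3, Vp4, Vu1, Vu2, Vs1, Vs2, Vs3, Vt1, Vt2,
    Vt123, Vt124, Vt125, Vt126, Vt135, Vt136, Vt245, Vt246}"
  by (auto, metis coord.exhaust)

instance coord :: finite
  by standard (simp add: UNIV_coord)

definition coord_index :: "coord \<Rightarrow> nat" where
  "coord_index = (SOME f. inj f)"

lemma coord_index_inject: "coord_index v = coord_index w \<longleftrightarrow> v = w"
proof -
  have "inj coord_index"
    unfolding coord_index_def
    using finite_imp_inj_to_nat_seg[OF finite_UNIV] by (intro someI_ex[of inj]) blast
  then show ?thesis by (simp add: inj_eq)
qed

text \<open>Which linear order is chosen does not matter. An order on the coordinates induces one on the
  exponent vectors, and with leading terms for it the polynomials form an integral domain.\<close>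
instantiation coord :: linorder
begin
definition less_eq_coord :: "coord \<Rightarrow> coord \<Rightarrow> bool" where
  "v \<le> w \<longleftrightarrow> coord_index v \<le> coord_index w"
definition less_coord :: "coord \<Rightarrow> coord \<Rightarrow> bool" where
  "v < w \<longleftrightarrow> coord_index v < coord_index w"
instance
  by standard (auto simp: less_eq_coord_def less_coord_def coord_index_inject)
end

definition cst :: "complex \<Rightarrow> cpoly" where
  "cst c = Poly_Mapping.single 0 c"

lemma cst_0 [simp]: "cst 0 = 0" and cst_1 [simp]: "cst 1 = 1"
  by (simp_all add: cst_def)

lemma cst_add: "cst (a + b) = cst a + cst b"
  by (simp add: cst_def single_add)

lemma cst_mult: "cst (a * b) = cst a * cst b"
  by (simp add: cst_def mult_single)

lemma cst_eq_0_iff [simp]: "cst c = 0 \<longleftrightarrow> c = 0"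
  by (metis cst_0 cst_def lookup_single_eq lookup_zero)

lemma cst_inverse: "c \<noteq> 0 \<Longrightarrow> cst c * cst (inverse c) = 1"
  by (simp flip: cst_mult)

lemma coord_poly_power: "\<xi> v ^ n = Poly_Mapping.single (Poly_Mapping.single v n) 1"
  by (induction n) (simp_all add: coord_poly_def mult_single flip: single_add)

lemma prod_single: "finite S \<Longrightarrow>
    (\<Prod>v\<in>S. Poly_Mapping.single (a v) (1::complex)) = Poly_Mapping.single (\<Sum>v\<in>S. a v :: coord \<Rightarrow>\<^sub>0 nat) 1"
  by (induction rule: finite_induct) (simp_all add: mult_single)

lemma sum_singles: "(\<Sum>v\<in>Poly_Mapping.keys f. Poly_Mapping.single v (Poly_Mapping.lookup f v)) = f"
  by (rule poly_mapping_eqI) (auto simp: lookup_sum lookup_single when_def in_keys_iff)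

lemma sum_singles_UNIV: "(\<Sum>v\<in>UNIV. Poly_Mapping.single v (Poly_Mapping.lookup f v)) = (f :: coord \<Rightarrow>\<^sub>0 nat)"
  by (rule poly_mapping_eqI) (auto simp: lookup_sum lookup_single when_def)

abbreviation monomial_at :: "(coord \<Rightarrow> 'a::comm_monoid_mult) \<Rightarrow> (coord \<Rightarrow>\<^sub>0 nat) \<Rightarrow> 'a" where
  "monomial_at x m \<equiv> (\<Prod>v\<in>UNIV. x v ^ Poly_Mapping.lookup m v)"

lemma single_eq_cst_times: "Poly_Mapping.single m c = cst c * monomial_at \<xi> m"
  by (simp add: coord_poly_power prod_single sum_singles_UNIV cst_def mult_single)

text \<open>The subring generated by the constants and the coordinates in V. The inductive description allows
  proofs along the ring operations.\<close>
inductive_set polys_in :: "coord set \<Rightarrow> cpoly set" for V where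
  const: "cst c \<in> polys_in V"
| var: "v \<in> V \<Longrightarrow> \<xi> v \<in> polys_in V"
| add: "f \<in> polys_in V \<Longrightarrow> g \<in> polys_in V \<Longrightarrow> f + g \<in> polys_in V"
| mult: "f \<in> polys_in V \<Longrightarrow> g \<in> polys_in V \<Longrightarrow> f * g \<in> polys_in V"

lemma polys_in_0 [simp, intro]: "0 \<in> polys_in V"
  by (metis cst_0 polys_in.const)

lemma polys_in_1 [simp, intro]: "1 \<in> polys_in V"
  by (metis cst_1 polys_in.const)

lemma cst_minus: "cst (- c) = - cst c"
  by (simp add: cst_def single_uminus)

lemma polys_in_uminus: "f \<in> polys_in V \<Longrightarrow> - f \<in> polys_in V"
  by (metis cst_1 cst_minus mult_minus_left mult_1 polys_in.const polys_in.mult)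

lemma polys_in_diff: "f \<in> polys_in V \<Longrightarrow> g \<in> polys_in V \<Longrightarrow> f - g \<in> polys_in V"
  by (metis diff_conv_add_uminus polys_in.add polys_in_uminus)

lemma polys_in_power: "f \<in> polys_in V \<Longrightarrow> f ^ n \<in> polys_in V"
  by (induction n) (auto intro: polys_in.mult)

lemma cst_numeral: "cst (numeral n) = numeral n"
  by (simp add: cst_def)

lemma polys_in_numeral [simp, intro]: "numeral n \<in> polys_in V"
  by (metis cst_numeral polys_in.const)

lemma polys_in_sum: "(\<And>i. i \<in> S \<Longrightarrow> f i \<in> polys_in V) \<Longrightarrow> sum f S \<in> polys_in V"
  by (induction S rule: infinite_finite_induct) (auto intro: polys_in.add)

lemma polys_in_prod: "(\<And>i. i \<in> S \<Longrightarrow> f i \<in> polys_in V) \<Longrightarrow> prod f S \<in> polys_in V"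
  by (induction S rule: infinite_finite_induct) (auto intro: polys_in.mult)

lemmas polys_in_intros = polys_in.intros polys_in_uminus polys_in_diff polys_in_power
  polys_in_numeral

lemma polys_in_mono: "f \<in> polys_in V \<Longrightarrow> V \<subseteq> W \<Longrightarrow> f \<in> polys_in W"
  by (induction rule: polys_in.induct) (auto intro: polys_in.intros)

lemma polys_in_UNIV [simp]: "f \<in> polys_in UNIV"
proof -
  have "(\<Sum>m\<in>Poly_Mapping.keys f. Poly_Mapping.single m (Poly_Mapping.lookup f m)) \<in> polys_in UNIV"
    by (intro polys_in_sum) (auto simp: single_eq_cst_times intro!: polys_in.intros polys_in_prod
        polys_in_power)
  then show ?thesis by (simp only: sum_singles)
qed

lemma cpoly_induct [case_names const var add mult]:
  assumes "\<And>c. P (cst c)" "\<And>v. P (\<xi> v)"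
    and "\<And>f g. P f \<Longrightarrow> P g \<Longrightarrow> P (f + g)" "\<And>f g. P f \<Longrightarrow> P g \<Longrightarrow> P (f * g)"
  shows "P f"
  using polys_in_UNIV[of f] by (induction rule: polys_in.induct) (auto intro: assms)

definition coeff_hom :: "(complex \<Rightarrow> 'a::comm_ring_1) \<Rightarrow> bool" where
  "coeff_hom k \<longleftrightarrow> k 0 = 0 \<and> k 1 = 1 \<and> (\<forall>a b. k (a + b) = k a + k b) \<and> (\<forall>a b. k (a * b) = k a * k b)"

text \<open>The ring homomorphism out of the polynomial ring that is k on constants and x on coordinates. Values
  at points, substitutions, the passage to one distinguished variable and the grading are all of
  this kind.\<close>
definition ev :: "(complex \<Rightarrow> 'a::comm_ring_1) \<Rightarrow> (coord \<Rightarrow> 'a) \<Rightarrow> cpoly \<Rightarrow> 'a" where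
  "ev k x f = (\<Sum>m\<in>Poly_Mapping.keys f. k (Poly_Mapping.lookup f m) * monomial_at x m)"

context
  fixes k :: "complex \<Rightarrow> 'a::comm_ring_1"
  assumes k: "coeff_hom k"
begin

lemma ev_superset: "finite S \<Longrightarrow> Poly_Mapping.keys f \<subseteq> S \<Longrightarrow>
    ev k x f = (\<Sum>m\<in>S. k (Poly_Mapping.lookup f m) * monomial_at x m)"
  unfolding ev_def using k
  by (intro sum.mono_neutral_left) (auto simp: coeff_hom_def in_keys_iff)

lemma ev_add: "ev k x (f + g) = ev k x f + ev k x g"
proof -
  let ?S = "Poly_Mapping.keys f \<union> Poly_Mapping.keys g"
  have "ev k x (f + g) = (\<Sum>m\<in>?S. k (Poly_Mapping.lookup (f + g) m) * monomial_at x m)"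
    by (rule ev_superset) (use Poly_Mapping.keys_add[of f g] in auto)
  also have "\<dots> = ev k x f + ev k x g"
    using k by (simp add: ev_superset[of ?S] lookup_add coeff_hom_def distrib_right sum.distrib)
  finally show ?thesis .
qed

lemma ev_zero: "ev k x 0 = 0"
  by (simp add: ev_def)

lemma ev_sum: "ev k x (sum f S) = (\<Sum>i\<in>S. ev k x (f i))"
  by (induction S rule: infinite_finite_induct) (simp_all add: ev_zero ev_add)

lemma ev_single: "ev k x (Poly_Mapping.single m c) = k c * monomial_at x m"
  using k ev_superset[of "{m}" "Poly_Mapping.single m c" x] by simp

lemma ev_mult: "ev k x (f * g) = ev k x f * ev k x g"
proof -
  have "f * g = (\<Sum>m\<in>Poly_Mapping.keys f. \<Sum>n\<in>Poly_Mapping.keys g.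
      Poly_Mapping.single (m + n) (Poly_Mapping.lookup f m * Poly_Mapping.lookup g n))"
    by (subst (1) sum_singles[of f, symmetric], subst (1) sum_singles[of g, symmetric])
       (simp add: sum_product mult_single)
  also have "ev k x \<dots> = (\<Sum>m\<in>Poly_Mapping.keys f. \<Sum>n\<in>Poly_Mapping.keys g.
      (k (Poly_Mapping.lookup f m) * monomial_at x m) * (k (Poly_Mapping.lookup g n) * monomial_at x n))"
    using k by (simp add: ev_sum ev_single lookup_add power_add prod.distrib coeff_hom_def mult_ac)
  also have "\<dots> = ev k x f * ev k x g"
    by (simp add: ev_def sum_product)
  finally show ?thesis .
qed

lemma ev_cst: "ev k x (cst c) = k c"
  by (simp add: cst_def ev_single)

lemma ev_var: "ev k x (\<xi> v) = x v"
proof -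
  have "(\<Prod>w\<in>UNIV. x w ^ Poly_Mapping.lookup (Poly_Mapping.single v 1) w) = (\<Prod>w\<in>UNIV. if w = v then x v else 1)"
    by (rule prod.cong) (auto simp: lookup_single when_def)
  then show ?thesis
    using k by (simp add: coord_poly_def ev_single coeff_hom_def)
qed

lemma ev_one: "ev k x 1 = 1"
  using ev_cst[of x 1] k by (simp add: coeff_hom_def)

lemma ev_uminus: "ev k x (- f) = - ev k x f"
  using ev_add[of x f "- f"] by (simp add: ev_zero eq_neg_iff_add_eq_0 add.commute)

lemma ev_diff: "ev k x (f - g) = ev k x f - ev k x g"
  using ev_add[of x f "- g"] by (simp add: ev_uminus)

lemma ev_power: "ev k x (f ^ n) = ev k x f ^ n"
  by (induction n) (simp_all add: ev_one ev_mult)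

lemma ev_numeral: "ev k x (numeral n) = numeral n"
proof -
  have "ev k x (of_nat m) = of_nat m" for m
    by (induction m) (simp_all add: ev_zero ev_add ev_one)
  then show ?thesis by (metis of_nat_numeral)
qed

lemmas ev_simps = ev_add ev_zero ev_mult ev_cst ev_var ev_one ev_uminus ev_diff ev_power ev_numeral ev_sum

lemma ev_cong: "f \<in> polys_in V \<Longrightarrow> (\<And>v. v \<in> V \<Longrightarrow> x v = y v) \<Longrightarrow> ev k x f = ev k y f"
  by (induction rule: polys_in.induct) (auto simp: ev_simps)

end

definition eval_at :: "(coord \<Rightarrow> complex) \<Rightarrow> cpoly \<Rightarrow> complex" where
  "eval_at = ev id"
definition subst :: "(coord \<Rightarrow> cpoly) \<Rightarrow> cpoly \<Rightarrow> cpoly" where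
  "subst = ev cst"

text \<open>The map uni x isolates the coordinate x: the result is a polynomial in one variable whose
  coefficients do not involve x (coeff_uni_in).\<close>
definition uni :: "coord \<Rightarrow> cpoly \<Rightarrow> cpoly poly" where
  "uni x = ev (\<lambda>c. [:cst c:]) (\<lambda>v. if v = x then [:0, 1:] else [:\<xi> v:])"

lemma coeff_hom_id: "coeff_hom id" and coeff_hom_cst: "coeff_hom cst"
  and coeff_hom_pcst: "coeff_hom (\<lambda>c. [:cst c:])"
  by (simp_all add: coeff_hom_def cst_add cst_mult one_pCons)

lemmas eval_at_simps [simp] = ev_simps[OF coeff_hom_id, folded eval_at_def, unfolded id_apply]
lemmas subst_simps [simp] = ev_simps[OF coeff_hom_cst, folded subst_def]
lemmas uni_simps [simp] = ev_simps[OF coeff_hom_pcst, of "\<lambda>v. if v = x then [:0, 1:] else [:\<xi> v:]"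
    for x, folded uni_def]
lemmas eval_at_cong = ev_cong[OF coeff_hom_id, folded eval_at_def]

lemma eval_at_subst: "eval_at y (subst \<tau> f) = eval_at (\<lambda>v. eval_at y (\<tau> v)) f"
  by (induction f rule: cpoly_induct) simp_all

lemma subst_coord_poly [simp]: "subst \<xi> f = f"
  by (induction f rule: cpoly_induct) simp_all

lemma poly_uni [simp]: "poly (uni x f) (\<xi> x) = f"
  by (induction f rule: cpoly_induct) auto

lemma uni_free: "f \<in> polys_in V \<Longrightarrow> x \<notin> V \<Longrightarrow> uni x f = [:f:]"
  by (induction rule: polys_in.induct) auto

lemma coeff_uni_in: "f \<in> polys_in V \<Longrightarrow> coeff (uni x f) i \<in> polys_in (V - {x})"
proof (induction arbitrary: i rule: polys_in.induct)
  case (mult f g)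
  then show ?case by (auto simp: coeff_mult intro!: polys_in_sum polys_in.mult)
next
  case (var v)
  then show ?case
    by (auto simp: coeff_pCons intro: polys_in.intros split: nat.splits)
next
  case (const c)
  then show ?case
    by (auto simp: coeff_pCons intro: polys_in.intros split: nat.splits)
qed (auto intro: polys_in.add)

lemma uni_eq_0_iff [simp]: "uni x f = 0 \<longleftrightarrow> f = 0"
  using poly_uni[of x f] by (metis poly_0 uni_simps(2))

lemma uni_sum_coeff: "f = (\<Sum>i\<le>degree (uni x f). coeff (uni x f) i * \<xi> x ^ i)"
  using poly_uni[of x f] by (simp add: poly_altdef)

lemma poly_eq_sum_le: "degree (q :: complex poly) \<le> n \<Longrightarrow> poly q a = (\<Sum>i\<le>n. coeff q i * a ^ i)"
  unfolding poly_altdef by (rule sum.mono_neutral_left) (auto simp: coeff_eq_0)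

text \<open>Induction on the variables: at a fixed choice of the other coordinates, the polynomial in x has all
  complex numbers as roots, so each of its coefficients vanishes there.\<close>
lemma eq_0_if_eval_at_eq_0_aux:
  assumes "finite V" "f \<in> polys_in V" "\<And>y. eval_at y f = 0"
  shows "f = 0"
  using assms
proof (induction V arbitrary: f rule: finite_induct)
  case empty
  then have "\<exists>c. f = cst c"
  proof -
    from \<open>f \<in> polys_in {}\<close> show ?thesis
      by (induction rule: polys_in.induct) (auto simp flip: cst_add cst_mult)
  qed
  then show ?case using empty(2) by auto
next
  case (insert x V)
  let ?c = "\<lambda>i. coeff (uni x f) i"
  have cV: "?c i \<in> polys_in V" for i
    using coeff_uni_in[OF insert.prems(1), of x i] insert.hyps(2) by (simp add: polys_in_mono)
  have "?c i = 0" for i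
  proof (rule insert.IH[OF cV])
    fix y
    define q where "q = Poly (map (\<lambda>i. eval_at y (?c i)) [0..<Suc (degree (uni x f))])"
    have coeff_q: "coeff q i = eval_at y (?c i)" for i
      by (auto simp: q_def nth_default_def coeff_eq_0 simp del: upt_Suc)
    have "poly q a = 0" for a
    proof -
      let ?y = "y(x := a)"
      have "eval_at ?y (?c i) = eval_at y (?c i)" for i
        using cV insert.hyps(2) by (intro eval_at_cong) auto
      moreover have "degree q \<le> degree (uni x f)"
        by (rule degree_le) (simp add: coeff_q coeff_eq_0)
      then have "poly q a = (\<Sum>i\<le>degree (uni x f). eval_at y (?c i) * a ^ i)"
        by (simp add: poly_eq_sum_le coeff_q)
      moreover have "eval_at ?y f = (\<Sum>i\<le>degree (uni x f). eval_at ?y (?c i) * a ^ i)"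
        by (subst uni_sum_coeff[of f x]) simp
      ultimately show ?thesis using insert.prems(2) by simp
    qed
    then have "q = 0" using poly_all_0_iff_0 by blast
    then show "eval_at y (?c i) = 0" using coeff_q[of i] by simp
  qed
  then show ?case by (subst uni_sum_coeff[of f x]) simp
qed

lemma eq_0_if_eval_at_eq_0: "(\<And>y. eval_at y f = 0) \<Longrightarrow> f = 0"
  by (rule eq_0_if_eval_at_eq_0_aux[of UNIV]) auto

text \<open>The locus where g is nonzero is dense: the product of g and f vanishes at every point.\<close>
lemma eq_0_if_eval_at_eq_0_dense:
  assumes "g \<noteq> 0" "\<And>y. eval_at y g \<noteq> 0 \<Longrightarrow> eval_at y f = 0"
  shows "f = 0"
proof -
  have "g * f = 0" by (rule eq_0_if_eval_at_eq_0) (use assms in auto)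
  with assms(1) show ?thesis by simp
qed

section \<open>The equations, their ideal and their points\<close>

lemma cpoly_numerals: "(2::cpoly) = 1 + 1" "(3::cpoly) = 1 + 1 + 1" "(4::cpoly) = 1 + 1 + (1 + 1)"
  by simp_all

text \<open>Numerals are split into sums of ones, so that after distribution both sides of an identity become
  literally the same sum of monomials.\<close>
lemmas ring_norm = algebra_simps power2_eq_square power3_eq_cube cpoly_numerals mult_1_left mult_1_right
  mult_minus_left mult_minus_right minus_minus add_uminus_conv_diff uminus_add_conv_diff
  diff_minus_eq_add minus_diff_eq minus_add_distrib

lemmas U_defs = U\<^sub>1_def U\<^sub>2_def U\<^sub>3_def
lemmas I_defs = I\<^sub>1_def I\<^sub>2_def I\<^sub>3_def
lemmas A_defs = A\<^sub>1_def A\<^sub>2_def A\<^sub>3_def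
lemmas minor_defs = \<alpha>_def \<beta>_def \<gamma>_def a\<^sub>0_def a\<^sub>1_def a\<^sub>2_def b\<^sub>0_def b\<^sub>1_def b\<^sub>2_def
lemmas F_defs = F\<^sub>1_def F\<^sub>2_def F\<^sub>3_def F\<^sub>4_def F\<^sub>5_def F\<^sub>6_def F\<^sub>7_def F\<^sub>8_def F\<^sub>9_def
  D_def U_defs I_defs A_defs
  minor_defs

definition m123 :: cpoly where
  "m123 = p2\<^sup>2 * p3 * t2 + p1 * p3 * u1 + p2 * p4 * u1 * t1 + p4 * u1\<^sup>2 - p1 * p2 * p4 * t2 - p1\<^sup>2 * u2
      - p2\<^sup>2 * u2 * t1 - p2 * u1 * u2"

definition m124 :: cpoly where
  "m124 = p2 * p3 * p4 * t2 + p3\<^sup>2 * u1 + p4\<^sup>2 * u1 * t1 + p4 * u1 * u2 - p1 * p4\<^sup>2 * t2 - p1 * p3 * u2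
      - p2 * p4 * u2 * t1 - p2 * u2\<^sup>2"

definition m125 :: cpoly where
  "m125 = p1 * p4 * u1 * t1 + p1 * p2 * p3 * t2 + p2\<^sup>2 * u2 * t2 + p1 * u1 * u2 - p2 * p3 * u1 * t1
      - p1\<^sup>2 * p4 * t2 - p2 * p4 * u1 * t2 - p3 * u1\<^sup>2"

definition m126 :: cpoly where
  "m126 = p2 * p3\<^sup>2 * t2 + p1 * p4 * u2 * t1 + p2 * p4 * u2 * t2 + p1 * u2\<^sup>2 - p1 * p3 * p4 * t2
      - p2 * p3 * u2 * t1 - p4\<^sup>2 * u1 * t2 - p3 * u1 * u2"

definition m135 :: cpoly where
  "m135 = p1\<^sup>2 * u1 * t1 + p2\<^sup>2 * u1 * t1\<^sup>2 + 2 * p2 * u1\<^sup>2 * t1 + u1 ^ 3 - p1 ^ 3 * t2 - p1 * p2\<^sup>2 * t1 * t2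
      - 3 * p1 * p2 * u1 * t2 - p2 ^ 3 * t2\<^sup>2"

definition m136 :: cpoly where
  "m136 = p1\<^sup>2 * u2 * t1 + p2\<^sup>2 * u2 * t1\<^sup>2 + 4 * p2 * u1 * u2 * t1 + 2 * p1 * p3 * u1 * t1
      + 2 * p2 * p4 * u1 * t1\<^sup>2 + 2 * p4 * u1\<^sup>2 * t1 + 3 * u1\<^sup>2 * u2 - 3 * p1\<^sup>2 * p3 * t2 - p2\<^sup>2 * p3 * t1 * t2
      - 3 * p2 * p3 * u1 * t2 - 2 * p1 * p2 * p4 * t1 * t2 - 3 * p1 * p4 * u1 * t2 - 3 * p1 * p2 * u2 * t2
      - 3 * p2\<^sup>2 * p4 * t2\<^sup>2"

definition m245 :: cpoly where
  "m245 = 2 * p1 * p3 * u2 * t1 + 2 * p2 * p4 * u2 * t1\<^sup>2 + 4 * p4 * u1 * u2 * t1 + 2 * p2 * u2\<^sup>2 * t1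
      + p3\<^sup>2 * u1 * t1 + p4\<^sup>2 * u1 * t1\<^sup>2 + 3 * u1 * u2\<^sup>2 - 3 * p1 * p3\<^sup>2 * t2 - 2 * p2 * p3 * p4 * t1 * t2
      - 3 * p3 * p4 * u1 * t2 - 3 * p2 * p3 * u2 * t2 - p1 * p4\<^sup>2 * t1 * t2 - 3 * p1 * p4 * u2 * t2
      - 3 * p2 * p4\<^sup>2 * t2\<^sup>2"

definition m246 :: cpoly where
  "m246 = p3\<^sup>2 * u2 * t1 + p4\<^sup>2 * u2 * t1\<^sup>2 + 2 * p4 * u2\<^sup>2 * t1 + u2 ^ 3 - p3 ^ 3 * t2 - p3 * p4\<^sup>2 * t1 * t2
      - 3 * p3 * p4 * u2 * t2 - p4 ^ 3 * t2\<^sup>2"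

lemmas m_defs = m123_def m124_def m125_def m126_def m135_def m136_def m245_def m246_def

text \<open>The equations F1, ..., F4 are affine in s, and their coefficients of s form a matrix with four rows
  and three columns. Up to sign, m126, m125, m124, m123 are the maximal minors of it, so the
  combination of F1, ..., F4 in D_F10 is free of s. It is divisible by D, and F10 is the quotient;
  by F10_eq it still lies in the ideal.\<close>
definition F10 :: cpoly where
  "F10 = t123 * m123 + t124 * m124 + t125 * m125 + t126 * m126 + t135 * m135 + t136 * m136 + t245 * m245
      + t246 * m246"

lemma F10_eq: "F10 = (p3 * t2 - u2 * t1) * F1 + (u1 * t1 - p1 * t2) * F2 + (p4 * t2) * F3 + (- (p2 * t2)) * F4
    + (- u2) * F5 + (u1) * F6"
  unfolding F10_def m_defs F_defs by (simp only: ring_norm)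

lemma D_F10: "D * F10 = m123 * F4 - m124 * F3 + m125 * F2 - m126 * F1"
  unfolding F10_def m_defs F_defs by (simp only: ring_norm)

text \<open>The next five identities say that F1, ..., F4 alone define the scheme where D is invertible.\<close>
lemma D_F5: "D * F5 = (p2 * p4 * t2 + p1 * u2) * F1 + (- (p1 * u1) - p2\<^sup>2 * t2) * F2 + (- (p1 * p3)
    - p2 * p4 * t1 - p2 * u2) * F3 + (p2 * u1 + p1\<^sup>2 + p2\<^sup>2 * t1) * F4"
  unfolding F_defs by (simp only: ring_norm)

lemma D_F6: "D * F6 = (p4\<^sup>2 * t2 + p3 * u2) * F1 + (- (p2 * p4 * t2) - p3 * u1) * F2 + (- (p4\<^sup>2 * t1) - p4 * u2
    - p3\<^sup>2) * F3 + (p4 * u1 + p1 * p3 + p2 * p4 * t1) * F4"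
  unfolding F_defs by (simp only: ring_norm)

lemma D_F7: "D * F7 = (p4 * s2 - p1 * p4 * t136 - p3 * p4 * t245 - p2 * p3 * t136 - p1 * p2 * t135) * F1
    + (- (p2 * s2) - p3 * p4 * t246 - p1 * p4 * t245 - p2 * p3 * t245 - p1 * p2 * t136) * F2
    + (2 * p2 * p4 * t136 + p4\<^sup>2 * t245 + p2\<^sup>2 * t135 - p4 * s1) * F3 + (p2\<^sup>2 * t136 + 2 * p2 * p4 * t245
    + p4\<^sup>2 * t246 + p2 * s1) * F4"
  unfolding F_defs by (simp only: ring_norm)

lemma D_F8: "D * F8 = (u2 * s1 + p2 * u2 * t136 + p4 * u2 * t245 + 2 * p2 * p4 * t1 * t136 + p4 * u1 * t136
    + p4\<^sup>2 * t1 * t245 + p2 * u1 * t135 + p2\<^sup>2 * t1 * t135 + p1 * p4 * t125 - p4 * s3 - p2 * p3 * t125) * F1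
    + (p2 * s3 + p1 * p4 * t126 + p2 * u2 * t245 + p4\<^sup>2 * t1 * t246 + p4 * u2 * t246 + p4 * u1 * t245
    + 2 * p2 * p4 * t1 * t245 + p2\<^sup>2 * t1 * t136 + p2 * u1 * t136 - u1 * s1 - p2 * p3 * t126) * F2
    + (p1 * p4 * t136 + p3 * p4 * t245 + p2 * p3 * t136 + p1 * p2 * t135 - p3 * s1) * F3 + (p1 * s1
    + p1 * p4 * t245 + p3 * p4 * t246 + p2 * p3 * t245 + p1 * p2 * t136) * F4"
  unfolding F_defs by (simp only: ring_norm)

lemma D_F9: "D * F9 = (u2 * s2 + 2 * p2 * p4 * t2 * t136 + p4\<^sup>2 * t2 * t245 + p1 * p4 * t123 + p2\<^sup>2 * t2 * t135
    - p2 * p3 * t123) * F1 + (2 * p2 * p4 * t2 * t245 + p4\<^sup>2 * t2 * t246 + p2\<^sup>2 * t2 * t136 + p1 * p4 * t124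
    - u1 * s2 - p2 * p3 * t124) * F2 + (p4 * u2 * t245 + p2 * u2 * t136 + p4 * u1 * t136 + p2 * u1 * t135
    - p4 * s3 - p3 * s2) * F3 + (p2 * s3 + p2 * u2 * t245 + p4 * u2 * t246 + p4 * u1 * t245 + p1 * s2
    + p2 * u1 * t136) * F4"
  unfolding F_defs by (simp only: ring_norm)

text \<open>In the identity D_F7 the coefficients of F3 and F4 are Q0 - p4 s1 and Q1 + p2 s1. Where D, F1, F2
  and F7 vanish it becomes a linear relation between F3 and F4. Together with p4 F3 = p2 F4 it forms
  a linear system whose determinant is C3 up to sign.\<close>
definition Q0 :: cpoly where "Q0 = p2\<^sup>2 * t135 + 2 * p2 * p4 * t136 + p4\<^sup>2 * t245"

definition Q1 :: cpoly where "Q1 = p2\<^sup>2 * t136 + 2 * p2 * p4 * t245 + p4\<^sup>2 * t246"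

text \<open>The next four identities play the same role on the divisor D = 0: once p4 and C3 are invertible
  there, the equations F1, F2, F7 and p4 F3 = p2 F4 imply the others.\<close>
lemma p4_F5: "p4 * F5 = (u2) * F1 + (- u1) * F2 + (- p3) * F3 + (p1) * F4 + (p2) * F6"
  unfolding F_defs by (simp only: ring_norm)

lemma p4_F8: "p4 * F8 = (- (p3 * t136) - p1 * t135) * F1 + (- s2 - p1 * t136 - p3 * t245) * F2 + (p4 * t136
    + p2 * t135) * F3 + (s1 + p2 * t136 + p4 * t245) * F4 + (p3) * F7"
  unfolding F_defs by (simp only: ring_norm)

lemma p4_F9: "p4 * F9 = (p4 * t123 - u2 * t136) * F1 + (u1 * t136 - s3 - p2 * t123) * F2 + (- (p1 * t135)
    - p4 * t125) * F3 + (s2 + p2 * t125 - 2 * p1 * t136 - p3 * t245) * F4 + (2 * p4 * t136 + p2 * t135) * F5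
    + (p4 * t245) * F6 + (u2) * F7"
  unfolding F_defs by (simp only: ring_norm)

lemma syz_F5_F6: "(p2 * s1 + Q1) * F6 - (p4 * s1 - Q0) * F5 = (- (u2 * s1) - p4 * s3 - p4\<^sup>2 * t124
    - p2 * p4 * t123) * F1 + (u1 * s1 + p2 * s3 + p2 * p4 * t124 + p2\<^sup>2 * t123) * F2 + (p4 * s2 + p4\<^sup>2 * t126
    + p1 * p4 * t136 + p3 * s1 + p3 * p4 * t245 + p2 * p3 * t136 + p1 * p2 * t135 + p2 * p4 * t125) * F3
    + (p1 * p4 * t245 + p3 * p4 * t246 + p2 * p3 * t245 + p1 * p2 * t136 - p1 * s1 - p2 * p4 * t126 - p2 * s2
    - p2\<^sup>2 * t125) * F4 + (p4 * u1 - p2 * u2) * F7"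
  unfolding Q0_def Q1_def F_defs by (simp only: ring_norm)

definition C3 :: cpoly where "C3 = p2 * Q0 + p4 * Q1"

lemma cpoly_ring_simps [simp]:
  "carrier cpoly_ring = UNIV" "x \<oplus>\<^bsub>cpoly_ring\<^esub> y = x + y" "x \<otimes>\<^bsub>cpoly_ring\<^esub> y
      = x * y"
  "\<zero>\<^bsub>cpoly_ring\<^esub> = 0" "\<one>\<^bsub>cpoly_ring\<^esub> = 1"
  by (simp_all add: cpoly_ring_def ring_of_type_algebra_def)

lemma cring_cpoly_ring: "cring cpoly_ring"
  unfolding cpoly_ring_def by (rule cring_from_type_algebra)

lemma ideal_cpoly_ringI:
  assumes "0 \<in> J" "\<And>f g. f \<in> J \<Longrightarrow> g \<in> J \<Longrightarrow> f + g \<in> J" "\<And>f g. f \<in> J \<Longrightarrow> g * f \<in> J"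
  shows "ideal J cpoly_ring"
proof -
  interpret R: cring cpoly_ring by (rule cring_cpoly_ring)
  have inv: "\<ominus>\<^bsub>cpoly_ring\<^esub> x = - x" for x
    by (rule R.minus_equality) simp_all
  have neg: "inv\<^bsub>add_monoid cpoly_ring\<^esub> x \<in> J" if "x \<in> J" for x
    using assms(3)[OF that, of "-1"] inv[of x] by (simp only: a_inv_def) simp
  show ?thesis
  proof (rule idealI)
    show "ring cpoly_ring" by (rule R.ring_axioms)
    show "subgroup J (add_monoid cpoly_ring)"
      by (rule group.subgroupI[OF R.a_group]) (use assms neg in auto)
  qed (use assms(3) in \<open>auto simp: mult.commute\<close>)
qed

lemma ideal_Pi: "ideal ideal_\<Pi> cpoly_ring"
proof -
  interpret R: cring cpoly_ring by (rule cring_cpoly_ring)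
  show ?thesis unfolding ideal_\<Pi>_def by (rule R.genideal_ideal) simp
qed

lemma ideal_Pi_0 [simp]: "0 \<in> ideal_\<Pi>"
  using additive_subgroup.zero_closed[OF ideal.axioms(1)[OF ideal_Pi]] by simp

lemma ideal_Pi_add: "f \<in> ideal_\<Pi> \<Longrightarrow> g \<in> ideal_\<Pi> \<Longrightarrow> f + g \<in> ideal_\<Pi>"
  using additive_subgroup.a_closed[OF ideal.axioms(1)[OF ideal_Pi]] by simp

lemma ideal_Pi_mult: "f \<in> ideal_\<Pi> \<Longrightarrow> g * f \<in> ideal_\<Pi>"
  using ideal.I_l_closed[OF ideal_Pi] by simp

lemma ideal_Pi_mult_right: "f \<in> ideal_\<Pi> \<Longrightarrow> f * g \<in> ideal_\<Pi>"
  by (metis ideal_Pi_mult mult.commute)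

lemma ideal_Pi_uminus: "f \<in> ideal_\<Pi> \<Longrightarrow> - f \<in> ideal_\<Pi>"
  using ideal_Pi_mult[of f "-1"] by simp

lemma ideal_Pi_diff: "f \<in> ideal_\<Pi> \<Longrightarrow> g \<in> ideal_\<Pi> \<Longrightarrow> f - g \<in> ideal_\<Pi>"
  using ideal_Pi_add[of f "- g"] by (simp add: ideal_Pi_uminus)

lemmas ideal_Pi_intros = ideal_Pi_add ideal_Pi_diff ideal_Pi_uminus ideal_Pi_mult ideal_Pi_mult_right

lemma F_in_ideal_Pi:
  "equations \<subseteq> ideal_\<Pi>"
proof -
  interpret R: cring cpoly_ring by (rule cring_cpoly_ring)
  show ?thesis unfolding ideal_\<Pi>_def by (rule R.genideal_self) simp
qed

lemma ideal_Pi_induct: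
  assumes "f \<in> ideal_\<Pi>"
    and "\<And>F. F \<in> equations \<Longrightarrow> P F"
    and "P 0" "\<And>f g. P f \<Longrightarrow> P g \<Longrightarrow> P (f + g)" "\<And>f g. P f \<Longrightarrow> P (g * f)"
  shows "P f"
proof -
  interpret R: cring cpoly_ring by (rule cring_cpoly_ring)
  have "ideal (Collect P) cpoly_ring"
    by (rule ideal_cpoly_ringI) (use assms(3-5) in auto)
  from R.genideal_minimal[OF this] have "ideal_\<Pi> \<subseteq> Collect P"
    unfolding ideal_\<Pi>_def using assms(2) by blast
  with assms(1) show ?thesis by blast
qed

lemma F10_in_ideal: "F10 \<in> ideal_\<Pi>"
  unfolding F10_eq using F_in_ideal_Pi by (auto intro!: ideal_Pi_add ideal_Pi_diff ideal_Pi_mult)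

definition on_\<Pi> :: "(coord \<Rightarrow> complex) \<Rightarrow> bool" where
  "on_\<Pi> y \<longleftrightarrow> (\<forall>F\<in>equations. eval_at y F = 0)"

lemma eval_at_ideal_Pi: "f \<in> ideal_\<Pi> \<Longrightarrow> on_\<Pi> y \<Longrightarrow> eval_at y f = 0"
  by (erule ideal_Pi_induct[where P = "\<lambda>f. eval_at y f = 0"]) (auto simp: on_\<Pi>_def)

lemma on_Pi_if_D_neq_0:
  assumes "eval_at y D \<noteq> 0" "eval_at y F1 = 0" "eval_at y F2 = 0" "eval_at y F3 = 0" "eval_at y F4 = 0"
  shows "on_\<Pi> y"
proof -
  have "eval_at y F = 0" if "D * F = c1 * F1 + c2 * F2 + c3 * F3 + c4 * F4" for F c1 c2 c3 c4
    using arg_cong[OF that, of "eval_at y"] assms by simp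
  from this[OF D_F5] this[OF D_F6] this[OF D_F7] this[OF D_F8] this[OF D_F9] assms
  show ?thesis by (simp add: on_\<Pi>_def)
qed

text \<open>The unknowns F3, F4 satisfy two homogeneous linear equations with determinant C3 up to sign, by D_F7
  and the hypothesis; so do F5, F6, by syz_F5_F6 and p4_F5. Then F8 and F9 vanish by p4_F8 and
  p4_F9.\<close>
lemma on_Pi_if_D_eq_0:
  assumes D: "eval_at y D = 0" and p4: "y Vp4 \<noteq> 0" and C3: "eval_at y C3 \<noteq> 0"
    and F: "eval_at y F1 = 0" "eval_at y F2 = 0" "eval_at y F7 = 0" and F34: "y Vp4 * eval_at y F3
        = y Vp2 * eval_at y F4"
  shows "on_\<Pi> y"
proof -
  define w0 w1 where "w0 = y Vp4 * y Vs1 - eval_at y Q0" and "w1 = y Vp2 * y Vs1 + eval_at y Q1"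
  have C3_eq: "eval_at y C3 = y Vp4 * w1 - y Vp2 * w0"
    by (simp add: C3_def w0_def w1_def algebra_simps)
  have "w1 * eval_at y F4 = w0 * eval_at y F3"
    using arg_cong[OF D_F7, of "eval_at y"] D F
    by (simp add: w0_def w1_def Q0_def Q1_def algebra_simps power2_eq_square)
  then have "eval_at y C3 * eval_at y F4 = w0 * (y Vp4 * eval_at y F3 - y Vp2 * eval_at y F4)"
    by (simp add: C3_eq algebra_simps)
  then have F4: "eval_at y F4 = 0" using C3 F34 by simp
  then have F3: "eval_at y F3 = 0" using F34 p4 by simp
  have F56: "y Vp4 * eval_at y F5 = y Vp2 * eval_at y F6"
    using arg_cong[OF p4_F5, of "eval_at y"] F F3 F4 by simp
  have "w1 * eval_at y F6 = w0 * eval_at y F5"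
    using arg_cong[OF syz_F5_F6, of "eval_at y"] F F3 F4
    by (simp add: w0_def w1_def)
  then have "eval_at y C3 * eval_at y F6 = w0 * (y Vp4 * eval_at y F5 - y Vp2 * eval_at y F6)"
    by (simp add: C3_eq algebra_simps)
  then have F6: "eval_at y F6 = 0" using C3 F56 by simp
  then have F5: "eval_at y F5 = 0" using F56 p4 by simp
  have F8: "eval_at y F8 = 0"
    using arg_cong[OF p4_F8, of "eval_at y"] F F3 F4 F5 F6 p4 by simp
  have F9: "eval_at y F9 = 0"
    using arg_cong[OF p4_F9, of "eval_at y"] F F3 F4 F5 F6 F8 p4 by simp
  show ?thesis using F F3 F4 F5 F6 F8 F9 by (simp add: on_\<Pi>_def)
qed

section \<open>Regular elements from leading coefficients\<close>

text \<open>The coefficients of k are shown to be in J from the highest one downwards. In degree n + i, the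
  product of F and k has the leading coefficient of F times the i-th coefficient of k, plus terms
  that contain higher coefficients of k.\<close>
lemma top_coeff_regular:
  assumes J: "0 \<in> J" "\<And>f g. f \<in> J \<Longrightarrow> g \<in> J \<Longrightarrow> f - g \<in> J" "\<And>f g. f \<in> J \<Longrightarrow> g * f \<in> J"
    and J_coeff: "\<And>f i. f \<in> J \<Longrightarrow> coeff (uni x f) i \<in> J"
    and F: "degree (uni x F) \<le> n" "\<And>y. coeff (uni x F) n * y \<in> J \<Longrightarrow> y \<in> J"
    and Fk: "F * k \<in> J"
  shows "k \<in> J"
proof -
  let ?F = "coeff (uni x F)" and ?k = "coeff (uni x k)"
  have J_sum: "sum f S \<in> J" if "\<And>i. i \<in> S \<Longrightarrow> f i \<in> J" for f :: "nat \<Rightarrow> cpoly" and S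
    using that
  proof (induction S rule: infinite_finite_induct)
    case (insert i S)
    \<comment> \<open>sums have to be expressed by differences, under which J is closed\<close>
    then have "f i - (- 1) * sum f S \<in> J" by (intro J) auto
    with insert show ?case by simp
  qed (use J(1) in auto)
  have "?k i \<in> J" for i
  proof (induction "degree (uni x k) - i" arbitrary: i rule: less_induct)
    case less
    show ?case
    proof (cases "i \<le> degree (uni x k)")
      case False
      then show ?thesis using J(1) by (simp add: coeff_eq_0)
    next
      case True
      have higher: "?k j \<in> J" if "j > i" for j
        using less[of j] that True J(1)
        by (cases "j \<le> degree (uni x k)") (auto simp: coeff_eq_0)
      have "coeff (uni x (F * k)) (n + i) = (\<Sum>j\<le>n+i. ?F j * ?k (n + i - j))"
        by (simp add: coeff_mult)
      also have "\<dots> = ?F n * ?k i + (\<Sum>j\<in>{..n+i}-{n}. ?F j * ?k (n + i - j))"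
        by (subst sum.remove[of _ n]) auto
      finally have "?F n * ?k i = coeff (uni x (F * k)) (n + i) - (\<Sum>j\<in>{..n+i}-{n}. ?F j * ?k (n + i - j))"
        by simp
      also have "\<dots> \<in> J"
      proof (intro J(2) J_sum)
        show "coeff (uni x (F * k)) (n + i) \<in> J" by (rule J_coeff[OF Fk])
        fix j assume "j \<in> {..n + i} - {n}"
        then consider "j < n" | "n < j" "j \<le> n + i" by force
        then show "?F j * ?k (n + i - j) \<in> J"
        proof cases
          case 1
          then show ?thesis by (intro J(3) higher) auto
        next
          case 2
          then have "?F j = 0" using F(1) by (simp add: coeff_eq_0)
          then show ?thesis using J(1) by simp
        qed
      qed
      finally show ?thesis by (rule F(2))
    qed
  qed
  then have "(\<Sum>i\<le>degree (uni x k). ?k i * \<xi> x ^ i) \<in> J"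
    by (intro J_sum) (subst mult.commute, rule J(3), simp)
  then show ?thesis by (subst uni_sum_coeff[of k x])
qed

definition span2 :: "cpoly \<Rightarrow> cpoly \<Rightarrow> cpoly set" where
  "span2 a b = {a * y + b * z |y z. True}"

lemma span2I: "f = a * y + b * z \<Longrightarrow> f \<in> span2 a b"
  by (auto simp: span2_def)

lemma span2_0 [simp]: "0 \<in> span2 a b"
  by (rule span2I[of _ _ 0 _ 0]) simp

lemma span2_diff: "f \<in> span2 a b \<Longrightarrow> g \<in> span2 a b \<Longrightarrow> f - g \<in> span2 a b"
  unfolding span2_def
proof clarsimp
  fix y z y' z'
  show "\<exists>c d. a * y + b * z - (a * y' + b * z') = a * c + b * d"
    by (rule exI[of _ "y - y'"], rule exI[of _ "z - z'"]) (simp add: algebra_simps)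
qed

lemma span2_mult: "f \<in> span2 a b \<Longrightarrow> g * f \<in> span2 a b"
  unfolding span2_def
proof clarsimp
  fix y z
  show "\<exists>c d. g * (a * y + b * z) = a * c + b * d"
    by (rule exI[of _ "g * y"], rule exI[of _ "g * z"]) (simp add: algebra_simps)
qed

lemma coeff_uni_mult_free:
  "a \<in> polys_in (- {x}) \<Longrightarrow> coeff (uni x (a * f)) i = a * coeff (uni x f) i"
  by (simp add: uni_free)

lemma span2_coeff:
  assumes "a \<in> polys_in (- {x})" "b \<in> polys_in (- {x})" "f \<in> span2 a b"
  shows "coeff (uni x f) i \<in> span2 a b"
proof -
  from assms(3) obtain y z where "f = a * y + b * z" by (auto simp: span2_def)
  then have "coeff (uni x f) i = a * coeff (uni x y) i + b * coeff (uni x z) i"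
    by (simp add: coeff_uni_mult_free[OF assms(1)] coeff_uni_mult_free[OF assms(2)] del: uni_simps(3))
  then show ?thesis by (rule span2I)
qed

lemma top_coeff_regular_span2:
  assumes "a \<in> polys_in (- {x})" "b \<in> polys_in (- {x})"
    and "degree (uni x F) \<le> n" "\<And>y. coeff (uni x F) n * y \<in> span2 a b \<Longrightarrow> y \<in> span2 a b"
    and "F * k \<in> span2 a b"
  shows "k \<in> span2 a b"
  by (rule top_coeff_regular[where J = "span2 a b" and x = x, OF _ _ _ _ assms(3-5)])
     (simp_all add: span2_diff span2_mult span2_coeff assms(1,2))

lemma in_span2_0_iff: "f \<in> span2 a 0 \<longleftrightarrow> a dvd f"
  by (auto simp: span2_def dvd_def)

lemma top_coeff_regular_dvd:
  assumes "a \<in> polys_in (- {x})"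
    and "degree (uni x F) \<le> n" "\<And>y. a dvd coeff (uni x F) n * y \<Longrightarrow> a dvd y"
    and "a dvd F * k"
  shows "a dvd k"
  by (rule top_coeff_regular_span2[of a x 0 F n k, unfolded in_span2_0_iff])
     (fact assms(1), simp, fact assms(2), erule assms(3), fact assms(4))

lemma coeff_0_uni_eq_0_imp:
  assumes "coeff (uni v k) 0 = 0"
  obtains k' where "k = \<xi> v * k'"
proof -
  obtain q where "uni v k = pCons 0 q"
    using assms by (cases "uni v k") auto
  then have "k = \<xi> v * poly q (\<xi> v)"
    using poly_uni[of v k] by simp
  then show ?thesis by (rule that)
qed

lemma D_in: "Vp1 \<in> V \<Longrightarrow> Vp2 \<in> V \<Longrightarrow> Vp3 \<in> V \<Longrightarrow> Vp4 \<in> V \<Longrightarrow> D \<in> polys_in V"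
  unfolding D_def by (intro polys_in_intros)

lemma coord_poly_neq_0 [simp]: "\<xi> v \<noteq> 0"
proof
  assume "\<xi> v = 0"
  then have "eval_at (\<lambda>_. 1) (\<xi> v) = eval_at (\<lambda>_. 1) 0" by (rule arg_cong)
  then show False by simp
qed

lemma D_neq_0: "D \<noteq> 0"
proof
  assume "D = 0"
  then have "eval_at (\<lambda>v. if v = Vp1 \<or> v = Vp4 then 1 else 0) D = 0" by simp
  then show False by (simp add: D_def)
qed

text \<open>At p4 = 0 the polynomial D becomes - p2 p3, which is not zero. A multiple D k that is divisible by
  p4 therefore has k divisible by p4.\<close>
lemma D_dvd_p4_mult: "D dvd p4 * y \<Longrightarrow> D dvd y"
proof -
  assume "D dvd p4 * y"
  then obtain k where k: "p4 * y = D * k" by (auto simp: dvd_def)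
  have "coeff (uni Vp4 (D * k)) 0 = - (p2 * p3) * coeff (uni Vp4 k) 0"
    by (simp add: D_def coeff_mult_0)
  moreover have "coeff (uni Vp4 (p4 * y)) 0 = 0" by simp
  ultimately have "coeff (uni Vp4 k) 0 = 0"
    using k by simp
  then obtain k' where "k = p4 * k'" by (rule coeff_0_uni_eq_0_imp)
  with k have "p4 * (y - D * k') = 0" by (simp add: algebra_simps)
  then have "y = D * k'" by simp
  then show ?thesis by simp
qed

text \<open>The divisor D = 0 will be studied on the open set where E is nonzero.\<close>
definition E :: cpoly where "E = p4 * C3"

text \<open>The leading coefficient in t246 is a power of p4.\<close>
lemma D_dvd_affine_t246_mult:
  assumes "A \<in> polys_in (- {Vt246})" "D dvd (A + t246 * p4 ^ 4) * y"
  shows "D dvd y"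
proof (rule top_coeff_regular_dvd[OF _ _ _ assms(2)])
  have u: "uni Vt246 (A + t246 * p4 ^ 4) = [:A, p4 ^ 4:]"
    using uni_free[OF assms(1), of Vt246]
    by (simp add: uni_free[of "p4 ^ 4" "{Vp4}"] polys_in_intros power4_eq_xxxx)
  show "degree (uni Vt246 (A + t246 * p4 ^ 4)) \<le> 1" by (simp only: u) simp
  fix z assume "D dvd coeff (uni Vt246 (A + t246 * p4 ^ 4)) 1 * z"
  then have "D dvd p4 * (p4 * (p4 * (p4 * z)))"
    by (simp only: u) (simp add: power4_eq_xxxx mult.assoc)
  then show "D dvd z" by (rule D_dvd_p4_mult[OF D_dvd_p4_mult[OF D_dvd_p4_mult[OF D_dvd_p4_mult]]])
qed (auto intro: D_in)

text \<open>The value of E at t135 = 0.\<close>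
definition E0 :: cpoly where "E0 = p4\<^sup>2 * (3 * t136 * p2\<^sup>2 + 3 * t245 * p2 * p4 + t246 * p4\<^sup>2)"

lemma E_in_t135: "E = E0 + t135 * (p4 * p2 ^ 3)"
  unfolding E_def C3_def Q0_def Q1_def E0_def by (simp only: ring_norm)

lemma E0_in_t246: "E0 = 3 * p4\<^sup>2 * (t136 * p2\<^sup>2 + t245 * p2 * p4) + t246 * p4 ^ 4"
  unfolding E0_def by (simp only: ring_norm power4_eq_xxxx)

lemma E_in_t246: "E = (3 * p4\<^sup>2 * (t136 * p2\<^sup>2 + t245 * p2 * p4) + t135 * (p4 * p2 ^ 3)) + t246 * p4 ^ 4"
  unfolding E_in_t135 E0_in_t246 by simp

lemma D_dvd_E0_mult: "D dvd E0 * y \<Longrightarrow> D dvd y"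
  unfolding E0_in_t246
  by (erule D_dvd_affine_t246_mult[rotated]) (intro polys_in_intros; simp)

lemma D_dvd_E_mult: "D dvd E * y \<Longrightarrow> D dvd y"
  unfolding E_in_t246
  by (erule D_dvd_affine_t246_mult[rotated]) (intro polys_in_intros; simp)

lemma E_in: "{Vp2, Vp4, Vt135, Vt136, Vt245, Vt246} \<subseteq> V \<Longrightarrow> E \<in> polys_in V"
  unfolding E_in_t246 by (intro polys_in_intros; simp)

text \<open>Suppose t135 y = D a + E b and set t135 = 0. Then E becomes E0, which is regular modulo D, so the
  constant terms of a and b form a trivial relation: they are - E0 d and D d for some d. Adding d
  times the trivial relation between D and E makes both cofactors divisible by t135.\<close>
lemma t135_regular:
  assumes "t135 * y \<in> span2 D E"
  shows "y \<in> span2 D E"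
proof -
  from assms obtain a b where ab: "t135 * y = D * a + E * b" by (auto simp: span2_def)
  let ?c = "\<lambda>f i. coeff (uni Vt135 f) i"
  have uE: "uni Vt135 E = [:E0, p4 * p2 ^ 3:]"
  proof -
    have "uni Vt135 E0 = [:E0:]"
      by (rule uni_free[of _ "- {Vt135}"]) (auto simp: E0_def intro!: polys_in_intros)
    moreover have "uni Vt135 (p4 * p2 ^ 3) = [:p4 * p2 ^ 3:]"
      by (rule uni_free[of _ "- {Vt135}"]) (auto intro!: polys_in_intros)
    ultimately show ?thesis by (simp add: E_in_t135 del: uni_simps(9))
  qed
  have uD: "uni Vt135 D = [:D:]"
    by (rule uni_free[of _ "- {Vt135}"]) (auto intro: D_in)
  have "?c (t135 * y) 0 = ?c (D * a + E * b) 0" by (simp only: ab)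
  then have "0 = D * ?c a 0 + E0 * ?c b 0"
    by (simp add: uD uE coeff_mult_0)
  then have eq0: "E0 * ?c b 0 = D * (- ?c a 0)" by (simp add: add_eq_0_iff)
  then have "D dvd ?c b 0" by (metis D_dvd_E0_mult dvd_triv_left)
  then obtain d where d: "?c b 0 = D * d" by (auto simp: dvd_def)
  from eq0 d have "D * (?c a 0 + E0 * d) = 0" by (simp add: algebra_simps)
  with D_neq_0 have a0: "?c a 0 = - E0 * d" by (simp add: add_eq_0_iff2)
  obtain a1 where a1: "a - ?c a 0 = t135 * a1"
    by (rule coeff_0_uni_eq_0_imp[of Vt135 "a - ?c a 0"])
       (use uni_free[OF coeff_uni_in[of a UNIV Vt135 0]] in auto)
  obtain b1 where b1: "b - ?c b 0 = t135 * b1"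
    by (rule coeff_0_uni_eq_0_imp[of Vt135 "b - ?c b 0"])
       (use uni_free[OF coeff_uni_in[of b UNIV Vt135 0]] in auto)
  have a_eq: "a = t135 * a1 - E0 * d" and b_eq: "b = t135 * b1 + D * d"
    using a1 b1 unfolding a0 d by (simp_all add: algebra_simps)
  have "t135 * y = D * (t135 * a1 - E0 * d) + E * (t135 * b1 + D * d)"
    by (simp only: ab a_eq b_eq)
  also have "\<dots> = t135 * (D * (a1 + p4 * p2 ^ 3 * d) + E * b1)"
    by (simp add: E_in_t135 algebra_simps)
  finally have "y = D * (a1 + p4 * p2 ^ 3 * d) + E * b1" by simp
  then show ?thesis by (rule span2I)
qed

lemma t135_regular_D: "D dvd t135 * y \<Longrightarrow> D dvd y"
  by (rule top_coeff_regular_dvd[of D Vt135 "t135" 1 y]) (auto intro: D_in)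

text \<open>Applied to an explicit polynomial and an unknown bound, these rules compute a bound.\<close>
lemma degree_uni_bounds:
  "degree (uni x f) \<le> a \<Longrightarrow> degree (uni x g) \<le> b \<Longrightarrow> degree (uni x (f + g)) \<le> max a b"
  "degree (uni x f) \<le> a \<Longrightarrow> degree (uni x g) \<le> b \<Longrightarrow> degree (uni x (f - g)) \<le> max a b"
  "degree (uni x f) \<le> a \<Longrightarrow> degree (uni x (- f)) \<le> a"
  "degree (uni x f) \<le> a \<Longrightarrow> degree (uni x g) \<le> b \<Longrightarrow> degree (uni x (f * g)) \<le> a + b"
  "degree (uni x f) \<le> a \<Longrightarrow> degree (uni x (f ^ n)) \<le> a * n"
  "degree (uni x (\<xi> v)) \<le> (if v = x then 1 else 0)"
  "degree (uni x (numeral k)) \<le> 0"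
proof -
  show "degree (uni x f) \<le> a \<Longrightarrow> degree (uni x g) \<le> b \<Longrightarrow> degree (uni x (f * g)) \<le> a + b"
    unfolding uni_simps by (rule order_trans[OF degree_mult_le add_mono])
  show "degree (uni x f) \<le> a \<Longrightarrow> degree (uni x (f ^ n)) \<le> a * n"
    unfolding uni_simps by (rule order_trans[OF degree_power_le mult_right_mono]) simp_all
qed (auto intro: degree_add_le degree_diff_le)

text \<open>The form in which leading coefficients are read off: only the leading term has to be separated.\<close>
lemma uni_top:
  assumes F: "F = c * \<xi> x ^ n + R" and c: "c \<in> polys_in (- {x})" and R: "degree (uni x R) < n"
  shows "degree (uni x F) \<le> n" "coeff (uni x F) n = c"
proof -
  have "uni x c = [:c:]" by (rule uni_free[OF c]) simp
  then have u: "uni x F = monom c n + uni x R" by (simp add: F monom_altdef)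
  show "coeff (uni x F) n = c" using R by (simp add: u coeff_eq_0)
  show "degree (uni x F) \<le> n"
    unfolding u using R by (intro degree_add_le) (simp_all add: degree_monom_le)
qed

lemma m135_in_u1:
  obtains R where "m135 = u1 ^ 3 + R" "degree (uni Vu1 R) \<le> 2"
proof (rule that)
  let ?R = "p1\<^sup>2 * u1 * t1 + p2\<^sup>2 * u1 * t1\<^sup>2 + 2 * p2 * u1\<^sup>2 * t1 - p1 ^ 3 * t2
    - p1 * p2\<^sup>2 * t1 * t2 - 3 * p1 * p2 * u1 * t2 - p2 ^ 3 * t2\<^sup>2"
  show "m135 = u1 ^ 3 + ?R" unfolding m135_def by simp
  show "degree (uni Vu1 ?R) \<le> 2" by (rule order_trans, (rule degree_uni_bounds)+, simp)
qed

lemma uni_u1_m135: "degree (uni Vu1 m135) \<le> 3" "coeff (uni Vu1 m135) 3 = 1"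
proof -
  obtain R where R: "m135 = u1 ^ 3 + R" "degree (uni Vu1 R) \<le> 2" by (rule m135_in_u1)
  show "degree (uni Vu1 m135) \<le> 3" "coeff (uni Vu1 m135) 3 = 1"
    by (rule uni_top[of m135 1 Vu1 3 R]; use R in simp)+
qed

lemma uni_u1_F10: "degree (uni Vu1 F10) \<le> 3" "coeff (uni Vu1 F10) 3 = t135"
proof -
  obtain R where R: "m135 = u1 ^ 3 + R" "degree (uni Vu1 R) \<le> 2" by (rule m135_in_u1)
  let ?S = "t123 * m123 + t124 * m124 + t125 * m125 + t126 * m126 + t135 * R
    + t136 * m136 + t245 * m245 + t246 * m246"
  have eq: "F10 = t135 * u1 ^ 3 + ?S" unfolding F10_def R(1) by (simp add: algebra_simps)
  have deg: "degree (uni Vu1 ?S) < 3"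
    unfolding m_defs by (rule le_less_trans, (rule degree_uni_bounds R(2))+, simp)
  show "degree (uni Vu1 F10) \<le> 3" "coeff (uni Vu1 F10) 3 = t135"
    by (rule uni_top[OF eq _ deg]; simp add: polys_in.var)+
qed

text \<open>As a polynomial in u1, F10 has leading coefficient t135, while D and E do not involve u1. So
  regularity of F10 modulo D, and modulo D and E, follows from that of t135.\<close>
lemma D_dvd_F10_mult:
  assumes "D dvd F10 * k"
  shows "D dvd k"
proof (rule top_coeff_regular_dvd[OF _ uni_u1_F10(1) _ assms])
  show "D \<in> polys_in (- {Vu1})" by (rule D_in) auto
  show "D dvd y" if "D dvd coeff (uni Vu1 F10) 3 * y" for y
    using that unfolding uni_u1_F10 by (rule t135_regular_D)
qed

lemma F10_regular_span2:
  assumes "F10 * k \<in> span2 D E"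
  shows "k \<in> span2 D E"
proof (rule top_coeff_regular_span2[OF _ _ uni_u1_F10(1) _ assms])
  show "D \<in> polys_in (- {Vu1})" by (rule D_in) auto
  show "E \<in> polys_in (- {Vu1})" by (rule E_in) auto
  show "y \<in> span2 D E" if "coeff (uni Vu1 F10) 3 * y \<in> span2 D E" for y
    using that unfolding uni_u1_F10 by (rule t135_regular)
qed

text \<open>The coefficients m135 and m246 of F10 involve different variables u: the first is monic in u1, the
  second is free of u1.\<close>
lemma m246_dvd_m135_mult: "m246 dvd m135 * y \<Longrightarrow> m246 dvd y"
proof (rule top_coeff_regular_dvd[of m246 Vu1 m135 3 y])
  show "m246 dvd coeff (uni Vu1 m135) 3 * z \<Longrightarrow> m246 dvd z" for z by (simp add: uni_u1_m135)
  show "m246 \<in> polys_in (- {Vu1})"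
    unfolding m246_def by (intro polys_in_intros; simp)
qed (rule uni_u1_m135)

lemma m246_dvd_F10_mult: "m246 dvd F10 * y \<Longrightarrow> m246 dvd y"
proof (rule top_coeff_regular_dvd[of m246 Vt135 F10 1 y])
  let ?R = "t123 * m123 + t124 * m124 + t125 * m125 + t126 * m126 + t136 * m136
    + t245 * m245 + t246 * m246"
  have F10: "F10 = m135 * t135 ^ 1 + ?R" by (simp add: F10_def)
  have m135: "m135 \<in> polys_in (- {Vt135})"
    unfolding m135_def by (intro polys_in_intros; simp)
  have R: "degree (uni Vt135 ?R) < 1"
    unfolding m_defs by (rule le_less_trans, (rule degree_uni_bounds)+, simp)
  show "degree (uni Vt135 F10) \<le> 1" by (rule uni_top[OF F10 m135 R])
  have "coeff (uni Vt135 F10) 1 = m135" by (rule uni_top[OF F10 m135 R])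
  then show "m246 dvd z" if "m246 dvd coeff (uni Vt135 F10) 1 * z" for z
    using that m246_dvd_m135_mult[of z] by simp
  show "m246 \<in> polys_in (- {Vt135})"
    unfolding m246_def by (intro polys_in_intros; simp)
qed

section \<open>The equations as rewrite rules\<close>

text \<open>The fourteen coordinates p and t. The ring of polynomials in them is called B in these comments.\<close>
definition base_vars :: "coord set" where
  "base_vars = - {Vu1, Vu2, Vs1, Vs2, Vs3}"

text \<open>The B-submodule generated by G.\<close>
inductive_set base_span :: "cpoly set \<Rightarrow> cpoly set" for G where
  gen: "g \<in> G \<Longrightarrow> g \<in> base_span G"
| add: "f \<in> base_span G \<Longrightarrow> g \<in> base_span G \<Longrightarrow> f + g \<in> base_span G"
| scale: "b \<in> polys_in base_vars \<Longrightarrow> f \<in> base_span G \<Longrightarrow> b * f \<in> base_span G"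

lemma base_span_uminus: "f \<in> base_span G \<Longrightarrow> - f \<in> base_span G"
  using base_span.scale[of "-1" f G] polys_in_uminus[OF polys_in_1] by simp

lemma base_span_diff: "f \<in> base_span G \<Longrightarrow> g \<in> base_span G \<Longrightarrow> f - g \<in> base_span G"
  using base_span.add[of f G "- g"] base_span_uminus by simp

lemma base_span_mono: "f \<in> base_span G \<Longrightarrow> G \<subseteq> H \<Longrightarrow> f \<in> base_span H"
  by (induction rule: base_span.induct) (auto intro: base_span.intros)

lemma base_span_base:
  assumes "b \<in> polys_in base_vars" "1 \<in> G"
  shows "b \<in> base_span G"
  using base_span.scale[OF assms(1) base_span.gen[OF assms(2)]] by simp

lemma base_span_power: "f \<in> polys_in base_vars \<Longrightarrow> 1 \<in> G \<Longrightarrow> f ^ n \<in> base_span G"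
  by (intro base_span_base polys_in_power)

text \<open>What may be left when a product u s or s s is rewritten: for most of the equations an element of
  degree one in u and s over B, and for F5, F6, F9 also quadratic terms in u.\<close>
abbreviation "lin_gens \<equiv> {1, u1, u2, s1, s2, s3}"
abbreviation "quad_gens \<equiv> {1, u1, u2, s1, s2, s3, u1 * u1, u1 * u2, u2 * u2}"

definition lin :: "cpoly set" where
  "lin = base_span lin_gens"

definition lin_quad :: "cpoly set" where
  "lin_quad = base_span quad_gens"

lemma coord_in_lin: "\<xi> v \<in> lin"
proof (cases "v \<in> base_vars")
  case True
  then show ?thesis unfolding lin_def by (intro base_span_base polys_in.var) auto
next
  case False
  then show ?thesis unfolding lin_def base_vars_def by (intro base_span.gen) auto
qed

lemma lin_subset_lin_quad: "lin \<subseteq> lin_quad"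
  unfolding lin_def lin_quad_def by (auto elim: base_span_mono)

lemma coord_in_lin_quad: "\<xi> v \<in> lin_quad"
  using coord_in_lin lin_subset_lin_quad by blast

lemma quad_in_lin_quad:
  "u1\<^sup>2 \<in> lin_quad" "u2\<^sup>2 \<in> lin_quad" "u1 * u2 \<in> lin_quad" "2 * u1 * u2 \<in> lin_quad"
proof -
  show *: "u1\<^sup>2 \<in> lin_quad" "u2\<^sup>2 \<in> lin_quad" "u1 * u2 \<in> lin_quad"
    unfolding lin_quad_def power2_eq_square by (intro base_span.gen; simp)+
  show "2 * u1 * u2 \<in> lin_quad"
    using base_span.scale[OF polys_in_numeral *(3)[unfolded lin_quad_def], of "num.Bit0 num.One"]
    by (simp add: lin_quad_def mult.assoc)
qed

lemma one_in: "1 \<in> lin_gens" "1 \<in> quad_gens"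
  by simp_all

lemmas lin_closed = coord_in_lin base_span.add[of _ "lin_gens", folded lin_def]
  base_span.scale[of _ _ "lin_gens", folded lin_def]
  base_span_diff[of _ "lin_gens", folded lin_def]
  base_span_uminus[of _ "lin_gens", folded lin_def]
  base_span_power[OF _ one_in(1), folded lin_def]

lemmas lin_quad_closed = quad_in_lin_quad coord_in_lin_quad
  base_span.add[of _ "quad_gens", folded lin_quad_def]
  base_span.scale[of _ _ "quad_gens", folded lin_quad_def]
  base_span_diff[of _ "quad_gens", folded lin_quad_def]
  base_span_uminus[of _ "quad_gens", folded lin_quad_def]
  base_span_power[OF _ one_in(2), folded lin_quad_def]

text \<open>The equations F1, ..., F6 rewrite the six products u_i s_j, and F7, F8, F9 rewrite s2 s2, s2 s3 and
  s3 s3. The last three also leave products with s1 and, in the case of F9, products u_i s_j and s2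
  s2.\<close>
lemma rewrite_us1:
  "u1 * s1 - F1 \<in> lin" "u2 * s1 - F2 \<in> lin"
proof -
  have "u1 * s1 - F1 = p1 * s2 + p2 * s3 + t126 * D + (t136 * U\<^sub>1 + t245 * U\<^sub>2 + t246 * U\<^sub>3)"
    unfolding F\<^sub>1_def by simp
  also have "\<dots> \<in> lin"
    unfolding D_def U_defs
    by (intro lin_closed polys_in_intros; simp add: base_vars_def)
  finally show "u1 * s1 - F1 \<in> lin" .
  have "u2 * s1 - F2 = p3 * s2 + p4 * s3 - t125 * D - t135 * U\<^sub>1 - t136 * U\<^sub>2 - t245 * U\<^sub>3"
    unfolding F\<^sub>2_def by simp
  also have "\<dots> \<in> lin"
    unfolding D_def U_defs
    by (intro lin_closed polys_in_intros; simp add: base_vars_def)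
  finally show "u2 * s1 - F2 \<in> lin" .
qed

lemma rewrite_us2:
  "u1 * s2 - F3 \<in> lin" "u2 * s2 - F4 \<in> lin"
proof -
  have "u1 * s2 - F3 = t2 * p2 * s1 - t1 * p2 * s2 + p1 * s3 + t124 * D
      + (t136 * I\<^sub>1 + t245 * I\<^sub>2 + t246 * I\<^sub>3)"
    unfolding F\<^sub>3_def by (simp add: distrib_right)
  also have "\<dots> \<in> lin"
    unfolding D_def I_defs
    by (intro lin_closed polys_in_intros; simp add: base_vars_def)
  finally show "u1 * s2 - F3 \<in> lin" .
  have "u2 * s2 - F4 = t2 * p4 * s1 - t1 * p4 * s2 + p3 * s3 - t123 * D
      - t135 * I\<^sub>1 - t136 * I\<^sub>2 - t245 * I\<^sub>3"
    unfolding F\<^sub>4_def by (simp add: distrib_right)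
  also have "\<dots> \<in> lin"
    unfolding D_def I_defs
    by (intro lin_closed polys_in_intros; simp add: base_vars_def)
  finally show "u2 * s2 - F4 \<in> lin" .
qed

lemma rewrite_us3:
  "u1 * s3 - F5 \<in> lin_quad" "u2 * s3 - F6 \<in> lin_quad"
proof -
  have "u1 * s3 - F5 = t2 * p1 * s1 - (t1 * p1 - t2 * p2) * s2 - t1 * p2 * s3
      - t123 * U\<^sub>1 - t124 * (p1 * p3 + t1 * p2 * p4 + p2 * u2)
      + t125 * I\<^sub>1 + t126 * (t2 * p2 * p4 + p1 * u2)
      + (t136 * A\<^sub>1 + t245 * A\<^sub>2 + t246 * A\<^sub>3)"
    unfolding F\<^sub>5_def by (simp add: distrib_right)
  also have "\<dots> \<in> lin_quad"
    unfolding U\<^sub>1_def I\<^sub>1_def A_defs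
    by (intro lin_quad_closed polys_in_intros; simp add: base_vars_def)
  finally show "u1 * s3 - F5 \<in> lin_quad" .
  have "u2 * s3 - F6 = t2 * p3 * s1 - (t1 * p3 - t2 * p4) * s2 - t1 * p4 * s3
      - t123 * (p1 * p3 + t1 * p2 * p4 + p4 * u1) - t124 * U\<^sub>3
      + t125 * (t2 * p2 * p4 + p3 * u1) + t126 * I\<^sub>3
      - t135 * A\<^sub>1 - t136 * A\<^sub>2 - t245 * A\<^sub>3"
    unfolding F\<^sub>6_def by (simp add: distrib_right)
  also have "\<dots> \<in> lin_quad"
    unfolding U\<^sub>3_def I\<^sub>3_def A_defs
    by (intro lin_quad_closed polys_in_intros; simp add: base_vars_def)
  finally show "u2 * s3 - F6 \<in> lin_quad" .
qed

lemma rewrite_ss: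
  "s2 * s2 + F7 - s1 * s3 \<in> lin"
  "s2 * s3 - F8 - (t2 * (s1 * s1) - t1 * (s1 * s2)) \<in> lin"
  "s3 * s3 - F9 - (t2 * (s1 * s2) - t1 * (s2 * s2)
     - (t123 * u1 + t124 * u2) * s1 + (t125 * u1 + t126 * u2) * s2) \<in> lin_quad"
proof -
  have "s2 * s2 + F7 - s1 * s3 = (t123 * p2 + t124 * p4) * s1
     - (t125 * p2 + t126 * p4) * s2 + \<alpha> * (p1\<^sup>2 - 2 * p2 * u1 - t1 * p2\<^sup>2)
     + \<gamma> * (p3\<^sup>2 - 2 * p4 * u2 - t1 * p4\<^sup>2) + \<beta> * (p2 * u2 + p4 * u1 - p1 * p3 + t1 * p2 * p4)
     + a\<^sub>0 * p2\<^sup>2 + 2 * a\<^sub>1 * p2 * p4 + a\<^sub>2 * p4\<^sup>2 - b\<^sub>0 * p1 * p2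
     - b\<^sub>1 * (p1 * p4 + p2 * p3) - b\<^sub>2 * p3 * p4"
    unfolding F\<^sub>7_def by (simp add: power2_eq_square)
  also have "\<dots> \<in> lin"
    unfolding minor_defs
    by (intro lin_closed polys_in_intros; simp add: base_vars_def)
  finally show "s2 * s2 + F7 - s1 * s3 \<in> lin" .
  have "s2 * s3 - F8 - (t2 * (s1 * s1) - t1 * (s1 * s2)) = - ((t123 * p1 + t124 * p3) * s1
     - (t125 * p1 + t126 * p3) * s2 + \<alpha> * (-2 * p1 * u1 - 2 * t1 * p1 * p2 + t2 * p2\<^sup>2)
     + \<gamma> * (-2 * p3 * u2 - 2 * t1 * p3 * p4 + t2 * p4\<^sup>2)
     + \<beta> * (p1 * u2 + p3 * u1 + t1 * (p1 * p4 + p2 * p3) - t2 * p2 * p4)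
     - b\<^sub>0 * p1\<^sup>2 - 2 * b\<^sub>1 * p1 * p3 - b\<^sub>2 * p3\<^sup>2 + a\<^sub>0 * p1 * p2
     + a\<^sub>1 * (p1 * p4 + p2 * p3) + a\<^sub>2 * p3 * p4)"
    unfolding F\<^sub>8_def by (simp add: power2_eq_square mult.assoc)
  also have "\<dots> \<in> lin"
    unfolding minor_defs
    by (intro lin_closed polys_in_intros; simp add: base_vars_def)
  finally show "s2 * s3 - F8 - (t2 * (s1 * s1) - t1 * (s1 * s2)) \<in> lin" .
  have "s3 * s3 - F9 - (t2 * (s1 * s2) - t1 * (s2 * s2)
     - (t123 * u1 + t124 * u2) * s1 + (t125 * u1 + t126 * u2) * s2) = - (- (\<alpha> * (2 * t2 * p1 * p2 + u1\<^sup>2))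
     + \<beta> * (t2 * (p2 * p3 + p1 * p4) + u1 * u2) - \<gamma> * (2 * t2 * p3 * p4 + u2\<^sup>2)
     - t1 * (a\<^sub>0 * p2\<^sup>2 + 2 * a\<^sub>1 * p2 * p4 + a\<^sub>2 * p4\<^sup>2)
     + t2 * (b\<^sub>0 * p2\<^sup>2 + 2 * b\<^sub>1 * p2 * p4 + b\<^sub>2 * p4\<^sup>2)
     - a\<^sub>0 * p1\<^sup>2 - 2 * a\<^sub>1 * p1 * p3 - a\<^sub>2 * p3\<^sup>2 + (t124 * t125 - t123 * t126) * D)"
    unfolding F\<^sub>9_def by (simp add: power2_eq_square mult.assoc)
  also have "\<dots> \<in> lin_quad"
    unfolding D_def minor_defs
    by (intro lin_quad_closed polys_in_intros; simp add: base_vars_def)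
  finally show "s3 * s3 - F9 - (t2 * (s1 * s2) - t1 * (s2 * s2)
     - (t123 * u1 + t124 * u2) * s1 + (t125 * u1 + t126 * u2) * s2) \<in> lin_quad" .
qed

section \<open>Normal forms modulo the ideal\<close>

text \<open>The normal monomials are those in u1, u2 and those of the form s1^k s_j. The predicate holds if f is
  congruent to a B-combination of normal monomials of degree at most n in u and s. Tracking this
  degree is what makes the rewriting terminate: apart from quadratic terms in u, an equation
  replaces a product by terms of lower degree or, in the case of F7, F8, F9, by products that are
  normal or can be rewritten by other equations.\<close>
inductive nf :: "nat \<Rightarrow> cpoly \<Rightarrow> bool" where
  ideal: "f \<in> ideal_\<Pi> \<Longrightarrow> nf n f"
| umon: "i + j \<le> n \<Longrightarrow> nf n (u1 ^ i * u2 ^ j)"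
| smon: "k < n \<Longrightarrow> \<sigma> \<in> {s1, s2, s3} \<Longrightarrow> nf n (s1 ^ k * \<sigma>)"
| add: "nf n f \<Longrightarrow> nf n g \<Longrightarrow> nf n (f + g)"
| scale: "b \<in> polys_in base_vars \<Longrightarrow> nf n f \<Longrightarrow> nf n (b * f)"

lemma nf_mono: "nf m f \<Longrightarrow> m \<le> n \<Longrightarrow> nf n f"
  by (induction rule: nf.induct) (auto intro: nf.intros)

lemma nf_uminus: "nf n f \<Longrightarrow> nf n (- f)"
  using nf.scale[of "-1" n f] polys_in_uminus[OF polys_in_1] by simp

lemma nf_diff: "nf n f \<Longrightarrow> nf n g \<Longrightarrow> nf n (f - g)"
  using nf.add[of n f "- g"] nf_uminus by simp

lemma nf_coord: "v \<in> base_vars \<Longrightarrow> nf n f \<Longrightarrow> nf n (\<xi> v * f)"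
  by (intro nf.scale polys_in.var)

text \<open>The claim to be proved by strong induction on n. It is stated for all five variables together,
  because rewriting a product with one of them leads to products with the others in lower degree.\<close>
definition step :: "nat \<Rightarrow> bool" where
  "step n \<longleftrightarrow> (\<forall>f. \<forall>v\<in>{u1, u2, s1, s2, s3}. nf n f \<longrightarrow> nf (Suc n) (v * f))"

text \<open>After rewriting one product, a linear factor is left, to be multiplied by a normal monomial of lower
  degree.\<close>
lemma nf_lin_mult:
  assumes "l \<in> lin" "step n" "nf n g"
  shows "nf (Suc n) (l * g)"
  using assms(1) unfolding lin_def
proof (induction rule: base_span.induct)
  case (gen v)
  then show ?case using assms(2,3) nf_mono[OF assms(3), of "Suc n"] by (auto simp: step_def)
next
  case (add f h)
  then show ?case by (simp add: distrib_right nf.add)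
next
  case (scale b f)
  then show ?case by (simp add: mult.assoc nf.scale)
qed

text \<open>Quadratic terms in u are harmless here because monomials in u are already normal.\<close>
lemma nf_lin_quad_mult:
  assumes "l \<in> lin_quad" "step (i + j)"
  shows "nf (i + j + 2) (l * (u1 ^ i * u2 ^ j))"
  using assms(1) unfolding lin_quad_def
proof (induction rule: base_span.induct)
  case (gen v)
  have umon: "nf (i + j) (u1 ^ i * u2 ^ j)" by (rule nf.umon) simp
  show ?case
  proof (cases "v \<in> lin_gens")
    case True
    then have "v \<in> lin" unfolding lin_def by (rule base_span.gen)
    from nf_lin_mult[OF this assms(2) umon] show ?thesis by (rule nf_mono) simp
  next
    case False
    with gen consider "v = u1 * u1" | "v = u1 * u2" | "v = u2 * u2" by auto
    then show ?thesis
    proof cases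
      case 1
      have "v * (u1 ^ i * u2 ^ j) = u1 ^ Suc (Suc i) * u2 ^ j" by (simp add: 1 mult_ac)
      then show ?thesis by (simp only:) (rule nf.umon, simp)
    next
      case 2
      have "v * (u1 ^ i * u2 ^ j) = u1 ^ Suc i * u2 ^ Suc j" by (simp add: 2 mult_ac)
      then show ?thesis by (simp only:) (rule nf.umon, simp)
    next
      case 3
      have "v * (u1 ^ i * u2 ^ j) = u1 ^ i * u2 ^ Suc (Suc j)" by (simp add: 3 mult_ac)
      then show ?thesis by (simp only:) (rule nf.umon, simp)
    qed
  qed
next
  case (add f h)
  then show ?case by (simp add: distrib_right nf.add)
next
  case (scale b f)
  then show ?case by (simp add: mult.assoc nf.scale)
qed

lemma nf_rewrite:
  assumes "F \<in> ideal_\<Pi>" "nf n ((w - F) * g)"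
  shows "nf n (w * g)"
proof -
  have "w * g = (w - F) * g + F * g" by (simp add: algebra_simps)
  moreover have "nf n (F * g)" by (intro nf.ideal ideal_Pi_mult_right assms(1))
  ultimately show ?thesis using nf.add[OF assms(2)] by simp
qed

lemma F_mem: "F1 \<in> ideal_\<Pi>" "F2 \<in> ideal_\<Pi>" "F3 \<in> ideal_\<Pi>" "F4 \<in> ideal_\<Pi>" "F5 \<in> ideal_\<Pi>"
  "F6 \<in> ideal_\<Pi>" "F7 \<in> ideal_\<Pi>" "F8 \<in> ideal_\<Pi>" "F9 \<in> ideal_\<Pi>"
  using F_in_ideal_Pi by auto

lemma us_rewrite:
  assumes "u \<in> {u1, u2}" "\<sigma> \<in> {s1, s2, s3}"
  obtains F where "F \<in> ideal_\<Pi>" "u * \<sigma> - F \<in> lin_quad"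
  using assms rewrite_us1 rewrite_us2 rewrite_us3 F_mem lin_subset_lin_quad by blast

lemma us1_rewrite:
  assumes "u \<in> {u1, u2}"
  obtains F where "F \<in> ideal_\<Pi>" "u * s1 - F \<in> lin"
  using assms rewrite_us1 F_mem by blast

text \<open>A product u s1^k s_j is rewritten at u s1, which leaves a linear factor times a monomial of degree
  k. Only for k = 0 the product is rewritten at u s_j, where quadratic terms in u may remain.\<close>
lemma nf_step_u:
  assumes IH: "\<And>m. m < n \<Longrightarrow> step m" and u: "u \<in> {u1, u2}" and "nf n f"
  shows "nf (Suc n) (u * f)"
  using assms(3,1,2)
proof (induction rule: nf.induct)
  case (ideal f n)
  then show ?case by (intro nf.ideal ideal_Pi_mult)
next
  case (umon i j n)
  then consider "u = u1" | "u = u2" by auto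
  then show ?case
  proof cases
    case 1
    have "u * (u1 ^ i * u2 ^ j) = u1 ^ Suc i * u2 ^ j" by (simp add: 1 mult_ac)
    then show ?thesis using umon by (simp only:) (rule nf.umon, simp)
  next
    case 2
    have "u * (u1 ^ i * u2 ^ j) = u1 ^ i * u2 ^ Suc j" by (simp add: 2 mult_ac)
    then show ?thesis using umon by (simp only:) (rule nf.umon, simp)
  qed
next
  case (smon k n \<sigma>)
  show ?case
  proof (cases k)
    case 0
    obtain F where F: "F \<in> ideal_\<Pi>" "u * \<sigma> - F \<in> lin_quad"
      using us_rewrite[OF smon.prems(2) smon.hyps(2)] .
    have "step (0 + 0)" using smon by simp
    from nf_lin_quad_mult[OF F(2) this] have "nf 2 ((u * \<sigma> - F) * 1)"
      by (simp add: numeral_2_eq_2)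
    from nf_rewrite[OF F(1) this] have "nf 2 (u * \<sigma>)" by simp
    then show ?thesis using 0 smon.hyps(1) by (auto elim: nf_mono)
  next
    case (Suc k')
    obtain F where F: "F \<in> ideal_\<Pi>" "u * s1 - F \<in> lin"
      using us1_rewrite[OF smon.prems(2)] .
    have g: "nf (Suc k') (s1 ^ k' * \<sigma>)" using smon.hyps(2) by (intro nf.smon) auto
    have "step (Suc k')" using smon Suc by simp
    from nf_lin_mult[OF F(2) this g] have "nf (Suc n) ((u * s1 - F) * (s1 ^ k' * \<sigma>))"
      by (rule nf_mono) (use smon.hyps Suc in simp)
    from nf_rewrite[OF F(1) this] show ?thesis by (simp add: Suc mult_ac)
  qed
next
  case (add n f g)
  then show ?case by (simp add: distrib_left nf.add)
next
  case (scale b n f)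
  then show ?case by (simp add: mult.left_commute[of u] nf.scale)
qed

text \<open>The product of two variables s times s1^k. Rewriting s3 s3 produces products of u with normal
  monomials of the same degree n, so nf_step_u has to be available in degree n already.\<close>
lemma nf_ss:
  assumes IH: "\<And>m. m < n \<Longrightarrow> step m" and k: "k < n"
    and "\<sigma> \<in> {s1, s2, s3}" "\<tau> \<in> {s1, s2, s3}"
  shows "nf (Suc n) (\<sigma> * (s1 ^ k * \<tau>))"
proof -
  have pow: "nf k (s1 ^ k)"
  proof (cases k)
    case 0
    then show ?thesis using nf.umon[of 0 0 0] by simp
  next
    case (Suc k')
    then show ?thesis using nf.smon[of k' k "s1"] by (simp add: power_commutes)
  qed
  have lin: "nf (Suc n) (l * s1 ^ k)" if "l \<in> lin" for l
    using nf_lin_mult[OF that IH[OF k] pow] by (rule nf_mono) (use k in simp)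
  have s1: "nf (Suc n) (s1 * \<sigma> * s1 ^ k)" if "\<sigma> \<in> {s1, s2, s3}" for \<sigma>
    using nf.smon[of "Suc k" "Suc n" \<sigma>] k that by (simp add: mult_ac)
  have s22: "nf (Suc n) (s2 * s2 * s1 ^ k)"
  proof (rule nf_rewrite[of "- F7"])
    have "(s2 * s2 - - F7) * s1 ^ k = (s2 * s2 + F7 - s1 * s3) * s1 ^ k + s1 * s3 * s1 ^ k"
      by (simp add: algebra_simps)
    then show "nf (Suc n) ((s2 * s2 - - F7) * s1 ^ k)"
      using nf.add[OF lin[OF rewrite_ss(1)] s1[of "s3"]] by simp
  qed (use F_mem in \<open>auto intro: ideal_Pi_uminus\<close>)
  have s23: "nf (Suc n) (s2 * s3 * s1 ^ k)"
  proof (rule nf_rewrite[of "F8"])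
    have "(s2 * s3 - F8) * s1 ^ k =
       (s2 * s3 - F8 - (t2 * (s1 * s1) - t1 * (s1 * s2))) * s1 ^ k
         + (t2 * (s1 * s1 * s1 ^ k) - t1 * (s1 * s2 * s1 ^ k))"
      by (simp add: algebra_simps)
    then show "nf (Suc n) ((s2 * s3 - F8) * s1 ^ k)"
      by (simp only:) (intro nf.add nf_diff nf_coord lin rewrite_ss s1; simp add: base_vars_def)
  qed (rule F_mem)
  have u_mult: "nf (Suc n) (u * f)" if "u \<in> {u1, u2}" "nf n f" for u f
    using nf_step_u[of n] IH that by blast
  have quad: "nf (Suc n) (q * s1 ^ k)" if "q \<in> lin_quad" for q
    using that unfolding lin_quad_def
  proof (induction rule: base_span.induct)
    case (gen v)
    have "nf n (u * s1 ^ k)" if "u \<in> {u1, u2}" for u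
    proof -
      have "nf (Suc k) (u * s1 ^ k)" using IH[OF k] pow that by (auto simp: step_def)
      then show ?thesis by (rule nf_mono) (use k in simp)
    qed
    then have uu: "nf (Suc n) (u * (u' * s1 ^ k))" if "u \<in> {u1, u2}" "u' \<in> {u1, u2}" for u u'
      using u_mult that by blast
    show ?case
    proof (cases "v \<in> lin_gens")
      case True
      then have "v \<in> lin" unfolding lin_def by (rule base_span.gen)
      then show ?thesis by (rule lin)
    next
      case False
      with gen uu show ?thesis by (auto simp: mult.assoc)
    qed
  next
    case (add f h)
    then show ?case by (simp add: distrib_right nf.add)
  next
    case (scale b f)
    then show ?case by (simp add: mult.assoc nf.scale)
  qed
  have s33: "nf (Suc n) (s3 * s3 * s1 ^ k)"
  proof (rule nf_rewrite[of "F9"])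
    have us: "nf (Suc n) (u * (s1 ^ k * \<sigma>))" if "u \<in> {u1, u2}" "\<sigma> \<in> {s1, s2, s3}" for u \<sigma>
      using u_mult[OF that(1) nf.smon[OF k that(2)]] .
    have "(s3 * s3 - F9) * s1 ^ k =
       (s3 * s3 - F9 - (t2 * (s1 * s2) - t1 * (s2 * s2)
         - (t123 * u1 + t124 * u2) * s1 + (t125 * u1 + t126 * u2) * s2)) * s1 ^ k
       + (t2 * (s1 * s2 * s1 ^ k) - t1 * (s2 * s2 * s1 ^ k)
         - (t123 * (u1 * (s1 ^ k * s1)) + t124 * (u2 * (s1 ^ k * s1)))
         + (t125 * (u1 * (s1 ^ k * s2)) + t126 * (u2 * (s1 ^ k * s2))))"
      by (simp add: algebra_simps)
    then show "nf (Suc n) ((s3 * s3 - F9) * s1 ^ k)"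
      by (simp only:) (intro nf.add nf_diff nf_coord quad rewrite_ss s1 us s22; simp add: base_vars_def)
  qed (rule F_mem)
  have s32: "nf (Suc n) (s3 * s2 * s1 ^ k)"
    using s23 by (simp only: mult.commute[of "s3" "s2"])
  have "nf (Suc n) (\<sigma> * \<tau> * s1 ^ k)"
  proof (cases "\<sigma> = s1 \<or> \<tau> = s1")
    case True
    then show ?thesis
      using s1[OF assms(3)] s1[OF assms(4)] by (auto simp only: mult.commute[of \<sigma> "s1"])
  next
    case False
    then show ?thesis using assms(3,4) s22 s23 s32 s33 by blast
  qed
  then show ?thesis by (simp add: mult_ac)
qed

lemma nf_step_s:
  assumes IH: "\<And>m. m < n \<Longrightarrow> step m" and \<sigma>: "\<sigma> \<in> {s1, s2, s3}" and "nf n f"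
  shows "nf (Suc n) (\<sigma> * f)"
  using assms(3,1,2)
proof (induction rule: nf.induct)
  case (ideal f n)
  then show ?case by (intro nf.ideal ideal_Pi_mult)
next
  case (umon i j n)
  have red: "nf (Suc n) (\<sigma> * (u * (u1 ^ i' * u2 ^ j')))" if le: "Suc (i' + j') \<le> n" and u: "u \<in> {u1, u2}"
      for u i' j'
  proof -
    obtain F where F: "F \<in> ideal_\<Pi>" "u * \<sigma> - F \<in> lin_quad"
      using us_rewrite[OF u umon.prems(2)] .
    have "step (i' + j')" using umon.prems le by simp
    from nf_lin_quad_mult[OF F(2) this] have "nf (Suc n) ((u * \<sigma> - F) * (u1 ^ i' * u2 ^ j'))"
      by (rule nf_mono) (use le in simp)
    from nf_rewrite[OF F(1) this] show ?thesis by (simp add: mult_ac)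
  qed
  show ?case
  proof (cases i)
    case (Suc i')
    then show ?thesis using red[of i' j "u1"] umon.hyps by (simp add: mult_ac)
  next
    case i: 0
    show ?thesis
    proof (cases j)
      case (Suc j')
      then show ?thesis using red[of 0 j' "u2"] umon.hyps i by (simp add: mult_ac)
    next
      case 0
      then show ?thesis using nf.smon[of 0 "Suc n" \<sigma>] umon.prems i by simp
    qed
  qed
next
  case (smon k n \<tau>)
  then show ?case using nf_ss by blast
next
  case (add n f g)
  then show ?case by (simp add: distrib_left nf.add)
next
  case (scale b n f)
  then show ?case by (simp add: mult.left_commute[of \<sigma>] nf.scale)
qed

lemma step: "step n"
proof (induction n rule: less_induct)
  case (less n)
  have "nf (Suc n) (v * f)" if "nf n f" "v \<in> {u1, u2} \<union> {s1, s2, s3}" for f v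
    using that(2)
  proof
    show "v \<in> {u1, u2} \<Longrightarrow> ?thesis" by (rule nf_step_u[OF less _ that(1)])
    show "v \<in> {s1, s2, s3} \<Longrightarrow> ?thesis" by (rule nf_step_s[OF less _ that(1)])
  qed
  then show ?case unfolding step_def by simp
qed

text \<open>Multiplying by the variables of f one after the other, starting from the normal monomial 1.\<close>
lemma nf_exists: "\<exists>n. nf n f"
proof -
  have "\<exists>n. nf n (f * g)" if "\<exists>n. nf n g" for g
    using that
  proof (induction f arbitrary: g rule: cpoly_induct)
    case (const c)
    then show ?case by (auto intro: nf.scale polys_in.const)
  next
    case (var v)
    then obtain n where n: "nf n g" by auto
    show ?case
    proof (cases "v \<in> base_vars")
      case True
      then show ?thesis using nf_coord n by blast
    next
      case False
      then show ?thesis using step[of n] n unfolding step_def base_vars_def by blast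
    qed
  next
    case (add f1 f2)
    then obtain m n where "nf m (f1 * g)" "nf n (f2 * g)" by blast
    then have "nf (max m n) (f1 * g + f2 * g)"
      by (intro nf.add) (auto elim: nf_mono)
    then show ?case by (auto simp: distrib_right)
  next
    case (mult f1 f2)
    then show ?case by (simp add: mult.assoc)
  qed
  from this[of 1] show ?thesis using nf.umon[of 0 0 0] by auto
qed

definition s_vars :: "coord set" where "s_vars = insert Vs1 base_vars"
definition u_vars :: "coord set" where "u_vars = {Vu1, Vu2} \<union> base_vars"

lemma normal_form:
  obtains g1 g2 g3 h where
    "g1 \<in> polys_in s_vars" "g2 \<in> polys_in s_vars" "g3 \<in> polys_in s_vars" "h \<in> polys_in u_vars"
    "f - (s1 * g1 + s2 * g2 + s3 * g3 + h) \<in> ideal_\<Pi>"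
proof -
  obtain n where "nf n f" using nf_exists by blast
  then have "\<exists>g1\<in>polys_in s_vars. \<exists>g2\<in>polys_in s_vars. \<exists>g3\<in>polys_in s_vars. \<exists>h\<in>polys_in u_vars.
     f - (s1 * g1 + s2 * g2 + s3 * g3 + h) \<in> ideal_\<Pi>"
  proof (induction rule: nf.induct)
    case (ideal f n)
    show ?case by (intro bexI[of _ 0]) (use ideal in auto)
  next
    case (umon i j n)
    show ?case by (intro bexI[of _ 0] bexI[of _ "u1 ^ i * u2 ^ j"])
      (auto simp: u_vars_def intro!: polys_in_intros)
  next
    case (smon k n \<sigma>)
    have pow: "s1 ^ k \<in> polys_in s_vars" by (auto simp: s_vars_def intro!: polys_in_intros)
    from smon(2) consider "\<sigma> = s1" | "\<sigma> = s2" | "\<sigma> = s3" by auto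
    then show ?case
    proof cases
      case 1
      show ?thesis by (rule bexI[of _ "s1 ^ k"], rule bexI[of _ 0], rule bexI[of _ 0], rule bexI[of _ 0])
        (use pow 1 in \<open>auto simp: mult.commute\<close>)
    next
      case 2
      show ?thesis by (rule bexI[of _ 0], rule bexI[of _ "s1 ^ k"], rule bexI[of _ 0], rule bexI[of _ 0])
        (use pow 2 in \<open>auto simp: mult.commute\<close>)
    next
      case 3
      show ?thesis by (rule bexI[of _ 0], rule bexI[of _ 0], rule bexI[of _ "s1 ^ k"], rule bexI[of _ 0])
        (use pow 3 in \<open>auto simp: mult.commute\<close>)
    qed
  next
    case (add n f f')
    then obtain g1 g2 g3 h g1' g2' g3' h' where
      g: "g1 \<in> polys_in s_vars" "g2 \<in> polys_in s_vars" "g3 \<in> polys_in s_vars" "h \<in> polys_in u_vars"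
      "g1' \<in> polys_in s_vars" "g2' \<in> polys_in s_vars" "g3' \<in> polys_in s_vars" "h' \<in> polys_in u_vars"
      and f: "f - (s1 * g1 + s2 * g2 + s3 * g3 + h) \<in> ideal_\<Pi>"
      and f': "f' - (s1 * g1' + s2 * g2' + s3 * g3' + h') \<in> ideal_\<Pi>" by blast
    show ?case
      by (rule bexI[of _ "g1 + g1'"], rule bexI[of _ "g2 + g2'"], rule bexI[of _ "g3
          + g3'"], rule bexI[of _ "h + h'"])
         (use ideal_Pi_add[OF f f'] g in \<open>auto simp: algebra_simps intro: polys_in.add\<close>)
  next
    case (scale b n f)
    then obtain g1 g2 g3 h where
      g: "g1 \<in> polys_in s_vars" "g2 \<in> polys_in s_vars" "g3 \<in> polys_in s_vars" "h \<in> polys_in u_vars"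
      and f: "f - (s1 * g1 + s2 * g2 + s3 * g3 + h) \<in> ideal_\<Pi>" by blast
    have b: "b \<in> polys_in s_vars" "b \<in> polys_in u_vars"
      using scale(1) by (auto simp: s_vars_def u_vars_def elim!: polys_in_mono)
    show ?case
      by (rule bexI[of _ "b * g1"], rule bexI[of _ "b * g2"], rule bexI[of _ "b * g3"], rule bexI[of _ "b * h"])
         (use ideal_Pi_mult[OF f, of b] g b in \<open>auto simp: algebra_simps intro: polys_in.mult\<close>)
  qed
  then show ?thesis using that by blast
qed

section \<open>Uniqueness of the s-part\<close>

lemma tendsto_eval_at:
  assumes "f \<in> polys_in V" "\<And>v. v \<in> V \<Longrightarrow> ((\<lambda>e. x e v) \<longlongrightarrow> l v) F"
  shows "((\<lambda>e. eval_at (x e) f) \<longlongrightarrow> eval_at l f) F"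
  using assms by (induction rule: polys_in.induct) (auto intro: tendsto_intros)

lemma linear_system_2:
  fixes a b c d :: complex
  assumes "a * d - b * c \<noteq> 0"
  obtains x y where "a * x + b * y = r" "c * x + d * y = s"
proof
  let ?e = "a * d - b * c"
  show "a * ((r * d - b * s) / ?e) + b * ((a * s - r * c) / ?e) = r"
    using assms by (simp add: divide_simps) (simp add: algebra_simps)
  show "c * ((r * d - b * s) / ?e) + d * ((a * s - r * c) / ?e) = s"
    using assms by (simp add: divide_simps) (simp add: algebra_simps)
qed

text \<open>The curve is found by the ansatz s = (1, x, x^2)/e + (0, \<sigma>2, \<sigma>3) and u_i = w_i + e
  v_i, where the coordinates other than t123, ..., t126, u, s stay fixed, and the equations F1, ...,
  F4 are solved for t126, t125, t124, t123, with denominator D. The terms of order 1/e cancel for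
  the choice of w_i below and because t2 = x^3 + t1 x. That t123, ..., t126 tend to their prescribed
  values as e tends to 0 is a linear system for \<sigma>2, \<sigma>3, v_1, v_2; after elimination of
  the v_i it has determinant D (t1 + 3 x^2), which is why x must be a simple root.\<close>
lemma curve_at_infinity:
  assumes D: "eval_at y D \<noteq> 0" and x: "y Vt2 = x ^ 3 + y Vt1 * x" "y Vt1 + 3 * x\<^sup>2 \<noteq> 0"
  obtains c \<sigma>2 \<sigma>3 where
    "\<And>e. e \<noteq> 0 \<Longrightarrow> on_\<Pi> (c e)"
    "\<And>e. c e Vs1 = inverse e" "\<And>e. c e Vs2 = x * inverse e + \<sigma>2" "\<And>e. c e Vs3 = x\<^sup>2 * inverse e + \<sigma>3"
    "\<And>v. v \<in> u_vars \<Longrightarrow> ((\<lambda>e. c e v) \<longlongrightarrow> c 0 v) (at 0)"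
    "\<And>v. v \<in> base_vars \<Longrightarrow> c 0 v = y v"
proof -
  define P1 P2 P3 P4 T1 where "P1 = y Vp1" "P2 = y Vp2" "P3 = y Vp3" "P4 = y Vp4" "T1 = y Vt1"
  note defs = this
  define d where "d = P1 * P4 - P2 * P3"
  have d: "d \<noteq> 0" using D by (simp add: d_def D_def defs)
  \<comment> \<open>the limits of u1 and u2, forced by the terms of order 1/e in F1 and F2\<close>
  define w1 w2 where "w1 = P1 * x + P2 * x\<^sup>2" and "w2 = P3 * x + P4 * x\<^sup>2"
  define val where "val = (\<lambda>a b. eval_at (y(Vu1 := a, Vu2 := b)))"
  define r1 r2 r3 r4 where
    "r1 = (\<lambda>a b. val a b (t136 * U\<^sub>1 + t245 * U\<^sub>2 + t246 * U\<^sub>3))"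
    "r2 = (\<lambda>a b. val a b (t135 * U\<^sub>1 + t136 * U\<^sub>2 + t245 * U\<^sub>3))"
    "r3 = (\<lambda>a b. val a b (t136 * I\<^sub>1 + t245 * I\<^sub>2 + t246 * I\<^sub>3))"
    "r4 = (\<lambda>a b. val a b (t135 * I\<^sub>1 + t136 * I\<^sub>2 + t245 * I\<^sub>3))"
  note rdefs = this
  \<comment> \<open>the terms of order 0 in F1, ..., F4 must have these values if t126, ..., t123 are to have the prescribed limits\<close>
  define c1 c2 c3 c4 where "c1 = d * y Vt126 + r1 w1 w2" "c2 = - (d * y Vt125 + r2 w1 w2)"
    "c3 = d * y Vt124 + r3 w1 w2" "c4 = - (d * y Vt123 + r4 w1 w2)"
  note cdefs = this
  have "(T1 * P2 + w1 + P1 * x) * (P4 * x - P3) - (P2 * x - P1) * (T1 * P4 + w2 + P3 * x) = d * (T1 + 3 * x\<^sup>2)"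
    by (simp add: d_def w1_def w2_def algebra_simps power2_eq_square)
  also have "\<dots> \<noteq> 0" using d x by (simp add: defs)
  finally obtain \<sigma>2 \<sigma>3 where
    \<sigma>: "(T1 * P2 + w1 + P1 * x) * \<sigma>2 + (P2 * x - P1) * \<sigma>3 = c3 - c1 * x"
       "(T1 * P4 + w2 + P3 * x) * \<sigma>2 + (P4 * x - P3) * \<sigma>3 = c4 - c2 * x"
    by (rule linear_system_2)
  define v1 v2 where "v1 = P1 * \<sigma>2 + P2 * \<sigma>3 + c1" and "v2 = P3 * \<sigma>2 + P4 * \<sigma>3 + c2"
  define a b where "a = (\<lambda>e. w1 + e * v1)" and "b = (\<lambda>e. w2 + e * v2)"
  define c where "c = (\<lambda>e. y(Vu1 := a e, Vu2 := b e, Vs1 := inverse e, Vs2 := x * inverse e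
      + \<sigma>2, Vs3 := x\<^sup>2 * inverse e + \<sigma>3,
      Vt126 := (v1 - P1 * \<sigma>2 - P2 * \<sigma>3 - r1 (a e) (b e)) / d,
      Vt125 := - (v2 - P3 * \<sigma>2 - P4 * \<sigma>3 + r2 (a e) (b e)) / d,
      Vt124 := ((T1 * P2 + a e) * \<sigma>2 + v1 * x - P1 * \<sigma>3 - r3 (a e) (b e)) / d,
      Vt123 := - ((T1 * P4 + b e) * \<sigma>2 + v2 * x - P3 * \<sigma>3 + r4 (a e) (b e)) / d))"
  show ?thesis
  proof (rule that[of c \<sigma>2 \<sigma>3])
    show "c e Vs1 = inverse e" "c e Vs2 = x * inverse e + \<sigma>2" "c e Vs3 = x\<^sup>2 * inverse e + \<sigma>3" for e
      by (simp_all add: c_def)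
    show "c 0 v = y v" if "v \<in> base_vars" for v
    proof -
      have "c 0 Vt126 = y Vt126" using d by (simp add: c_def v1_def cdefs a_def b_def)
      moreover have "c 0 Vt125 = y Vt125" using d by (simp add: c_def v2_def cdefs a_def b_def)
      moreover have "(T1 * P2 + w1) * \<sigma>2 + v1 * x - P1 * \<sigma>3 = c3"
        using \<sigma>(1) by (simp add: v1_def algebra_simps)
      then have "c 0 Vt124 = y Vt124" using d by (simp add: c_def cdefs a_def b_def)
      moreover have "(T1 * P4 + w2) * \<sigma>2 + v2 * x - P3 * \<sigma>3 = c4"
        using \<sigma>(2) by (simp add: v2_def algebra_simps)
      then have "(T1 * P4 + w2) * \<sigma>2 + v2 * x - P3 * \<sigma>3 + r4 w1 w2 = - (d * y Vt123)"
        by (simp add: cdefs)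
      then have "c 0 Vt123 = - (- (d * y Vt123)) / d"
        unfolding c_def a_def b_def by (simp only: fun_upd_apply) simp
      then have "c 0 Vt123 = y Vt123" using d by simp
      ultimately show ?thesis using that by (cases v) (simp_all add: c_def base_vars_def)
    qed
    show "((\<lambda>e. c e v) \<longlongrightarrow> c 0 v) (at 0)" if "v \<in> u_vars" for v
    proof -
      have "continuous_on UNIV (\<lambda>e. c e v)"
        using that d
        by (cases v)
           (auto simp: c_def u_vars_def base_vars_def a_def b_def rdefs val_def U_defs I_defs intro!:
               continuous_intros)
      then show ?thesis by (simp add: continuous_on_def)
    qed
    fix e :: complex assume e: "e \<noteq> 0"
    have cD: "eval_at (c e) D = d" by (simp add: c_def D_def d_def defs)
    show "on_\<Pi> (c e)"
    proof (rule on_Pi_if_D_neq_0)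
      show "eval_at (c e) D \<noteq> 0" using cD d by simp
      have U: "eval_at (c e) F = val (a e) (b e) F" if "F \<in> {U\<^sub>1, U\<^sub>2, U\<^sub>3, I\<^sub>1, I\<^sub>2, I\<^sub>3}" for F
        using that by (auto simp: val_def U_defs I_defs c_def)
      have k: "e * z * inverse e = z" for z using e by simp
      have ak: "a e * inverse e = w1 * inverse e + v1" "b e * inverse e = w2 * inverse e + v2"
        by (simp_all only: a_def b_def distrib_right k)
      have "eval_at (c e) F1 = a e * inverse e - P1 * (x * inverse e + \<sigma>2) - P2 * (x\<^sup>2 * inverse e + \<sigma>3)
          - c e Vt126 * d - r1 (a e) (b e)"
        by (simp add: F\<^sub>1_def U cD) (simp add: c_def defs rdefs val_def)
      also have "\<dots> = v1 - P1 * \<sigma>2 - P2 * \<sigma>3 - c e Vt126 * d - r1 (a e) (b e)"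
        unfolding ak by (simp add: w1_def algebra_simps)
      finally show "eval_at (c e) F1 = 0" using d by (simp add: c_def)
      have "eval_at (c e) F2 = b e * inverse e - P3 * (x * inverse e + \<sigma>2) - P4 * (x\<^sup>2 * inverse e + \<sigma>3)
          + c e Vt125 * d + r2 (a e) (b e)"
        by (simp add: F\<^sub>2_def U cD) (simp add: c_def defs rdefs val_def)
      also have "\<dots> = v2 - P3 * \<sigma>2 - P4 * \<sigma>3 + c e Vt125 * d + r2 (a e) (b e)"
        unfolding ak by (simp add: w2_def algebra_simps)
      finally show "eval_at (c e) F2 = 0" using d by (simp add: c_def)
      have t2: "y Vt2 = x ^ 3 + T1 * x" using x by (simp add: defs)
      have "eval_at (c e) F3 = - (y Vt2 * P2 * inverse e) + T1 * P2 * (x * inverse e) + (a e * inverse e) * x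
          - P1 * (x\<^sup>2 * inverse e + \<sigma>3)
          + (T1 * P2 + a e) * \<sigma>2 - c e Vt124 * d - r3 (a e) (b e)"
        by (simp add: F\<^sub>3_def U cD) (simp add: c_def defs rdefs val_def algebra_simps)
      also have "\<dots> = (T1 * P2 + a e) * \<sigma>2 + v1 * x - P1 * \<sigma>3 - c e Vt124 * d - r3 (a e) (b e)"
        unfolding ak t2 by (simp add: w1_def algebra_simps power2_eq_square power3_eq_cube)
      finally show "eval_at (c e) F3 = 0" using d by (simp add: c_def)
      have "eval_at (c e) F4 = - (y Vt2 * P4 * inverse e) + T1 * P4 * (x * inverse e) + (b e * inverse e) * x
          - P3 * (x\<^sup>2 * inverse e + \<sigma>3)
          + (T1 * P4 + b e) * \<sigma>2 + c e Vt123 * d + r4 (a e) (b e)"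
        by (simp add: F\<^sub>4_def U cD) (simp add: c_def defs rdefs val_def algebra_simps)
      also have "\<dots> = (T1 * P4 + b e) * \<sigma>2 + v2 * x - P3 * \<sigma>3 + c e Vt123 * d + r4 (a e) (b e)"
        unfolding ak t2 by (simp add: w2_def algebra_simps power2_eq_square power3_eq_cube)
      finally show "eval_at (c e) F4 = 0" using d by (simp add: c_def)
    qed
  qed
qed

text \<open>Evaluate the relation on the curve, multiply by e^(n+1) and let e tend to 0. Since s1 = 1/e, only
  the terms of degree n in s1 survive, weighted by the direction (1, x, x^2) of s.\<close>
lemma top_s_coeffs_at_root:
  assumes g: "g1 \<in> polys_in s_vars" "g2 \<in> polys_in s_vars" "g3 \<in> polys_in s_vars" "h \<in> polys_in u_vars"
    and I: "s1 * g1 + s2 * g2 + s3 * g3 + h \<in> ideal_\<Pi>"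
    and deg: "degree (uni Vs1 g1) \<le> n" "degree (uni Vs1 g2) \<le> n" "degree (uni Vs1 g3) \<le> n"
    and y: "eval_at y D \<noteq> 0" "y Vt2 = x ^ 3 + y Vt1 * x" "y Vt1 + 3 * x\<^sup>2 \<noteq> 0"
  shows "eval_at y (coeff (uni Vs1 g1) n) + eval_at y (coeff (uni Vs1 g2) n) * x
      + eval_at y (coeff (uni Vs1 g3) n) * x\<^sup>2 = 0"
proof -
  let ?b = "\<lambda>g i. coeff (uni Vs1 g) i"
  have b_in: "?b g i \<in> polys_in base_vars" if "g \<in> polys_in s_vars" for g i
    using coeff_uni_in[OF that, of Vs1 i] by (auto simp: s_vars_def elim!: polys_in_mono)
  obtain c \<sigma>2 \<sigma>3 where c: "\<And>e. e \<noteq> 0 \<Longrightarrow> on_\<Pi> (c e)"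
    and s: "\<And>e. c e Vs1 = inverse e" "\<And>e. c e Vs2 = x * inverse e + \<sigma>2" "\<And>e. c e Vs3 = x\<^sup>2 * inverse e + \<sigma>3"
    and lim: "\<And>v. v \<in> u_vars \<Longrightarrow> ((\<lambda>e. c e v) \<longlongrightarrow> c 0 v) (at 0)"
    and c0: "\<And>v. v \<in> base_vars \<Longrightarrow> c 0 v = y v"
    using curve_at_infinity[OF y] by metis
  \<comment> \<open>e ^ Suc n times the value of the relation on the curve, in a form that makes sense at e = 0\<close>
  define S where "S e = (\<Sum>i\<le>n. (eval_at (c e) (?b g1 i) + eval_at (c e) (?b g2 i) * (x + e * \<sigma>2)
     + eval_at (c e) (?b g3 i) * (x\<^sup>2 + e * \<sigma>3)) * e ^ (n - i)) + e ^ Suc n * eval_at (c e) h" for e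
  have S0: "S e = 0" if e: "e \<noteq> 0" for e
  proof -
    have "e ^ n * eval_at (c e) g = (\<Sum>i\<le>n. eval_at (c e) (?b g i) * e ^ (n - i))"
      if "degree (uni Vs1 g) \<le> n" for g
    proof -
      have "g = (\<Sum>i\<le>n. ?b g i * s1 ^ i)"
        by (subst uni_sum_coeff[of g Vs1], rule sum.mono_neutral_left)
           (use that in \<open>auto simp: coeff_eq_0\<close>)
      then have "eval_at (c e) g = eval_at (c e) (\<Sum>i\<le>n. ?b g i * s1 ^ i)" by (rule arg_cong)
      then have "eval_at (c e) g = (\<Sum>i\<le>n. eval_at (c e) (?b g i) * inverse e ^ i)"
          by (simp only: eval_at_simps s(1))
      then have "e ^ n * eval_at (c e) g = (\<Sum>i\<le>n. e ^ n * (eval_at (c e) (?b g i) * inverse e ^ i))"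
        by (simp add: sum_distrib_left)
      also have "\<dots> = (\<Sum>i\<le>n. eval_at (c e) (?b g i) * e ^ (n - i))"
        using e by (intro sum.cong) (auto simp: power_diff power_inverse divide_inverse)
      finally show ?thesis .
    qed
    from this[OF deg(1)] this[OF deg(2)] this[OF deg(3)]
    have g_eq: "e ^ n * eval_at (c e) g1 = (\<Sum>i\<le>n. eval_at (c e) (?b g1 i) * e ^ (n - i))"
      "e ^ n * eval_at (c e) g2 = (\<Sum>i\<le>n. eval_at (c e) (?b g2 i) * e ^ (n - i))"
      "e ^ n * eval_at (c e) g3 = (\<Sum>i\<le>n. eval_at (c e) (?b g3 i) * e ^ (n - i))" .
    have es: "e * c e Vs1 = 1" "e * c e Vs2 = x + e * \<sigma>2" "e * c e Vs3 = x\<^sup>2 + e * \<sigma>3"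
      using e by (simp_all add: s algebra_simps)
    have "0 = e ^ Suc n * eval_at (c e) (s1 * g1 + s2 * g2 + s3 * g3 + h)"
      using eval_at_ideal_Pi[OF I c[OF e]] by simp
    also have "\<dots> = (e * c e Vs1) * (e ^ n * eval_at (c e) g1) + (e * c e Vs2) * (e ^ n * eval_at (c e) g2)
        + (e * c e Vs3) * (e ^ n * eval_at (c e) g3) + e ^ Suc n * eval_at (c e) h"
      by (simp add: algebra_simps)
    also have "\<dots> = S e"
      unfolding es g_eq S_def by (simp add: sum.distrib sum_distrib_left algebra_simps)
    finally show ?thesis by simp
  qed
  have lim_b: "((\<lambda>e. eval_at (c e) (?b g i)) \<longlongrightarrow> eval_at y (?b g i)) (at 0)" if "g \<in> polys_in s_vars" for g i
  proof -
    have "eval_at y (?b g i) = eval_at (c 0) (?b g i)" using b_in[OF that] c0 by (intro eval_at_cong) auto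
    moreover have "((\<lambda>e. eval_at (c e) (?b g i)) \<longlongrightarrow> eval_at (c 0) (?b g i)) (at 0)"
      by (rule tendsto_eval_at[OF b_in[OF that]]) (use lim in \<open>auto simp: u_vars_def\<close>)
    ultimately show ?thesis by simp
  qed
  have "(S \<longlongrightarrow> (\<Sum>i\<le>n. (eval_at y (?b g1 i) + eval_at y (?b g2 i) * (x + 0 * \<sigma>2)
     + eval_at y (?b g3 i) * (x\<^sup>2 + 0 * \<sigma>3)) * 0 ^ (n - i)) + 0 ^ Suc n * eval_at (c 0) h) (at 0)"
    unfolding S_def using g lim
    by (intro tendsto_intros lim_b tendsto_eval_at[of h u_vars]) auto
  moreover have "(S \<longlongrightarrow> 0) (at 0)"
    by (rule tendsto_eventually) (use S0 in \<open>auto simp: eventually_at_filter\<close>)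
  ultimately have "(\<Sum>i\<le>n. (eval_at y (?b g1 i) + eval_at y (?b g2 i) * (x + 0 * \<sigma>2)
     + eval_at y (?b g3 i) * (x\<^sup>2 + 0 * \<sigma>3)) * 0 ^ (n - i)) + 0 ^ Suc n * eval_at (c 0) h = 0"
    by (rule tendsto_unique[rotated]) simp
  moreover have "(\<Sum>i\<le>n. (eval_at y (?b g1 i) + eval_at y (?b g2 i) * x + eval_at y (?b g3 i) * x\<^sup>2) * 0 ^ (n
      - i))
      = (\<Sum>i\<in>{n}. (eval_at y (?b g1 i) + eval_at y (?b g2 i) * x + eval_at y (?b g3 i) * x\<^sup>2) * 0 ^ (n - i))"
    by (rule sum.mono_neutral_right) auto
  ultimately show ?thesis by simp
qed

text \<open>The condition is that the discriminant of the cubic is nonzero. One root comes from the fundamental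
  theorem of algebra, the others from the quadratic formula.\<close>
lemma cubic_roots:
  fixes a b :: complex
  assumes "4 * a ^ 3 + 27 * b\<^sup>2 \<noteq> 0"
  obtains x1 x2 x3 where "x1 \<noteq> x2" "x1 \<noteq> x3" "x2 \<noteq> x3"
    "\<And>x. x \<in> {x1, x2, x3} \<Longrightarrow> b = x ^ 3 + a * x \<and> a + 3 * x\<^sup>2 \<noteq> 0"
proof -
  have "\<not> constant (poly [:- b, a, 0, 1:])"
    by (simp add: constant_degree)
  from fundamental_theorem_of_algebra[OF this]
  obtain x1 where "poly [:- b, a, 0, 1:] x1 = 0" by blast
  then have x1: "b = x1 ^ 3 + a * x1" by (simp add: algebra_simps power3_eq_cube)
  define \<delta> where "\<delta> = csqrt (- 3 * x1\<^sup>2 - 4 * a)"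
  have \<delta>: "\<delta>\<^sup>2 = - 3 * x1\<^sup>2 - 4 * a" by (simp add: \<delta>_def)
  define x2 x3 where "x2 = (\<delta> - x1) / 2" and "x3 = (- \<delta> - x1) / 2"
  have a: "a = (- 3 * x1\<^sup>2 - \<delta>\<^sup>2) / 4" using \<delta> by simp
  have disc: "4 * a ^ 3 + 27 * b\<^sup>2 = - (((x1 - x2) * (x1 - x3) * (x2 - x3))\<^sup>2)"
  proof -
    have "(x1 - x2) * (x1 - x3) * (x2 - x3) = (9 * x1\<^sup>2 - \<delta>\<^sup>2) / 4 * \<delta>"
      by (simp add: x2_def x3_def field_simps power2_eq_square)
    then have "- (((x1 - x2) * (x1 - x3) * (x2 - x3))\<^sup>2) = - ((9 * x1\<^sup>2 - \<delta>\<^sup>2) / 4)\<^sup>2 * \<delta>\<^sup>2"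
      by (simp only: power_mult_distrib) simp
    also have "\<dots> = 4 * a ^ 3 + 27 * b\<^sup>2"
      unfolding x1 \<delta> by (simp add: field_simps power2_eq_square power3_eq_cube)
    finally show ?thesis by simp
  qed
  have ne: "x1 \<noteq> x2" "x1 \<noteq> x3" "x2 \<noteq> x3" using assms unfolding disc by auto
  have sum: "x1 + x2 + x3 = 0" by (simp add: x2_def x3_def field_simps)
  have a': "a = x1 * x2 + x1 * x3 + x2 * x3"
    unfolding a x2_def x3_def by (simp add: field_simps power2_eq_square)
  have x3: "x3 = - x1 - x2" proof -
    have "x3 = (x1 + x2 + x3) - x1 - x2" by simp
    then show ?thesis unfolding sum by simp
  qed
  have d: "a + 3 * x1\<^sup>2 = (x1 - x2) * (x1 - x3)" "a + 3 * x2\<^sup>2 = (x2 - x1) * (x2 - x3)"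
    "a + 3 * x3\<^sup>2 = (x3 - x1) * (x3 - x2)"
    unfolding a' x3 by (simp_all add: algebra_simps power2_eq_square)
  have roots: "b = x2 ^ 3 + a * x2" "b = x3 ^ 3 + a * x3"
    unfolding x1 a' x3 by (simp_all add: algebra_simps power2_eq_square power3_eq_cube)
  have "a + 3 * x1\<^sup>2 \<noteq> 0" "a + 3 * x2\<^sup>2 \<noteq> 0" "a + 3 * x3\<^sup>2 \<noteq> 0"
    unfolding d using ne by simp_all
  with x1 roots ne show ?thesis by (intro that[of x1 x2 x3]) blast+
qed

lemma quadratic_eq_0:
  fixes b1 b2 b3 :: complex
  assumes "\<And>x. x \<in> {x1, x2, x3} \<Longrightarrow> b1 + b2 * x + b3 * x\<^sup>2 = 0"
    and ne: "x1 \<noteq> x2" "x1 \<noteq> x3" "x2 \<noteq> x3"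
  shows "b1 = 0" "b2 = 0" "b3 = 0"
proof -
  have "poly [:b1, b2, b3:] x = 0" if "x \<in> {x1, x2, x3}" for x
    using assms(1)[OF that] by (simp add: algebra_simps power2_eq_square)
  then have sub: "{x1, x2, x3} \<subseteq> {x. poly [:b1, b2, b3:] x = 0}" by blast
  have "[:b1, b2, b3:] = 0"
  proof (rule ccontr)
    assume nz: "[:b1, b2, b3:] \<noteq> 0"
    have "3 = card {x1, x2, x3}" using ne by simp
    also have "\<dots> \<le> card {x. poly [:b1, b2, b3:] x = 0}"
      by (rule card_mono[OF poly_roots_finite[OF nz] sub])
    also have "\<dots> \<le> degree [:b1, b2, b3:]" by (rule card_poly_roots_bound[OF nz])
    also have "\<dots> \<le> 2" by simp
    finally show False by simp
  qed
  then show "b1 = 0" "b2 = 0" "b3 = 0" by simp_all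
qed

text \<open>Where D and the discriminant of x^3 + t1 x - t2 are nonzero, the three roots x give three linear
  equations for the three top coefficients, with a Vandermonde matrix. So the top coefficients
  vanish on a dense set, and the degrees can be lowered until nothing is left.\<close>
lemma s_part_eq_0:
  assumes g: "g1 \<in> polys_in s_vars" "g2 \<in> polys_in s_vars" "g3 \<in> polys_in s_vars" "h \<in> polys_in u_vars"
    and I: "s1 * g1 + s2 * g2 + s3 * g3 + h \<in> ideal_\<Pi>"
  shows "g1 = 0" "g2 = 0" "g3 = 0"
proof -
  let ?b = "\<lambda>g i. coeff (uni Vs1 g) i"
  define disc where "disc = 4 * t1 ^ 3 + 27 * t2\<^sup>2"
  have "disc \<noteq> 0"
  proof
    assume "disc = 0"
    then have "eval_at (\<lambda>v. 1) disc = 0" by simp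
    then show False by (simp add: disc_def)
  qed
  then have nz: "D * disc \<noteq> 0" using D_neq_0 by simp
  have vanish: "?b g1 n = 0 \<and> ?b g2 n = 0 \<and> ?b g3 n = 0"
    if deg: "degree (uni Vs1 g1) \<le> n" "degree (uni Vs1 g2) \<le> n" "degree (uni Vs1 g3) \<le> n" for n
  proof -
    have *: "eval_at y (?b g1 n) = 0 \<and> eval_at y (?b g2 n) = 0 \<and> eval_at y (?b g3 n) = 0"
        if "eval_at y (D * disc) \<noteq> 0" for y
    proof -
      have "4 * y Vt1 ^ 3 + 27 * (y Vt2)\<^sup>2 \<noteq> 0" and D: "eval_at y D \<noteq> 0"
        using that by (auto simp: disc_def)
      from cubic_roots[OF this(1)] obtain x1 x2 x3 where ne: "x1 \<noteq> x2" "x1 \<noteq> x3" "x2 \<noteq> x3"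
        and x: "\<And>x. x \<in> {x1, x2, x3} \<Longrightarrow> y Vt2 = x ^ 3 + y Vt1 * x \<and> y Vt1 + 3 * x\<^sup>2 \<noteq> 0"
        by metis
      have "eval_at y (?b g1 n) + eval_at y (?b g2 n) * x + eval_at y (?b g3 n) * x\<^sup>2 = 0"
          if "x \<in> {x1, x2, x3}" for x
        using x[OF that] by (intro top_s_coeffs_at_root[OF g I deg D]) auto
      from quadratic_eq_0[OF this ne] show ?thesis by blast
    qed
    show ?thesis
      using eq_0_if_eval_at_eq_0_dense[OF nz, of "?b g1 n"] eq_0_if_eval_at_eq_0_dense[OF nz, of "?b g2 n"]
        eq_0_if_eval_at_eq_0_dense[OF nz, of "?b g3 n"] * by blast
  qed
  define n where "n = max (degree (uni Vs1 g1)) (max (degree (uni Vs1 g2)) (degree (uni Vs1 g3)))"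
  have less: "degree p \<le> m" if "degree p \<le> Suc m" "coeff p (Suc m) = 0" for p :: "cpoly poly" and m
    using that by (metis le_SucE leading_coeff_0_iff degree_0 zero_le)
  have "degree (uni Vs1 g1) \<le> n - k \<and> degree (uni Vs1 g2) \<le> n - k \<and> degree (uni Vs1 g3) \<le> n - k" for k
  proof (induction k)
    case 0
    then show ?case by (auto simp: n_def le_max_iff_disj)
  next
    case (Suc k)
    show ?case
    proof (cases "n - k")
      case (Suc m)
      then have "n - Suc k = m" by simp
      then show ?thesis using Suc.IH vanish[of "Suc m"] less[of _ m] Suc by simp
    qed (use Suc.IH in simp)
  qed
  from this[of n] have d0: "degree (uni Vs1 g1) = 0" "degree (uni Vs1 g2) = 0" "degree (uni Vs1 g3) = 0"
      by simp_all
  with vanish[of 0] have "uni Vs1 g1 = 0" "uni Vs1 g2 = 0" "uni Vs1 g3 = 0"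
    by (metis leading_coeff_0_iff order_refl)+
  then show "g1 = 0" "g2 = 0" "g3 = 0" by simp_all
qed

section \<open>Elimination of s and the nonzerodivisors D and E\<close>

text \<open>Localization without constructing it: modulo J, these are the elements that lie in the subring R
  after inverting e.\<close>
definition fractions :: "cpoly set \<Rightarrow> cpoly set \<Rightarrow> cpoly \<Rightarrow> cpoly set" where
  "fractions J R e = {f. \<exists>N. \<exists>r\<in>R. e ^ N * f - r \<in> J}"

locale fraction_setting =
  fixes J R :: "cpoly set" and e :: cpoly
  assumes J0: "0 \<in> J" and J_add: "\<And>f g. f \<in> J \<Longrightarrow> g \<in> J \<Longrightarrow> f + g \<in> J" and J_mult: "\<And>f g. f \<in> J \<Longrightarrow> g * f \<in> J"
    and R_cst: "\<And>c. cst c \<in> R" and R_add: "\<And>f g. f \<in> R \<Longrightarrow> g \<in> R \<Longrightarrow> f + g \<in> R"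
    and R_mult: "\<And>f g. f \<in> R \<Longrightarrow> g \<in> R \<Longrightarrow> f * g \<in> R" and e_R: "e \<in> R"
begin

lemma e_power_R: "e ^ n \<in> R"
  by (induction n) (use R_cst[of 1] R_mult e_R in auto)

lemma fractions_base: "r \<in> R \<Longrightarrow> r \<in> fractions J R e"
  unfolding fractions_def by (auto intro!: exI[of _ 0] bexI[of _ r] simp: J0)

lemma fractions_add:
  assumes "f \<in> fractions J R e" "g \<in> fractions J R e"
  shows "f + g \<in> fractions J R e"
proof -
  from assms obtain M N r s where r: "r \<in> R" "e ^ M * f - r \<in> J" and s: "s \<in> R" "e ^ N * g - s \<in> J"
    by (auto simp: fractions_def)
  have "e ^ (M + N) * (f + g) - (e ^ N * r + e ^ M * s) = e ^ N * (e ^ M * f - r) + e ^ M * (e ^ N * g - s)"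
    by (simp add: algebra_simps power_add)
  also have "\<dots> \<in> J" by (intro J_add J_mult r s)
  finally show ?thesis
    unfolding fractions_def using e_power_R r s R_add R_mult by blast
qed

lemma fractions_mult:
  assumes "f \<in> fractions J R e" "g \<in> fractions J R e"
  shows "f * g \<in> fractions J R e"
proof -
  from assms obtain M N r s where r: "r \<in> R" "e ^ M * f - r \<in> J" and s: "s \<in> R" "e ^ N * g - s \<in> J"
    by (auto simp: fractions_def)
  have "e ^ (M + N) * (f * g) - r * s = (e ^ N * g) * (e ^ M * f - r) + r * (e ^ N * g - s)"
    by (simp add: algebra_simps power_add)
  also have "\<dots> \<in> J" by (intro J_add J_mult r s)
  finally show ?thesis
    unfolding fractions_def using r s R_mult by blast
qed

lemma fractions_uminus: "f \<in> fractions J R e \<Longrightarrow> - f \<in> fractions J R e"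
  using fractions_mult[OF fractions_base[OF R_cst[of "-1"]], of f] by (simp add: cst_minus)

lemma fractions_diff: "f \<in> fractions J R e \<Longrightarrow> g \<in> fractions J R e \<Longrightarrow> f - g \<in> fractions J R e"
  using fractions_add[of f "- g"] fractions_uminus by simp

lemma fractions_polys_in:
  "f \<in> polys_in V \<Longrightarrow> (\<And>v. v \<in> V \<Longrightarrow> \<xi> v \<in> fractions J R e) \<Longrightarrow> f \<in> fractions J R e"
  by (induction rule: polys_in.induct) (auto intro: fractions_add fractions_mult fractions_base R_cst)

lemma fractions_cong:
  assumes "f - g \<in> J" "g \<in> fractions J R e"
  shows "f \<in> fractions J R e"
proof -
  from assms(2) obtain N r where r: "r \<in> R" "e ^ N * g - r \<in> J" by (auto simp: fractions_def)
  have "e ^ N * f - r = (e ^ N * g - r) + e ^ N * (f - g)" by (simp add: algebra_simps)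
  also have "\<dots> \<in> J" by (intro J_add J_mult r assms)
  finally show ?thesis unfolding fractions_def using r by blast
qed

text \<open>A factor a of e is invertible as well, with inverse c/e.\<close>
lemma fractions_cancel:
  assumes "a * f \<in> fractions J R e" "e = c * a" "c \<in> fractions J R e"
  shows "f \<in> fractions J R e"
proof -
  have "e * f \<in> fractions J R e"
    using fractions_mult[OF assms(3,1)] by (simp add: assms(2) mult_ac)
  then obtain N r where r: "r \<in> R" "e ^ N * (e * f) - r \<in> J" by (auto simp: fractions_def)
  then have "e ^ Suc N * f - r \<in> J" by (simp add: mult_ac)
  then show ?thesis unfolding fractions_def using r by blast
qed

end

lemma linear_system_3:
  fixes a1 a2 a3 b1 b2 b3 c1 c2 c3 :: complex
  assumes "a1 * (b2 * c3 - b3 * c2) - a2 * (b1 * c3 - b3 * c1) + a3 * (b1 * c2 - b2 * c1) \<noteq> 0" (is "?d \<noteq> 0")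
  obtains x y z where "a1 * x + a2 * y + a3 * z = r1" "b1 * x + b2 * y + b3 * z = r2" "c1 * x + c2 * y
      + c3 * z = r3"
proof
  let ?x = "r1 * (b2 * c3 - b3 * c2) - a2 * (r2 * c3 - b3 * r3) + a3 * (r2 * c2 - b2 * r3)"
  let ?y = "a1 * (r2 * c3 - b3 * r3) - r1 * (b1 * c3 - b3 * c1) + a3 * (b1 * r3 - r2 * c1)"
  let ?z = "a1 * (b2 * r3 - r2 * c2) - a2 * (b1 * r3 - r2 * c1) + r1 * (b1 * c2 - b2 * c1)"
  have *: "v1 * (x / d) + v2 * (y / d) + v3 * (z / d) = r"
    if "d \<noteq> 0" "v1 * x + v2 * y + v3 * z = d * r" for d x y z v1 v2 v3 r :: complex
  proof -
    have "v1 * (x / d) + v2 * (y / d) + v3 * (z / d) = (v1 * x + v2 * y + v3 * z) / d"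
      by (simp add: add_divide_distrib)
    then show ?thesis unfolding that(2) using that(1) by simp
  qed
  show "a1 * (?x / ?d) + a2 * (?y / ?d) + a3 * (?z / ?d) = r1"
    by (rule *[OF assms]) (simp only: algebra_simps)
  show "b1 * (?x / ?d) + b2 * (?y / ?d) + b3 * (?z / ?d) = r2"
    by (rule *[OF assms]) (simp only: algebra_simps)
  show "c1 * (?x / ?d) + c2 * (?y / ?d) + c3 * (?z / ?d) = r3"
    by (rule *[OF assms]) (simp only: algebra_simps)
qed

text \<open>The equation F10 = 0 is solved for t246, whose coefficient is m246. Then the linear equations F1 =
  F2 = F3 = 0, with determinant m123, are solved for s. By D_F10 the equation F4 = 0 follows.\<close>
lemma point_over_hypersurface:
  assumes "eval_at y D \<noteq> 0" "eval_at y m246 \<noteq> 0" "eval_at y m123 \<noteq> 0"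
  shows "\<exists>z. on_\<Pi> z \<and> (\<forall>v\<in>u_vars - {Vt246}. z v = y v)"
proof -
  let ?T = "y(Vt246 := - eval_at (y(Vt246 := 0)) F10 / eval_at y m246)"
  let ?r = "\<lambda>F. eval_at (?T(Vs1 := 0, Vs2 := 0, Vs3 := 0)) F"
  define a1 a2 a3 b1 b2 b3 c1 c2 c3 where
    "a1 = y Vu1" "a2 = - y Vp1" "a3 = - y Vp2"
    "b1 = y Vu2" "b2 = - y Vp3" "b3 = - y Vp4"
    "c1 = - y Vt2 * y Vp2" "c2 = y Vt1 * y Vp2 + y Vu1" "c3 = - y Vp1"
  note coeffs = this
  have "a1 * (b2 * c3 - b3 * c2) - a2 * (b1 * c3 - b3 * c1) + a3 * (b1 * c2 - b2 * c1) = eval_at y m123"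
    unfolding coeffs m123_def by (simp add: algebra_simps power2_eq_square)
  also have "\<dots> \<noteq> 0" by (rule assms)
  finally obtain x1 x2 x3 where x: "a1 * x1 + a2 * x2 + a3 * x3 = - ?r F1"
    "b1 * x1 + b2 * x2 + b3 * x3 = - ?r F2" "c1 * x1 + c2 * x2 + c3 * x3 = - ?r F3"
    by (rule linear_system_3)
  define z where "z = ?T(Vs1 := x1, Vs2 := x2, Vs3 := x3)"
  have zv: "z v = y v" if "v \<in> u_vars - {Vt246}" for v
    using that by (cases v) (simp_all add: z_def u_vars_def base_vars_def)
  have same: "eval_at z f = eval_at y f" if "f \<in> polys_in (u_vars - {Vt246})" for f
    using zv that by (intro eval_at_cong) auto
  have D: "eval_at z D = eval_at y D"
    by (rule same) (simp add: D_in u_vars_def base_vars_def)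
  have m246: "eval_at z m246 = eval_at y m246"
    by (rule same) (unfold m246_def u_vars_def base_vars_def, intro polys_in_intros; simp)
  have m123: "eval_at z m123 = eval_at y m123"
    by (rule same) (unfold m123_def u_vars_def base_vars_def, intro polys_in_intros; simp)
  have F1: "eval_at z F1 = 0"
  proof -
    have "eval_at z F1 = a1 * x1 + a2 * x2 + a3 * x3 + ?r F1"
      by (simp add: z_def F\<^sub>1_def D_def U_defs coeffs)
    then show ?thesis using x by simp
  qed
  have F2: "eval_at z F2 = 0"
  proof -
    have "eval_at z F2 = b1 * x1 + b2 * x2 + b3 * x3 + ?r F2"
      by (simp add: z_def F\<^sub>2_def D_def U_defs coeffs)
    then show ?thesis using x by simp
  qed
  have F3: "eval_at z F3 = 0"
  proof -
    have "eval_at z F3 = c1 * x1 + c2 * x2 + c3 * x3 + ?r F3"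
      by (simp add: z_def F\<^sub>3_def D_def I_defs coeffs)
    then show ?thesis using x by simp
  qed
  define rest where "rest = t123 * m123 + t124 * m124 + t125 * m125 + t126 * m126 + t135 * m135
    + t136 * m136 + t245 * m245"
  have F10_rest: "F10 = rest + t246 * m246" by (simp add: rest_def F10_def)
  have rest: "eval_at z rest = eval_at y rest" "eval_at (y(Vt246 := 0)) rest = eval_at y rest"
  proof -
    have *: "rest \<in> polys_in (u_vars - {Vt246})"
      unfolding rest_def m_defs u_vars_def base_vars_def by (intro polys_in_intros; simp)
    then show "eval_at z rest = eval_at y rest" by (rule same)
    show "eval_at (y(Vt246 := 0)) rest = eval_at y rest" by (rule eval_at_cong[OF *]) auto
  qed
  have "eval_at (y(Vt246 := 0)) F10 = eval_at y rest" unfolding F10_rest by (simp add: rest)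
  then have "z Vt246 = - eval_at y rest / eval_at y m246" by (simp add: z_def)
  moreover have "eval_at z F10 = eval_at y rest + z Vt246 * eval_at y m246"
    unfolding F10_rest by (simp add: rest m246)
  ultimately have F10: "eval_at z F10 = 0" using assms(2) by simp
  have F4: "eval_at z F4 = 0"
    using arg_cong[OF D_F10, of "eval_at z"] assms by (simp add: F10 F1 F2 F3 m123)
  have "on_\<Pi> z" by (rule on_Pi_if_D_neq_0) (simp_all add: D assms F1 F2 F3 F4)
  then show ?thesis using zv by blast
qed

lemma m246_neq_0: "m246 \<noteq> 0" and m123_neq_0: "m123 \<noteq> 0"
proof -
  have "eval_at (\<lambda>v. if v = Vu2 then 1 else 0) m246 \<noteq> 0" by (simp add: m246_def)
  then show "m246 \<noteq> 0" by auto
  have "eval_at (\<lambda>v. if v = Vu2 \<or> v = Vp1 then 1 else 0) m123 \<noteq> 0" by (simp add: m123_def)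
  then show "m123 \<noteq> 0" by auto
qed

text \<open>Powers of m246 appear as denominators when t246 is eliminated by means of F10. Being regular modulo
  F10, they can be cancelled in the end.\<close>
lemma m246_power_dvd_F10_mult: "m246 ^ n dvd F10 * k \<Longrightarrow> m246 ^ n dvd k"
proof (induction n arbitrary: k)
  case (Suc n)
  then have "m246 dvd F10 * k" by (metis dvd_mult_left power_Suc)
  then have "m246 dvd k" by (rule m246_dvd_F10_mult)
  then obtain k' where k: "k = m246 * k'" by (rule dvdE)
  have "m246 * m246 ^ n dvd m246 * (F10 * k')"
    using Suc.prems unfolding k power_Suc by (simp only: mult.left_commute)
  then have "m246 ^ n dvd F10 * k'" using m246_neq_0 by simp
  then have "m246 ^ n dvd k'" by (rule Suc.IH)
  then show ?case unfolding k power_Suc by (rule mult_dvd_mono[OF dvd_refl])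
qed simp

lemma eliminate_t246:
  assumes "h \<in> polys_in u_vars"
  shows "h \<in> fractions {f. F10 dvd f} (polys_in (u_vars - {Vt246})) m246"
proof -
  let ?J = "{f. F10 dvd f}" and ?R = "polys_in (u_vars - {Vt246})"
  have m246: "m246 \<in> ?R"
    unfolding m246_def u_vars_def base_vars_def by (intro polys_in_intros; simp)
  interpret fraction_setting ?J ?R m246
    by unfold_locales (auto intro: polys_in.intros m246)
  show ?thesis
  proof (rule fractions_polys_in[OF assms])
    fix v assume v: "v \<in> u_vars"
    show "\<xi> v \<in> fractions ?J ?R m246"
    proof (cases "v = Vt246")
      case True
      let ?rest = "t123 * m123 + t124 * m124 + t125 * m125 + t126 * m126 + t135 * m135
        + t136 * m136 + t245 * m245"
      have "m246 ^ 1 * \<xi> v - (- ?rest) = F10"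
        by (simp add: True F10_def algebra_simps)
      then have in_J: "m246 ^ 1 * \<xi> v - (- ?rest) \<in> ?J" by (simp only: mem_Collect_eq dvd_refl)
      have in_R: "- ?rest \<in> ?R"
        unfolding m_defs u_vars_def base_vars_def by (intro polys_in_intros; simp)
      show ?thesis
        unfolding fractions_def by (rule CollectI, rule exI[of _ 1], rule bexI[OF _ in_R], rule in_J)
    next
      case False
      have in_R: "\<xi> v \<in> ?R" using v False by (intro polys_in.var) auto
      show ?thesis
        unfolding fractions_def by (rule CollectI, rule exI[of _ 0], rule bexI[OF _ in_R]) simp
    qed
  qed
qed

text \<open>Modulo F10 and up to a power of m246, the polynomial h does not involve t246. What is left vanishes
  at a dense set of points, since generic values of the coordinates in u_vars other than t246 occur
  at points of the scheme.\<close>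
lemma F10_dvd_if_in_ideal_Pi:
  assumes "h \<in> polys_in u_vars" "h \<in> ideal_\<Pi>"
  shows "F10 dvd h"
proof -
  obtain N r where r: "r \<in> polys_in (u_vars - {Vt246})" and dvd: "F10 dvd m246 ^ N * h - r"
    using eliminate_t246[OF assms(1)] unfolding fractions_def by blast
  have "r = 0"
  proof (rule eq_0_if_eval_at_eq_0_dense)
    show "D * (m246 * m123) \<noteq> 0" using D_neq_0 m246_neq_0 m123_neq_0 by simp
    fix y assume "eval_at y (D * (m246 * m123)) \<noteq> 0"
    then have "eval_at y D \<noteq> 0" "eval_at y m246 \<noteq> 0" "eval_at y m123 \<noteq> 0" by simp_all
    from point_over_hypersurface[OF this]
    obtain z where z: "on_\<Pi> z" "\<forall>v\<in>u_vars - {Vt246}. z v = y v" by blast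
    obtain k where "m246 ^ N * h - r = F10 * k" using dvdE[OF dvd] by blast
    then have k: "r = m246 ^ N * h - F10 * k" by (simp flip: \<open>_ = F10 * k\<close>)
    have "eval_at z r = 0"
      unfolding k using eval_at_ideal_Pi[OF assms(2) z(1)] eval_at_ideal_Pi[OF F10_in_ideal z(1)] by simp
    then show "eval_at y r = 0" using eval_at_cong[OF r, of z y] z(2) by simp
  qed
  with dvd have "F10 dvd m246 ^ N * h" by simp
  then obtain k where k: "m246 ^ N * h = F10 * k" by (rule dvdE)
  then have "m246 ^ N dvd F10 * k" by (metis dvd_triv_left)
  then have "m246 ^ N dvd k" by (rule m246_power_dvd_F10_mult)
  then obtain k' where "k = m246 ^ N * k'" by (rule dvdE)
  with k have "m246 ^ N * h = m246 ^ N * (F10 * k')" by (simp add: mult_ac)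
  then have "h = F10 * k'" using m246_neq_0 by simp
  then show ?thesis by simp
qed

lemma D_in_vars: "D \<in> polys_in s_vars" "D \<in> polys_in u_vars" "E \<in> polys_in s_vars" "E \<in> polys_in u_vars"
  by (auto simp: s_vars_def u_vars_def base_vars_def intro!: D_in E_in)

text \<open>Multiplication by D respects normal forms. So the s-part of f vanishes by uniqueness, and for the
  other part h, divisibility of D h by F10 implies that of h, because D is regular modulo F10.\<close>
lemma D_regular:
  assumes "D * f \<in> ideal_\<Pi>"
  shows "f \<in> ideal_\<Pi>"
proof -
  obtain g1 g2 g3 h where g: "g1 \<in> polys_in s_vars" "g2 \<in> polys_in s_vars" "g3 \<in> polys_in s_vars" "h \<in>
      polys_in u_vars"
    and f: "f - (s1 * g1 + s2 * g2 + s3 * g3 + h) \<in> ideal_\<Pi>" by (rule normal_form)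
  have I: "s1 * (D * g1) + s2 * (D * g2) + s3 * (D * g3) + D * h \<in> ideal_\<Pi>"
    using ideal_Pi_diff[OF assms ideal_Pi_mult[OF f, of D]] by (simp add: algebra_simps)
  have in_vars: "D * g1 \<in> polys_in s_vars" "D * g2 \<in> polys_in s_vars" "D * g3 \<in> polys_in s_vars" "D * h \<in>
      polys_in u_vars"
    using g D_in_vars by (auto intro: polys_in.mult)
  from s_part_eq_0[OF in_vars I] have g0: "g1 = 0" "g2 = 0" "g3 = 0" using D_neq_0 by simp_all
  with I have "D * h \<in> ideal_\<Pi>" by simp
  with in_vars obtain k where k: "D * h = F10 * k" using F10_dvd_if_in_ideal_Pi by (metis dvdE)
  then have "D dvd F10 * k" by (metis dvd_triv_left)
  then have "D dvd k" by (rule D_dvd_F10_mult)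
  then obtain k' where "k = D * k'" by (rule dvdE)
  with k have "D * h = D * (F10 * k')" by (simp add: mult_ac)
  then have "h = F10 * k'" using D_neq_0 by simp
  then have "h \<in> ideal_\<Pi>" using ideal_Pi_mult_right[OF F10_in_ideal] by simp
  with f g0 show ?thesis using ideal_Pi_add by fastforce
qed

lemma D_power_regular: "D ^ n * f \<in> ideal_\<Pi> \<Longrightarrow> f \<in> ideal_\<Pi>"
proof (induction n)
  case (Suc n)
  then have "D * (D ^ n * f) \<in> ideal_\<Pi>" by (simp add: mult.assoc)
  then show ?case by (rule Suc.IH[OF D_regular])
qed simp

definition ideal_D :: "cpoly set" where
  "ideal_D = {f. \<exists>q. f - D * q \<in> ideal_\<Pi>}"

lemma ideal_D_add: "f \<in> ideal_D \<Longrightarrow> g \<in> ideal_D \<Longrightarrow> f + g \<in> ideal_D"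
proof -
  assume "f \<in> ideal_D" "g \<in> ideal_D"
  then obtain q r where "f - D * q \<in> ideal_\<Pi>" "g - D * r \<in> ideal_\<Pi>" by (auto simp: ideal_D_def)
  from ideal_Pi_add[OF this] have "f + g - D * (q + r) \<in> ideal_\<Pi>" by (simp add: algebra_simps)
  then show ?thesis unfolding ideal_D_def by blast
qed

lemma ideal_D_mult: "f \<in> ideal_D \<Longrightarrow> g * f \<in> ideal_D"
proof -
  assume "f \<in> ideal_D"
  then obtain q where "f - D * q \<in> ideal_\<Pi>" by (auto simp: ideal_D_def)
  from ideal_Pi_mult[OF this, of g] have "g * f - D * (g * q) \<in> ideal_\<Pi>" by (simp add: algebra_simps)
  then show ?thesis unfolding ideal_D_def by blast
qed

lemma ideal_D_uminus: "f \<in> ideal_D \<Longrightarrow> - f \<in> ideal_D"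
  using ideal_D_mult[of f "-1"] by simp

lemma ideal_D_diff: "f \<in> ideal_D \<Longrightarrow> g \<in> ideal_D \<Longrightarrow> f - g \<in> ideal_D"
  using ideal_D_add[of f "- g"] ideal_D_uminus by simp

lemma ideal_Pi_subset_ideal_D: "f \<in> ideal_\<Pi> \<Longrightarrow> f \<in> ideal_D"
  unfolding ideal_D_def by (auto intro!: exI[of _ 0])

lemma D_mult_in_ideal_D: "D * f \<in> ideal_D"
  unfolding ideal_D_def by (auto intro!: exI[of _ f])

text \<open>If E f = D f' in R, comparing normal forms gives E g_i = D g_i' for the coefficients in the s-part,
  and E h - D h' = F10 k for the rest. Regularity of E modulo D settles the s-part. In the rest,
  regularity of F10 modulo (D, E) allows to write k as a combination of D and E, and h is divisible
  by D up to a multiple of F10.\<close>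
lemma E_regular:
  assumes "E * f \<in> ideal_D"
  shows "f \<in> ideal_D"
proof -
  obtain f' where ff': "E * f - D * f' \<in> ideal_\<Pi>" using assms by (auto simp: ideal_D_def)
  obtain g1 g2 g3 h where g: "g1 \<in> polys_in s_vars" "g2 \<in> polys_in s_vars" "g3 \<in> polys_in s_vars" "h \<in>
      polys_in u_vars"
    and f: "f - (s1 * g1 + s2 * g2 + s3 * g3 + h) \<in> ideal_\<Pi>" by (rule normal_form)
  obtain g1' g2' g3' h' where g': "g1' \<in> polys_in s_vars" "g2' \<in> polys_in s_vars" "g3' \<in> polys_in s_vars" "h'
      \<in> polys_in u_vars"
    and f': "f' - (s1 * g1' + s2 * g2' + s3 * g3' + h') \<in> ideal_\<Pi>" by (rule normal_form)
  have "(E * f - D * f') - E * (f - (s1 * g1 + s2 * g2 + s3 * g3 + h))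
      + D * (f' - (s1 * g1' + s2 * g2' + s3 * g3' + h')) \<in> ideal_\<Pi>"
    by (intro ideal_Pi_add ideal_Pi_diff ideal_Pi_mult ff' f f')
  then have I: "s1 * (E * g1 - D * g1') + s2 * (E * g2 - D * g2') + s3 * (E * g3 - D * g3') + (E * h
      - D * h') \<in> ideal_\<Pi>"
    by (simp add: algebra_simps)
  have in_vars: "E * g1 - D * g1' \<in> polys_in s_vars" "E * g2 - D * g2' \<in> polys_in s_vars"
    "E * g3 - D * g3' \<in> polys_in s_vars" "E * h - D * h' \<in> polys_in u_vars"
    using g g' D_in_vars by (auto intro: polys_in.mult polys_in_diff)
  note s0 = s_part_eq_0[OF in_vars I]
  have D_dvd: "D dvd a" if "E * a - D * b = 0" for a b
  proof (rule D_dvd_E_mult)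
    have "E * a = D * b" using that by simp
    then show "D dvd E * a" by simp
  qed
  obtain q1 q2 q3 where q: "g1 = D * q1" "g2 = D * q2" "g3 = D * q3"
    using D_dvd[OF s0(1)] D_dvd[OF s0(2)] D_dvd[OF s0(3)] by (metis dvdE)
  from I s0 have "E * h - D * h' \<in> ideal_\<Pi>" by simp
  with in_vars obtain k where k: "E * h - D * h' = F10 * k" using F10_dvd_if_in_ideal_Pi by (metis dvdE)
  have "F10 * k \<in> span2 D E" by (rule span2I[of _ _ "- h'" _ h]) (simp flip: k)
  then have "k \<in> span2 D E" by (rule F10_regular_span2)
  then obtain a b where ab: "k = D * a + E * b" by (auto simp: span2_def)
  have "E * (h - F10 * b) = D * (h' + F10 * a)" using k by (simp add: ab algebra_simps)
  then have "D dvd h - F10 * b" by (intro D_dvd[of _ "h' + F10 * a"]) simp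
  then obtain c where "h - F10 * b = D * c" by (rule dvdE)
  then have h: "h = D * c + F10 * b" by (simp add: algebra_simps)
  have "f - D * (s1 * q1 + s2 * q2 + s3 * q3 + c) = (f - (s1 * g1 + s2 * g2 + s3 * g3 + h)) + F10 * b"
    unfolding q h by (simp add: algebra_simps)
  also have "\<dots> \<in> ideal_\<Pi>" by (intro ideal_Pi_add ideal_Pi_mult_right f F10_in_ideal)
  finally show ?thesis unfolding ideal_D_def by blast
qed

lemma E_power_regular: "E ^ n * f \<in> ideal_D \<Longrightarrow> f \<in> ideal_D"
proof (induction n)
  case (Suc n)
  then have "E * (E ^ n * f) \<in> ideal_D" by (simp add: mult.assoc)
  then show ?case by (rule Suc.IH[OF E_regular])
qed simp

section \<open>Primality of the ideal and of D\<close>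

text \<open>The coordinates that remain after F1, ..., F4 have been solved for t126, t125, t124, t123.\<close>
definition free_vars :: "coord set" where
  "free_vars = - {Vt123, Vt124, Vt125, Vt126}"

text \<open>By on_Pi_if_D_neq_0 only F1, ..., F4 have to be solved, each for one coordinate with coefficient D
  or - D.\<close>
lemma point_with_free_coords:
  assumes D: "eval_at y D \<noteq> 0"
  shows "\<exists>z. on_\<Pi> z \<and> (\<forall>v\<in>free_vars. z v = y v)"
proof -
  define y0 where "y0 = y(Vt123 := 0, Vt124 := 0, Vt125 := 0, Vt126 := 0)"
  define z where "z = y0(Vt126 := eval_at y0 F1 / eval_at y D, Vt125 := - eval_at y0 F2 / eval_at y D,
    Vt124 := eval_at y0 F3 / eval_at y D, Vt123 := - eval_at y0 F4 / eval_at y D)"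
  have Dz: "eval_at z D = eval_at y D" by (simp add: D_def z_def y0_def)
  have zf: "z v = y v" if "v \<in> free_vars" for v
    using that by (auto simp: z_def y0_def free_vars_def)
  have zy0: "z v = y0 v" if "v \<in> free_vars" for v
    using that by (auto simp: z_def free_vars_def)
  have y0_0: "y0 Vt123 = 0" "y0 Vt124 = 0" "y0 Vt125 = 0" "y0 Vt126 = 0" by (simp_all add: y0_def)
  have U: "eval_at z U\<^sub>1 = eval_at y0 U\<^sub>1" "eval_at z U\<^sub>2 = eval_at y0 U\<^sub>2" "eval_at z U\<^sub>3 = eval_at y0 U\<^sub>3"
    "eval_at z I\<^sub>1 = eval_at y0 I\<^sub>1" "eval_at z I\<^sub>2 = eval_at y0 I\<^sub>2" "eval_at z I\<^sub>3 = eval_at y0 I\<^sub>3"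
    by (simp_all add: z_def U_defs I_defs)
  have "eval_at z F1 = eval_at y0 F1 - z Vt126 * eval_at y D"
    by (simp add: F\<^sub>1_def U Dz y0_0 zy0 free_vars_def)
  then have F1: "eval_at z F1 = 0" using D by (simp add: z_def)
  have "eval_at z F2 = eval_at y0 F2 + z Vt125 * eval_at y D"
    by (simp add: F\<^sub>2_def U Dz y0_0 zy0 free_vars_def)
  then have F2: "eval_at z F2 = 0" using D by (simp add: z_def)
  have "eval_at z F3 = eval_at y0 F3 - z Vt124 * eval_at y D"
    by (simp add: F\<^sub>3_def U Dz y0_0 zy0 free_vars_def)
  then have F3: "eval_at z F3 = 0" using D by (simp add: z_def)
  have "eval_at z F4 = eval_at y0 F4 + z Vt123 * eval_at y D"
    by (simp add: F\<^sub>4_def U Dz y0_0 zy0 free_vars_def)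
  then have F4: "eval_at z F4 = 0" using D by (simp add: z_def)
  have "on_\<Pi> z" by (rule on_Pi_if_D_neq_0) (simp_all add: Dz D F1 F2 F3 F4)
  then show ?thesis using zf by blast
qed

lemma D_in_free: "D \<in> polys_in free_vars"
  by (rule D_in) (auto simp: free_vars_def)

lemma clear_D_denominator:
  obtains N r where "r \<in> polys_in free_vars" "D ^ N * f - r \<in> ideal_\<Pi>"
proof -
  interpret fraction_setting ideal_\<Pi> "polys_in free_vars" D
    by unfold_locales (auto intro: polys_in.intros D_in_free ideal_Pi_intros)
  have solve: "\<xi> v \<in> fractions ideal_\<Pi> (polys_in free_vars) D"
    if "r \<in> polys_in free_vars" "D * \<xi> v - r \<in> ideal_\<Pi>" for v r
    unfolding fractions_def by (rule CollectI, rule exI[of _ 1], rule bexI[OF _ that(1)]) (use that(2) in simp)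
  have "f \<in> fractions ideal_\<Pi> (polys_in free_vars) D"
  proof (rule fractions_polys_in[OF polys_in_UNIV])
    fix v
    consider "v = Vt126" | "v = Vt125" | "v = Vt124" | "v = Vt123" | "v \<in> free_vars"
      by (auto simp: free_vars_def)
    then show "\<xi> v \<in> fractions ideal_\<Pi> (polys_in free_vars) D"
    proof cases
      case 1
      let ?r = "u1 * s1 - p1 * s2 - p2 * s3 - (t136 * U\<^sub>1 + t245 * U\<^sub>2 + t246 * U\<^sub>3)"
      have "D * \<xi> v - ?r = - F1" by (simp add: 1 F\<^sub>1_def algebra_simps)
      then show ?thesis
        by (intro solve[of ?r]) (unfold U_defs free_vars_def,
          (intro polys_in_intros; simp), simp add: F_mem ideal_Pi_uminus)
    next
      case 2
      let ?r = "- (u2 * s1 - p3 * s2 - p4 * s3 + t135 * U\<^sub>1 + t136 * U\<^sub>2 + t245 * U\<^sub>3)"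
      have "D * \<xi> v - ?r = F2" by (simp add: 2 F\<^sub>2_def algebra_simps)
      then show ?thesis
        by (intro solve[of ?r]) (unfold U_defs free_vars_def,
          (intro polys_in_intros; simp), simp add: F_mem)
    next
      case 3
      let ?r = "- t2 * p2 * s1 + (t1 * p2 + u1) * s2 - p1 * s3 - (t136 * I\<^sub>1 + t245 * I\<^sub>2 + t246 * I\<^sub>3)"
      have "D * \<xi> v - ?r = - F3" by (simp add: 3 F\<^sub>3_def algebra_simps)
      then show ?thesis
        by (intro solve[of ?r]) (unfold I_defs free_vars_def,
          (intro polys_in_intros; simp), simp add: F_mem ideal_Pi_uminus)
    next
      case 4
      let ?r = "- (- t2 * p4 * s1 + (t1 * p4 + u2) * s2 - p3 * s3 + t135 * I\<^sub>1 + t136 * I\<^sub>2 + t245 * I\<^sub>3)"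
      have "D * \<xi> v - ?r = F4" by (simp add: 4 F\<^sub>4_def algebra_simps)
      then show ?thesis
        by (intro solve[of ?r]) (unfold I_defs free_vars_def,
          (intro polys_in_intros; simp), simp add: F_mem)
    next
      case 5
      then show ?thesis by (intro fractions_base polys_in.var)
    qed
  qed
  then show ?thesis using that unfolding fractions_def by blast
qed

text \<open>The fifteen free coordinates are algebraically independent in R, since they take arbitrary values
  with D nonzero at points of the scheme.\<close>
lemma free_eq_0_if_in_ideal_Pi:
  assumes "r \<in> polys_in free_vars" "r \<in> ideal_\<Pi>"
  shows "r = 0"
proof (rule eq_0_if_eval_at_eq_0_dense[OF D_neq_0])
  fix y assume "eval_at y D \<noteq> 0"
  from point_with_free_coords[OF this]
  obtain z where z: "on_\<Pi> z" "\<forall>v\<in>free_vars. z v = y v" by blast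
  have "eval_at y r = eval_at z r" by (rule eval_at_cong[OF assms(1)]) (use z in simp)
  also have "\<dots> = 0" by (rule eval_at_ideal_Pi[OF assms(2) z(1)])
  finally show "eval_at y r = 0" .
qed

text \<open>Up to powers of D, which are regular, all elements come from the polynomial ring in the free
  coordinates, which injects into R.\<close>
lemma ideal_Pi_prime:
  assumes "f * g \<in> ideal_\<Pi>"
  shows "f \<in> ideal_\<Pi> \<or> g \<in> ideal_\<Pi>"
proof -
  obtain M r where r: "r \<in> polys_in free_vars" "D ^ M * f - r \<in> ideal_\<Pi>" by (rule clear_D_denominator)
  obtain N s where s: "s \<in> polys_in free_vars" "D ^ N * g - s \<in> ideal_\<Pi>" by (rule clear_D_denominator)
  have "r * s = (D ^ M * D ^ N) * (f * g) - ((D ^ N * g) * (D ^ M * f - r) + r * (D ^ N * g - s))"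
    by (simp add: algebra_simps)
  also have "\<dots> \<in> ideal_\<Pi>"
    by (intro ideal_Pi_diff ideal_Pi_add ideal_Pi_mult assms r s)
  finally have "r * s = 0" using r s by (intro free_eq_0_if_in_ideal_Pi polys_in.mult)
  then consider "r = 0" | "s = 0" by auto
  then show ?thesis
  proof cases
    case 1
    with r have "D ^ M * f \<in> ideal_\<Pi>" by simp
    from D_power_regular[OF this] show ?thesis by blast
  next
    case 2
    with s have "D ^ N * g \<in> ideal_\<Pi>" by simp
    from D_power_regular[OF this] show ?thesis by blast
  qed
qed

text \<open>On D = 0 with p4 and C3 invertible, the equation D = 0 gives p1, the combinations p4 F1 - p2 F2 and
  p4 F3 - p2 F4 give t1 and t2, and F2 gives s3. Of F7 there remains one linear equation for t123
  and t124. So p2 t123 + p4 t124 is the fourteenth coordinate. In the substitution chart it takes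
  the place of t123.\<close>
definition chart_vars :: "coord set" where
  "chart_vars = {Vp2, Vp3, Vp4, Vu1, Vu2, Vs1, Vs2, Vt123, Vt125, Vt126, Vt135, Vt136, Vt245, Vt246}"

definition chart :: "coord \<Rightarrow> cpoly" where
  "chart = \<xi>(Vt123 := p2 * t123 + p4 * t124)"

text \<open>The right-hand sides of the equations that determine t1, t2, s3 and, in the case of F7, of the
  linear equation for t123 and t124.\<close>
definition \<rho>1 :: cpoly where
  "\<rho>1 = (p4 * u1 - p2 * u2) * s1
    - (p4 * t136 + p2 * t135) * (p1\<^sup>2 + p2 * u1)
    - (p4 * t245 + p2 * t136) * (2 * p1 * p3 + p4 * u1 + p2 * u2)
    - (p4 * t246 + p2 * t245) * (p3\<^sup>2 + p4 * u2)"

definition \<rho>2 :: cpoly where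
  "\<rho>2 = (p4 * u1 - p2 * u2) * s2
    - (p4 * t136 + p2 * t135) * (p1 * u1)
    - (p4 * t245 + p2 * t136) * (p3 * u1 + p1 * u2)
    - (p4 * t246 + p2 * t245) * (p3 * u2)"

definition \<rho>3 :: cpoly where
  "\<rho>3 = u2 * s1 - p3 * s2 + t125 * D + t135 * U\<^sub>1 + t136 * U\<^sub>2 + t245 * U\<^sub>3"

definition \<rho>7 :: cpoly where
  "\<rho>7 = s1 * s3 - s2\<^sup>2 - (t125 * p2 + t126 * p4) * s2 + \<alpha> * (p1\<^sup>2 - 2 * p2 * u1 - t1 * p2\<^sup>2)
     + \<gamma> * (p3\<^sup>2 - 2 * p4 * u2 - t1 * p4\<^sup>2) + \<beta> * (p2 * u2 + p4 * u1 - p1 * p3 + t1 * p2 * p4)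
     - b\<^sub>0 * p1 * p2 - b\<^sub>1 * (p1 * p4 + p2 * p3) - b\<^sub>2 * p3 * p4"

lemma chart_t1: "C3 * t1 = \<rho>1 - (p4 * F1 - p2 * F2) - D * (s2 + p4 * t126 + p2 * t125)"
  unfolding \<rho>1_def C3_def Q0_def Q1_def F_defs by (simp only: ring_norm)

lemma chart_t2: "C3 * t2 = \<rho>2 - (p4 * F3 - p2 * F4) - D * (s3 + p4 * t124 + p2 * t123)"
  unfolding \<rho>2_def C3_def Q0_def Q1_def F_defs by (simp only: ring_norm)

lemma chart_s3: "p4 * s3 = \<rho>3 - F2"
  by (simp add: \<rho>3_def F\<^sub>2_def)

lemma F7_eq: "F7 = (p2 * s1 + Q1) * t123 + (p4 * s1 - Q0) * t124 + \<rho>7"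
  unfolding \<rho>7_def Q0_def Q1_def F_defs by (simp only: ring_norm)

text \<open>The next two identities are the rule of Cramer for F7 and for the value of p2 t123 + p4 t124, two
  linear equations for t123 and t124 with determinant C3.\<close>
lemma chart_t123: "C3 * t123 = p4 * (F7 - \<rho>7) - (p4 * s1 - Q0) * (p2 * t123 + p4 * t124)"
  unfolding F7_eq C3_def by (simp add: algebra_simps)

lemma chart_t124: "C3 * t124 = (p2 * s1 + Q1) * (p2 * t123 + p4 * t124) - p2 * (F7 - \<rho>7)"
  unfolding F7_eq C3_def by (simp add: algebra_simps)

lemma rho_in:
  "\<rho>1 \<in> polys_in (insert Vp1 chart_vars)" "\<rho>2 \<in> polys_in (insert Vp1 chart_vars)"
  "\<rho>3 \<in> polys_in ({Vp1, Vt1} \<union> chart_vars)" "\<rho>7 \<in> polys_in ({Vp1, Vt1, Vs3} \<union> (chart_vars - {Vt123}))"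
  "Q0 \<in> polys_in (chart_vars - {Vt123})" "Q1 \<in> polys_in (chart_vars - {Vt123})" "C3 \<in> polys_in (chart_vars
      - {Vt123})"
  unfolding \<rho>1_def \<rho>2_def \<rho>3_def \<rho>7_def Q0_def Q1_def C3_def D_def U_defs \<alpha>_def \<beta>_def \<gamma>_def
    b\<^sub>0_def b\<^sub>1_def b\<^sub>2_def chart_vars_def
  by (intro polys_in_intros; simp)+

lemma E_in_chart: "E \<in> polys_in (chart_vars - {Vt123})"
  by (rule E_in) (auto simp: chart_vars_def)

lemma subst_chart: "f \<in> polys_in (- {Vt123}) \<Longrightarrow> subst chart f = f"
proof -
  assume "f \<in> polys_in (- {Vt123})"
  then have "subst chart f = subst \<xi> f"
    unfolding subst_def by (rule ev_cong[OF coeff_hom_cst]) (auto simp: chart_def)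
  then show ?thesis by simp
qed

text \<open>The solved coordinates are treated in the order p1, t1, t2, s3, t123, t124, each being expressed by
  the previous ones.\<close>
lemma clear_E_denominator:
  obtains N r where "r \<in> polys_in chart_vars" "E ^ N * f - subst chart r \<in> ideal_D"
proof -
  let ?R = "subst chart ` polys_in chart_vars"
  have R: "f \<in> ?R" if "f \<in> polys_in (chart_vars - {Vt123})" for f
  proof -
    have "f = subst chart f" using that by (intro subst_chart[symmetric]) (auto elim: polys_in_mono)
    moreover have "f \<in> polys_in chart_vars" using that by (rule polys_in_mono) auto
    ultimately show ?thesis by (rule image_eqI)
  qed
  interpret fraction_setting ideal_D ?R E
  proof
    show "0 \<in> ideal_D" by (rule ideal_Pi_subset_ideal_D) simp
    show "cst c \<in> ?R" for c by (rule R) (rule polys_in.const)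
    show "f + g \<in> ?R" if "f \<in> ?R" "g \<in> ?R" for f g
      using that by (auto simp flip: subst_simps(1) intro!: imageI polys_in.add)
    show "f * g \<in> ?R" if "f \<in> ?R" "g \<in> ?R" for f g
      using that by (auto simp flip: subst_simps(3) intro!: imageI polys_in.mult)
    show "E \<in> ?R" by (rule R) (rule E_in_chart)
  qed (fact ideal_D_add ideal_D_mult)+
  let ?T = "fractions ideal_D ?R E"
  have vars: "\<xi> v \<in> ?T" if "v \<in> chart_vars - {Vt123}" for v
    by (rule fractions_base, rule R, rule polys_in.var) (use that in auto)
  have Y: "p2 * t123 + p4 * t124 \<in> ?T"
  proof (rule fractions_base, rule image_eqI)
    show "p2 * t123 + p4 * t124 = subst chart t123" by (simp add: chart_def)
  qed (auto simp: chart_vars_def intro: polys_in.var)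
  have C3: "C3 \<in> ?T" by (rule fractions_base, rule R, rule rho_in)
  have p4: "p4 \<in> ?T" by (rule vars) (simp add: chart_vars_def)
  have cancel_p4: "f \<in> ?T" if "p4 * f \<in> ?T" for f
    by (rule fractions_cancel[OF that _ C3]) (simp add: E_def mult.commute)
  have cancel_C3: "f \<in> ?T" if "C3 * f \<in> ?T" for f
    by (rule fractions_cancel[OF that _ p4]) (simp add: E_def)
  have F: "F \<in> ideal_D" if "F \<in> ideal_\<Pi>" for F using that by (rule ideal_Pi_subset_ideal_D)
  have p1: "p1 \<in> ?T"
  proof (rule cancel_p4, rule fractions_cong)
    have "p4 * p1 - p2 * p3 = D * 1" by (simp add: D_def mult.commute)
    then show "p4 * p1 - p2 * p3 \<in> ideal_D" by (simp only: D_mult_in_ideal_D)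
    show "p2 * p3 \<in> ?T" by (intro fractions_mult vars) (simp_all add: chart_vars_def)
  qed
  have vars2: "\<xi> v \<in> ?T" if "v \<in> insert Vp1 (chart_vars - {Vt123})" for v
    using that vars p1 by blast
  have \<rho>12: "\<rho>1 \<in> ?T" "\<rho>2 \<in> ?T"
  proof -
    have "\<rho>1 \<in> polys_in (insert Vp1 (chart_vars - {Vt123}))" "\<rho>2 \<in> polys_in (insert Vp1 (chart_vars - {Vt123}))"
      unfolding \<rho>1_def \<rho>2_def chart_vars_def by (intro polys_in_intros; simp)+
    then show "\<rho>1 \<in> ?T" "\<rho>2 \<in> ?T" using vars2 by (auto intro: fractions_polys_in)
  qed
  have t1: "t1 \<in> ?T"
  proof (rule cancel_C3, rule fractions_cong[OF _ \<rho>12(1)])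
    have "C3 * t1 - \<rho>1 = - (p4 * F1 - p2 * F2) - D * (s2 + p4 * t126 + p2 * t125)"
      unfolding chart_t1 by simp
    also have "\<dots> \<in> ideal_D"
      by (intro ideal_D_diff ideal_D_uminus ideal_D_mult D_mult_in_ideal_D F F_mem)
    finally show "C3 * t1 - \<rho>1 \<in> ideal_D" .
  qed
  have t2: "t2 \<in> ?T"
  proof (rule cancel_C3, rule fractions_cong[OF _ \<rho>12(2)])
    have "C3 * t2 - \<rho>2 = - (p4 * F3 - p2 * F4) - D * (s3 + p4 * t124 + p2 * t123)"
      unfolding chart_t2 by simp
    also have "\<dots> \<in> ideal_D"
      by (intro ideal_D_diff ideal_D_uminus ideal_D_mult D_mult_in_ideal_D F F_mem)
    finally show "C3 * t2 - \<rho>2 \<in> ideal_D" .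
  qed
  have s3: "s3 \<in> ?T"
  proof (rule cancel_p4, rule fractions_cong)
    show "p4 * s3 - \<rho>3 \<in> ideal_D"
      unfolding chart_s3 by (simp add: F F_mem ideal_D_uminus)
    have "\<rho>3 \<in> polys_in ({Vp1, Vt1} \<union> (chart_vars - {Vt123}))"
      unfolding \<rho>3_def D_def U_defs chart_vars_def by (intro polys_in_intros; simp)
    then show "\<rho>3 \<in> ?T" by (rule fractions_polys_in) (use vars2 t1 in auto)
  qed
  have \<rho>7: "\<rho>7 \<in> ?T"
    by (rule fractions_polys_in[OF rho_in(4)]) (use vars2 t1 s3 in auto)
  have Q: "Q0 \<in> ?T" "Q1 \<in> ?T" by (rule fractions_base, rule R, rule rho_in)+
  have F7: "F7 - \<rho>7 \<in> ?T"
    by (rule fractions_cong[of _ "- \<rho>7"]) (simp_all add: F F_mem fractions_uminus \<rho>7)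
  have ps: "p2 \<in> ?T" "p4 \<in> ?T" "s1 \<in> ?T" by (rule vars, simp add: chart_vars_def)+
  have t123: "t123 \<in> ?T"
    by (rule cancel_C3, unfold chart_t123) (intro fractions_diff fractions_mult F7 Q Y ps)
  have t124: "t124 \<in> ?T"
    by (rule cancel_C3, unfold chart_t124) (intro fractions_diff fractions_add fractions_mult F7 Q Y ps)
  have "f \<in> ?T"
  proof (rule fractions_polys_in[OF polys_in_UNIV])
    fix v show "\<xi> v \<in> ?T"
      using vars p1 t1 t2 s3 t123 t124 by (cases v) (auto simp: chart_vars_def)
  qed
  then show ?thesis using that unfolding fractions_def by blast
qed

text \<open>By on_Pi_if_D_eq_0 it is enough to solve D, F1, F2, F7 and p4 F3 - p2 F4.\<close>
lemma point_with_chart_coords: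
  assumes E: "eval_at y E \<noteq> 0"
  shows "\<exists>z. on_\<Pi> z \<and> eval_at z D = 0 \<and> (\<forall>v\<in>chart_vars. eval_at z (chart v) = y v)"
proof -
  have p4: "y Vp4 \<noteq> 0" and C3: "eval_at y C3 \<noteq> 0" using E by (auto simp: E_def)
  \<comment> \<open>the six other coordinates, in the order in which they are solved for\<close>
  define y1 where "y1 = y(Vp1 := y Vp2 * y Vp3 / y Vp4)"
  define y2 where "y2 = y1(Vt1 := eval_at y1 \<rho>1 / eval_at y C3, Vt2 := eval_at y1 \<rho>2 / eval_at y C3)"
  define y3 where "y3 = y2(Vs3 := eval_at y2 \<rho>3 / y Vp4)"
  define z where "z = y3(
    Vt123 := (- (y Vp4 * eval_at y3 \<rho>7) - (y Vp4 * y Vs1 - eval_at y Q0) * y Vt123) / eval_at y C3,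
    Vt124 := ((y Vp2 * y Vs1 + eval_at y Q1) * y Vt123 + y Vp2 * eval_at y3 \<rho>7) / eval_at y C3)"
  note z_defs = y1_def y2_def y3_def z_def
  have zv: "z v = y v" if "v \<in> chart_vars - {Vt123}" for v
    using that by (cases v) (simp_all add: z_defs chart_vars_def)
  have same: "eval_at z f = eval_at y f" if "f \<in> polys_in (chart_vars - {Vt123})" for f
    using zv by (intro eval_at_cong[OF that]) auto
  have C3z: "eval_at z C3 = eval_at y C3" and Q: "eval_at z Q0 = eval_at y Q0" "eval_at z Q1 = eval_at y Q1"
    by (rule same, rule rho_in)+
  have D: "eval_at z D = 0" using p4 by (simp add: D_def z_defs)
  have \<rho>: "eval_at z \<rho>1 = eval_at y1 \<rho>1" "eval_at z \<rho>2 = eval_at y1 \<rho>2" "eval_at z \<rho>3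
      = eval_at y2 \<rho>3" "eval_at z \<rho>7 = eval_at y3 \<rho>7"
  proof -
    have "\<rho>1 \<in> polys_in (- {Vt1, Vt2, Vs3, Vt123, Vt124})" "\<rho>2 \<in> polys_in (- {Vt1, Vt2, Vs3, Vt123, Vt124})"
      unfolding \<rho>1_def \<rho>2_def by (intro polys_in_intros; simp)+
    moreover have "z v = y1 v" if "v \<in> - {Vt1, Vt2, Vs3, Vt123, Vt124}" for v
      using that by (auto simp: z_def y3_def y2_def)
    ultimately show "eval_at z \<rho>1 = eval_at y1 \<rho>1" "eval_at z \<rho>2 = eval_at y1 \<rho>2"
      by (blast intro: eval_at_cong)+
    have "\<rho>3 \<in> polys_in (- {Vs3, Vt123, Vt124})"
      unfolding \<rho>3_def D_def U_defs by (intro polys_in_intros; simp)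
    then show "eval_at z \<rho>3 = eval_at y2 \<rho>3" by (rule eval_at_cong) (auto simp: y3_def z_def)
    show "eval_at z \<rho>7 = eval_at y3 \<rho>7"
      by (rule eval_at_cong[OF rho_in(4)]) (auto simp: z_def chart_vars_def)
  qed
  have coords: "z Vp2 = y Vp2" "z Vp4 = y Vp4" "z Vs1 = y Vs1" by (simp_all add: z_defs)
  have t1: "eval_at y C3 * z Vt1 = eval_at z \<rho>1" and t2: "eval_at y C3 * z Vt2 = eval_at z \<rho>2"
    using C3 by (simp_all add: \<rho>) (simp_all add: z_def y3_def y2_def)
  have s3: "y Vp4 * z Vs3 = eval_at z \<rho>3"
    using p4 by (simp add: \<rho>) (simp add: z_def y3_def)
  have t123: "eval_at y C3 * z Vt123 = - (y Vp4 * eval_at z \<rho>7) - (y Vp4 * y Vs1 - eval_at y Q0) * y Vt123"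
    and t124: "eval_at y C3 * z Vt124 = (y Vp2 * y Vs1 + eval_at y Q1) * y Vt123 + y Vp2 * eval_at z \<rho>7"
    using C3 by (simp_all add: \<rho>) (simp_all add: z_def)
  have C3_eq: "eval_at y C3 = y Vp2 * eval_at y Q0 + y Vp4 * eval_at y Q1" by (simp add: C3_def)
  have F2: "eval_at z F2 = 0"
    using arg_cong[OF chart_s3, of "eval_at z"] s3 by (simp add: coords)
  have F1: "eval_at z F1 = 0"
    using arg_cong[OF chart_t1, of "eval_at z"] t1 p4 by (simp add: C3z coords D F2)
  have F34: "z Vp4 * eval_at z F3 = z Vp2 * eval_at z F4"
    using arg_cong[OF chart_t2, of "eval_at z"] t2 by (simp add: C3z coords D)
  have "eval_at y C3 * eval_at z F7 = (y Vp2 * y Vs1 + eval_at y Q1) * (eval_at y C3 * z Vt123)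
      + (y Vp4 * y Vs1 - eval_at y Q0) * (eval_at y C3 * z Vt124) + eval_at y C3 * eval_at z \<rho>7"
    unfolding F7_eq by (simp add: Q coords algebra_simps)
  also have "\<dots> = 0" unfolding t123 t124 unfolding C3_eq by (simp add: algebra_simps)
  finally have F7: "eval_at z F7 = 0" using C3 by simp
  have "on_\<Pi> z"
    by (rule on_Pi_if_D_eq_0[OF D _ _ F1 F2 F7 F34]) (simp_all add: coords p4 C3z C3)
  moreover have "eval_at z (chart v) = y v" if "v \<in> chart_vars" for v
  proof (cases "v = Vt123")
    case True
    have "eval_at y C3 * (y Vp2 * z Vt123 + y Vp4 * z Vt124) = y Vp2 * (eval_at y C3 * z Vt123)
        + y Vp4 * (eval_at y C3 * z Vt124)"
      by (simp add: algebra_simps)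
    also have "\<dots> = eval_at y C3 * y Vt123" unfolding t123 t124 unfolding C3_eq by (simp add: algebra_simps)
    finally have "y Vp2 * z Vt123 + y Vp4 * z Vt124 = y Vt123" using C3 by simp
    then show ?thesis by (simp add: True chart_def coords)
  next
    case False
    then show ?thesis using that zv by (simp add: chart_def)
  qed
  ultimately show ?thesis using D by blast
qed

text \<open>The fourteen chart coordinates are algebraically independent in R/(D), since they take arbitrary
  values with E nonzero at points of the scheme with D = 0.\<close>
lemma chart_eq_0_if_in_ideal_D:
  assumes "r \<in> polys_in chart_vars" "subst chart r \<in> ideal_D"
  shows "r = 0"
proof (rule eq_0_if_eval_at_eq_0_dense)
  show "E \<noteq> 0"
  proof
    assume "E = 0"
    then have "eval_at (\<lambda>_. 1) E = 0" by simp
    then show False by (simp add: E_def C3_def Q0_def Q1_def)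
  qed
  fix y assume "eval_at y E \<noteq> 0"
  from point_with_chart_coords[OF this]
  obtain z where z: "on_\<Pi> z" "eval_at z D = 0" "\<forall>v\<in>chart_vars. eval_at z (chart v) = y v" by blast
  obtain q where q: "subst chart r - D * q \<in> ideal_\<Pi>" using assms(2) unfolding ideal_D_def by blast
  have "eval_at z (subst chart r) = 0" using eval_at_ideal_Pi[OF q z(1)] z(2) by simp
  then have "eval_at (\<lambda>v. eval_at z (chart v)) r = 0" by (simp add: eval_at_subst)
  then show "eval_at y r = 0" using eval_at_cong[OF assms(1), of "\<lambda>v. eval_at z (chart v)" y] z(3) by simp
qed

text \<open>The same argument as for the ideal itself, with the chart in place of the free coordinates and E in
  place of D.\<close>
lemma ideal_D_prime:
  assumes "f * g \<in> ideal_D"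
  shows "f \<in> ideal_D \<or> g \<in> ideal_D"
proof -
  obtain M r where r: "r \<in> polys_in chart_vars" "E ^ M * f - subst chart r \<in> ideal_D"
      by (rule clear_E_denominator)
  obtain N s where s: "s \<in> polys_in chart_vars" "E ^ N * g - subst chart s \<in> ideal_D"
      by (rule clear_E_denominator)
  have "subst chart (r * s) = (E ^ M * E ^ N) * (f * g)
     - ((E ^ N * g) * (E ^ M * f - subst chart r) + subst chart r * (E ^ N * g - subst chart s))"
    by (simp add: algebra_simps)
  also have "\<dots> \<in> ideal_D"
    by (intro ideal_D_diff ideal_D_add ideal_D_mult assms r s)
  finally have "r * s = 0" using r s by (intro chart_eq_0_if_in_ideal_D polys_in.mult)
  then consider "r = 0" | "s = 0" by auto
  then show ?thesis
  proof cases
    case 1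
    with r have "E ^ M * f \<in> ideal_D" by simp
    from E_power_regular[OF this] show ?thesis by blast
  next
    case 2
    with s have "E ^ N * g \<in> ideal_D" by simp
    from E_power_regular[OF this] show ?thesis by blast
  qed
qed

section \<open>Unique factorization in subrings generated by coordinates\<close>

text \<open>Unique factorization passes from a ring to its polynomials in one variable. The injection j
  identifies an iterated ring of such polynomials with the subring generated by V.\<close>
definition poly_embedding :: "('a::comm_ring_1 \<Rightarrow> cpoly) \<Rightarrow> coord set \<Rightarrow> bool" where
  "poly_embedding j V \<longleftrightarrow> inj j \<and> range j = polys_in V \<and> j 0 = 0 \<and> j 1 = 1
     \<and> (\<forall>a b. j (a + b) = j a + j b) \<and> (\<forall>a b. j (a * b) = j a * j b)"

lemma polys_in_empty: "polys_in {} = range cst"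
proof -
  have "\<exists>c. f = cst c" if "f \<in> polys_in {}" for f
    using that by (induction rule: polys_in.induct) (auto simp flip: cst_add cst_mult)
  then show ?thesis by (auto intro: polys_in.const)
qed

lemma inj_cst: "inj cst"
proof (rule injI)
  fix a b assume "cst a = cst b"
  then have "cst (a + - b) = 0" unfolding cst_add cst_minus by simp
  then show "a = b" by (simp del: cst_add)
qed

lemma poly_embedding_cst: "poly_embedding cst {}"
  by (simp add: poly_embedding_def polys_in_empty inj_cst cst_add cst_mult)

lemma uni_poly:
  assumes "\<And>i. coeff P i \<in> polys_in (- {x})"
  shows "uni x (poly P (\<xi> x)) = P"
proof -
  have "uni x (poly P (\<xi> x)) = (\<Sum>i\<le>degree P. [:coeff P i:] * [:0, 1:] ^ i)"
    unfolding poly_altdef using uni_free[OF assms] by simp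
  also have "\<dots> = (\<Sum>i\<le>degree P. monom (coeff P i) i)"
    by (intro sum.cong refl) (simp add: monom_altdef)
  also have "\<dots> = P" by (rule poly_as_sum_of_monoms)
  finally show ?thesis .
qed

lemma poly_embedding_insert:
  assumes j: "poly_embedding (j :: 'a::comm_ring_1 \<Rightarrow> cpoly) V" and x: "x \<notin> V"
  shows "poly_embedding (\<lambda>q :: 'a poly. poly (map_poly j q) (\<xi> x)) (insert x V)"
proof -
  have inj: "inj j" and range: "range j = polys_in V" and j0 [simp]: "j 0 = 0" and j1: "j 1 = 1"
    and j_add: "\<And>a b. j (a + b) = j a + j b" and j_mult: "\<And>a b. j (a * b) = j a * j b"
    using j by (auto simp: poly_embedding_def)
  have j_sum: "j (sum f S) = (\<Sum>i\<in>S. j (f i))" for f :: "nat \<Rightarrow> 'a" and S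
    by (induction S rule: infinite_finite_induct) (auto simp: j_add)
  have j_in: "j a \<in> polys_in V" for a using range by blast
  have m_add: "map_poly j (p + q) = map_poly j p + map_poly j q" for p q
    by (rule poly_eqI) (simp add: coeff_map_poly j_add)
  have m_mult: "map_poly j (p * q) = map_poly j p * map_poly j q" for p q
    by (rule poly_eqI) (simp add: coeff_map_poly coeff_mult j_sum j_mult)
  have m_1: "map_poly j 1 = 1"
    by (rule poly_eqI) (simp add: coeff_map_poly coeff_1 j1)
  have uni: "uni x (poly (map_poly j q) (\<xi> x)) = map_poly j q" for q
  proof (rule uni_poly)
    have "V \<subseteq> - {x}" using x by auto
    from polys_in_mono[OF j_in this] show "coeff (map_poly j q) i \<in> polys_in (- {x})" for i
      by (simp add: coeff_map_poly)
  qed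
  have "inj (\<lambda>q. poly (map_poly j q) (\<xi> x))"
  proof (rule injI)
    fix p q assume "poly (map_poly j p) (\<xi> x) = poly (map_poly j q) (\<xi> x)"
    then have eq: "map_poly j p = map_poly j q" by (metis uni)
    have "j (coeff p i) = j (coeff q i)" for i
      using arg_cong[OF eq, of "\<lambda>r. coeff r i"] by (simp add: coeff_map_poly)
    then show "p = q" using inj by (intro poly_eqI) (auto dest: injD)
  qed
  moreover have "range (\<lambda>q. poly (map_poly j q) (\<xi> x)) = polys_in (insert x V)"
  proof safe
    fix q
    have "j a \<in> polys_in (insert x V)" for a using j_in[of a] by (rule polys_in_mono) auto
    then show "poly (map_poly j q) (\<xi> x) \<in> polys_in (insert x V)"
      by (auto simp: poly_altdef coeff_map_poly intro!: polys_in_sum polys_in_intros)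
  next
    fix f assume f: "f \<in> polys_in (insert x V)"
    have c: "coeff (uni x f) i \<in> range j" for i
      using coeff_uni_in[OF f, of x i] x unfolding range by (simp add: polys_in_mono)
    have "inv_into UNIV j 0 = 0" using inj by (metis inv_f_f j0)
    then have "map_poly j (map_poly (inv_into UNIV j) (uni x f)) = uni x f"
      by (intro poly_eqI) (simp add: coeff_map_poly f_inv_into_f[OF c])
    then have "f = poly (map_poly j (map_poly (inv_into UNIV j) (uni x f))) (\<xi> x)" by simp
    then show "f \<in> range (\<lambda>q. poly (map_poly j q) (\<xi> x))" by blast
  qed
  ultimately show ?thesis
    by (simp add: poly_embedding_def m_add m_mult m_1)
qed

lemma poly_embedding_step:
  assumes "\<exists>j :: 'a::comm_ring_1 \<Rightarrow> cpoly. poly_embedding j V" "x \<notin> V"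
  shows "\<exists>j :: 'a poly \<Rightarrow> cpoly. poly_embedding j (insert x V)"
  using assms poly_embedding_insert by blast

lemma poly_embedding_free_vars:
  "\<exists>j :: complex poly poly poly poly poly poly poly poly poly poly poly poly poly poly poly \<Rightarrow> cpoly.
     poly_embedding j free_vars"
proof -
  have free: "free_vars = {Vp1, Vp2, Vp3, Vp4, Vu1, Vu2, Vs1, Vs2, Vs3, Vt1, Vt2, Vt135, Vt136, Vt245, Vt246}"
    unfolding free_vars_def by (auto, metis coord.exhaust)
  show ?thesis
    unfolding free
    by (intro poly_embedding_step exI[of _ cst] poly_embedding_cst) simp_all
qed

definition dvd_in :: "coord set \<Rightarrow> cpoly \<Rightarrow> cpoly \<Rightarrow> bool" where
  "dvd_in V a b \<longleftrightarrow> (\<exists>c\<in>polys_in V. b = a * c)"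

definition prime_in :: "coord set \<Rightarrow> cpoly \<Rightarrow> bool" where
  "prime_in V q \<longleftrightarrow> q \<in> polys_in V \<and> q \<noteq> 0 \<and> \<not> dvd_in V q 1 \<and>
     (\<forall>a\<in>polys_in V. \<forall>b\<in>polys_in V. dvd_in V q (a * b) \<longrightarrow> dvd_in V q a \<or> dvd_in V q b)"

text \<open>Only this consequence of unique factorization is used: every nonzero nonunit has a prime divisor.\<close>
lemma prime_factor_transfer:
  fixes j :: "'a :: {factorial_semiring, comm_ring_1} \<Rightarrow> cpoly"
  assumes j: "poly_embedding j V" and h: "h \<in> polys_in V" "h \<noteq> 0" "\<not> dvd_in V h 1"
  shows "\<exists>q. prime_in V q \<and> dvd_in V q h"
proof -
  have inj: "inj j" and range: "range j = polys_in V" and j0: "j 0 = 0" and j1: "j 1 = 1"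
    and j_mult: "\<And>a b. j (a * b) = j a * j b"
    using j by (auto simp: poly_embedding_def)
  have dvd: "dvd_in V (j a) (j b) \<longleftrightarrow> a dvd b" for a b
  proof -
    have "dvd_in V (j a) (j b) \<longleftrightarrow> (\<exists>c. j b = j (a * c))"
      unfolding dvd_in_def range[symmetric] by (auto simp: j_mult)
    then show ?thesis using inj by (auto simp: dvd_def inj_eq)
  qed
  obtain a where a: "h = j a" using h(1) range by auto
  have "a \<noteq> 0" "\<not> a dvd 1" using h a j0 dvd[of a 1] j1 by auto
  from prime_divisor_exists[OF this] obtain b where b: "b dvd a" "prime b" by blast
  have "prime_in V (j b)"
    unfolding prime_in_def
  proof (intro conjI ballI impI)
    show "j b \<in> polys_in V" using range by blast
    have "b \<noteq> 0" using b(2) by auto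
    then show "j b \<noteq> 0" using inj j0 by (metis injD)
    have "\<not> b dvd 1" using b(2) by auto
    then show "\<not> dvd_in V (j b) 1" using dvd[of b 1] j1 by simp
    fix f g assume "f \<in> polys_in V" "g \<in> polys_in V" and fg: "dvd_in V (j b) (f * g)"
    then have "f \<in> range j" "g \<in> range j" unfolding range by simp_all
    then obtain c d where "f = j c" "g = j d" by blast
    then show "dvd_in V (j b) f \<or> dvd_in V (j b) g"
      using fg dvd[of b "c * d"] dvd[of b c] dvd[of b d] b(2) by (auto simp: j_mult prime_dvd_mult_iff)
  qed
  moreover have "dvd_in V (j b) h" using b a dvd by simp
  ultimately show ?thesis by blast
qed

lemma prime_factor_free:
  assumes "h \<in> polys_in free_vars" "h \<noteq> 0" "\<not> dvd_in free_vars h 1"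
  shows "\<exists>q. prime_in free_vars q \<and> dvd_in free_vars q h"
proof -
  obtain j :: "complex poly poly poly poly poly poly poly poly poly poly poly poly poly poly poly \<Rightarrow> cpoly"
    where "poly_embedding j free_vars" using poly_embedding_free_vars by blast
  from prime_factor_transfer[OF this assms] show ?thesis .
qed

section \<open>The positive grading\<close>

text \<open>The equations are homogeneous for several independent gradings. This is a combination of them in
  which all weights are positive.\<close>
primrec weight :: "coord \<Rightarrow> nat" where
  "weight Vp1 = 3" | "weight Vp2 = 2" | "weight Vp3 = 3" | "weight Vp4 = 2"
| "weight Vu1 = 4" | "weight Vu2 = 4"
| "weight Vs1 = 4" | "weight Vs2 = 5" | "weight Vs3 = 6"
| "weight Vt1 = 2" | "weight Vt2 = 3"
| "weight Vt123 = 4" | "weight Vt124 = 4" | "weight Vt125 = 3" | "weight Vt126 = 3"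
| "weight Vt135 = 2" | "weight Vt136 = 2" | "weight Vt245 = 2" | "weight Vt246 = 2"

text \<open>The variable of the resulting polynomial records the weight: its n-th coefficient is the homogeneous
  component of degree n.\<close>
definition grade :: "cpoly \<Rightarrow> cpoly poly" where
  "grade = ev (\<lambda>c. [:cst c:]) (\<lambda>v. monom (\<xi> v) (weight v))"

lemmas grade_simps [simp] =
  ev_simps[OF coeff_hom_pcst, of "\<lambda>v. monom (\<xi> v) (weight v)", folded grade_def]

lemma poly_grade_1: "poly (grade f) 1 = f"
  by (induction f rule: cpoly_induct) (simp_all add: poly_monom)

text \<open>With this rule all terms of a homogeneous polynomial become monomials in the grading variable.\<close>
lemma numeral_eq_monom: "(numeral n :: cpoly poly) = monom (numeral n) 0"
  by (simp add: monom_0 numeral_poly)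

lemma homogeneous_F:
  "grade D = monom D 5"
  "F \<in> equations \<Longrightarrow> \<exists>d. grade F = monom F d"
proof -
  note [simp] = mult_monom add_monom diff_monom minus_monom monom_power numeral_eq_monom eval_nat_numeral
  show D: "grade D = monom D 5" by (simp add: D_def)
  have U: "grade U\<^sub>1 = monom U\<^sub>1 6" "grade U\<^sub>2 = monom U\<^sub>2 6" "grade U\<^sub>3 = monom U\<^sub>3 6"
    by (simp_all add: U_defs)
  have I: "grade I\<^sub>1 = monom I\<^sub>1 7" "grade I\<^sub>2 = monom I\<^sub>2 7" "grade I\<^sub>3 = monom I\<^sub>3 7"
    by (simp_all add: I_defs)
  have A: "grade A\<^sub>1 = monom A\<^sub>1 8" "grade A\<^sub>2 = monom A\<^sub>2 8" "grade A\<^sub>3 = monom A\<^sub>3 8"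
    by (simp_all add: A_defs)
  have abc: "grade \<alpha> = monom \<alpha> 4" "grade \<beta> = monom \<beta> 4" "grade \<gamma> = monom \<gamma> 4"
    "grade a\<^sub>0 = monom a\<^sub>0 6" "grade a\<^sub>1 = monom a\<^sub>1 6" "grade a\<^sub>2 = monom a\<^sub>2 6"
    "grade b\<^sub>0 = monom b\<^sub>0 5" "grade b\<^sub>1 = monom b\<^sub>1 5" "grade b\<^sub>2 = monom b\<^sub>2 5"
    by (simp_all add: minor_defs)
  have "grade F1 = monom F1 8" by (simp add: F\<^sub>1_def D U)
  moreover have "grade F2 = monom F2 8" by (simp add: F\<^sub>2_def D U)
  moreover have "grade F3 = monom F3 9" by (simp add: F\<^sub>3_def D I)
  moreover have "grade F4 = monom F4 9" by (simp add: F\<^sub>4_def D I)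
  moreover have "grade F5 = monom F5 10" by (simp add: F\<^sub>5_def U I A)
  moreover have "grade F6 = monom F6 10" by (simp add: F\<^sub>6_def U I A)
  moreover have "grade F7 = monom F7 10" by (simp add: F\<^sub>7_def abc)
  moreover have "grade F8 = monom F8 11" by (simp add: F\<^sub>8_def abc)
  moreover have "grade F9 = monom F9 12" by (simp add: F\<^sub>9_def abc D)
  ultimately show "F \<in> equations \<Longrightarrow> \<exists>d. grade F = monom F d" by auto
qed

lemma ideal_Pi_sum: "(\<And>i. i \<in> S \<Longrightarrow> f i \<in> ideal_\<Pi>) \<Longrightarrow> sum f S \<in> ideal_\<Pi>"
  by (induction S rule: infinite_finite_induct) (auto intro: ideal_Pi_add)

lemma ideal_Pi_homogeneous: "f \<in> ideal_\<Pi> \<Longrightarrow> coeff (grade f) n \<in> ideal_\<Pi>"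
proof -
  assume "f \<in> ideal_\<Pi>"
  then have "\<forall>n. coeff (grade f) n \<in> ideal_\<Pi>"
  proof (rule ideal_Pi_induct[where P = "\<lambda>f. \<forall>n. coeff (grade f) n \<in> ideal_\<Pi>"])
    fix F assume F: "F \<in> equations"
    then obtain d where "grade F = monom F d" using homogeneous_F(2) by blast
    moreover have "F \<in> ideal_\<Pi>" using F F_in_ideal_Pi by blast
    ultimately show "\<forall>n. coeff (grade F) n \<in> ideal_\<Pi>" by simp
  next
    fix f g assume "\<forall>n. coeff (grade f) n \<in> ideal_\<Pi>"
    then show "\<forall>n. coeff (grade (g * f)) n \<in> ideal_\<Pi>"
      by (auto simp: coeff_mult intro!: ideal_Pi_sum ideal_Pi_mult)
  qed (simp_all add: ideal_Pi_add)
  then show ?thesis ..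
qed

text \<open>The degree of the class of f in R: components that lie in the ideal are ignored.\<close>
definition deg :: "cpoly \<Rightarrow> nat" where
  "deg f = Max {n. coeff (grade f) n \<notin> ideal_\<Pi>}"

lemma deg_set:
  assumes "f \<notin> ideal_\<Pi>"
  shows "finite {n. coeff (grade f) n \<notin> ideal_\<Pi>}" "{n. coeff (grade f) n \<notin> ideal_\<Pi>} \<noteq> {}"
proof -
  have "{n. coeff (grade f) n \<notin> ideal_\<Pi>} \<subseteq> {..degree (grade f)}"
    by (auto intro: ccontr simp: coeff_eq_0 not_le)
  then show "finite {n. coeff (grade f) n \<notin> ideal_\<Pi>}" by (rule finite_subset) simp
  have "f \<in> ideal_\<Pi>" if "\<And>n. coeff (grade f) n \<in> ideal_\<Pi>"
  proof -
    have "f = (\<Sum>n\<le>degree (grade f). coeff (grade f) n)"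
      using poly_grade_1[of f] by (simp add: poly_altdef)
    also have "\<dots> \<in> ideal_\<Pi>" by (rule ideal_Pi_sum) (rule that)
    finally show ?thesis .
  qed
  with assms show "{n. coeff (grade f) n \<notin> ideal_\<Pi>} \<noteq> {}" by auto
qed

lemma coeff_deg: "f \<notin> ideal_\<Pi> \<Longrightarrow> coeff (grade f) (deg f) \<notin> ideal_\<Pi>"
  using Max_in[OF deg_set] by (simp add: deg_def)

lemma coeff_above_deg: "f \<notin> ideal_\<Pi> \<Longrightarrow> n > deg f \<Longrightarrow> coeff (grade f) n \<in> ideal_\<Pi>"
  using Max_ge[OF deg_set(1), of f n] by (force simp: deg_def)

lemma deg_eqI:
  assumes "coeff (grade f) n \<notin> ideal_\<Pi>" "\<And>m. m > n \<Longrightarrow> coeff (grade f) m \<in> ideal_\<Pi>"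
  shows "deg f = n"
proof -
  have f: "f \<notin> ideal_\<Pi>" using assms(1) ideal_Pi_homogeneous by blast
  have "\<not> deg f > n" using assms(2) coeff_deg[OF f] by blast
  moreover have "\<not> n > deg f" using assms(1) coeff_above_deg[OF f] by blast
  ultimately show ?thesis by simp
qed

text \<open>As for polynomials, because the product of the two top components is not in the ideal, which is
  prime.\<close>
lemma deg_mult:
  assumes f: "f \<notin> ideal_\<Pi>" and g: "g \<notin> ideal_\<Pi>"
  shows "deg (f * g) = deg f + deg g"
proof (rule deg_eqI)
  let ?f = "coeff (grade f)" and ?g = "coeff (grade g)"
  have *: "?f i * ?g (n - i) \<in> ideal_\<Pi>" if "i \<le> n" "n > deg f + deg g \<or> n = deg f + deg g \<and> i \<noteq> deg f" for i n
  proof -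
    have "i > deg f \<or> n - i > deg g" using that by linarith
    then show ?thesis
      using coeff_above_deg[OF f] coeff_above_deg[OF g] ideal_Pi_mult ideal_Pi_mult_right by blast
  qed
  have "coeff (grade (f * g)) (deg f + deg g) = ?f (deg f) * ?g (deg g)
      + (\<Sum>i\<in>{..deg f + deg g} - {deg f}. ?f i * ?g (deg f + deg g - i))"
    by (simp add: coeff_mult sum.remove[of _ "deg f"])
  moreover have "(\<Sum>i\<in>{..deg f + deg g} - {deg f}. ?f i * ?g (deg f + deg g - i)) \<in> ideal_\<Pi>"
    by (rule ideal_Pi_sum) (rule *, auto)
  moreover have "?f (deg f) * ?g (deg g) \<notin> ideal_\<Pi>"
    using ideal_Pi_prime coeff_deg[OF f] coeff_deg[OF g] by blast
  ultimately show "coeff (grade (f * g)) (deg f + deg g) \<notin> ideal_\<Pi>"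
    using ideal_Pi_diff by fastforce
  show "coeff (grade (f * g)) m \<in> ideal_\<Pi>" if "m > deg f + deg g" for m
    unfolding grade_simps coeff_mult by (rule ideal_Pi_sum) (rule *, use that in auto)
qed

lemma deg_cong:
  assumes "f - g \<in> ideal_\<Pi>" "g \<notin> ideal_\<Pi>"
  shows "deg f = deg g"
proof (rule deg_eqI)
  have eq: "coeff (grade f) n = coeff (grade (f - g)) n + coeff (grade g) n" for n by simp
  have d: "coeff (grade (f - g)) n \<in> ideal_\<Pi>" for n by (rule ideal_Pi_homogeneous[OF assms(1)])
  show "coeff (grade f) (deg g) \<notin> ideal_\<Pi>"
    using coeff_deg[OF assms(2)] ideal_Pi_diff[OF _ d, of _ "deg g"] unfolding eq by fastforce
  show "coeff (grade f) m \<in> ideal_\<Pi>" if "m > deg g" for m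
    unfolding eq using d coeff_above_deg[OF assms(2) that] by (rule ideal_Pi_add)
qed

text \<open>This is where the positivity of the weights enters.\<close>
lemma coeff_0_grade: "coeff (grade f) 0 \<in> range cst"
proof (induction f rule: cpoly_induct)
  case (var v)
  have "coeff (grade (\<xi> v)) 0 = 0" by (cases v) simp_all
  then show ?case by (metis cst_0 rangeI)
qed (auto simp: coeff_mult_0 simp flip: cst_add cst_mult)

lemma deg_eq_0:
  assumes "f \<notin> ideal_\<Pi>" "deg f = 0"
  obtains c where "c \<noteq> 0" "f - cst c \<in> ideal_\<Pi>"
proof -
  obtain c where c: "coeff (grade f) 0 = cst c" using coeff_0_grade by blast
  have "f = (\<Sum>n\<le>degree (grade f). coeff (grade f) n)"
    using poly_grade_1[of f] by (simp add: poly_altdef)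
  also have "\<dots> = cst c + (\<Sum>n\<in>{..degree (grade f)} - {0}. coeff (grade f) n)"
    by (subst sum.remove[of _ 0]) (simp_all add: c)
  finally have "f - cst c = (\<Sum>n\<in>{..degree (grade f)} - {0}. coeff (grade f) n)" by (metis add_diff_cancel_left')
  also have "\<dots> \<in> ideal_\<Pi>"
    by (rule ideal_Pi_sum) (rule coeff_above_deg[OF assms(1)], use assms(2) in auto)
  finally have "f - cst c \<in> ideal_\<Pi>" .
  moreover have "c \<noteq> 0" using calculation assms(1) by auto
  ultimately show ?thesis using that by blast
qed

lemma cst_notin_ideal_Pi: "c \<noteq> 0 \<Longrightarrow> cst c \<notin> ideal_\<Pi>"
  using free_eq_0_if_in_ideal_Pi[OF polys_in.const, of c] by auto

lemma D_notin_ideal_Pi: "D \<notin> ideal_\<Pi>"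
  using free_eq_0_if_in_ideal_Pi[OF D_in_free] D_neq_0 by blast

lemma deg_cst: "c \<noteq> 0 \<Longrightarrow> deg (cst c) = 0"
  by (rule deg_eqI) (auto simp: cst_notin_ideal_Pi coeff_pCons split: nat.splits)

lemma deg_D: "deg D = 5"
  by (rule deg_eqI) (auto simp: homogeneous_F D_notin_ideal_Pi)

section \<open>Nagata's argument\<close>

text \<open>Divisibility and prime elements in R, expressed by representatives.\<close>
definition dvd_mod :: "cpoly \<Rightarrow> cpoly \<Rightarrow> bool" where
  "dvd_mod f g \<longleftrightarrow> (\<exists>q. g - f * q \<in> ideal_\<Pi>)"

definition prime_mod :: "cpoly \<Rightarrow> bool" where
  "prime_mod q \<longleftrightarrow> q \<notin> ideal_\<Pi> \<and> \<not> dvd_mod q 1 \<and> (\<forall>f g. dvd_mod q (f * g) \<longrightarrow> dvd_mod q f \<or> dvd_mod q g)"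

lemma dvd_mod_D: "dvd_mod D f \<longleftrightarrow> f \<in> ideal_D"
  by (simp add: dvd_mod_def ideal_D_def)

lemma one_notin_ideal_Pi: "1 \<notin> ideal_\<Pi>"
  using cst_notin_ideal_Pi[of 1] by simp

lemma in_ideal_Pi_cong: "f - g \<in> ideal_\<Pi> \<Longrightarrow> g \<in> ideal_\<Pi> \<Longrightarrow> f \<in> ideal_\<Pi>"
  using ideal_Pi_add[of "f - g" g] by simp

lemma deg_quotient:
  assumes g: "g \<notin> ideal_\<Pi>" and q: "g - f * q \<in> ideal_\<Pi>"
  shows "f \<notin> ideal_\<Pi>" "q \<notin> ideal_\<Pi>" "deg g = deg f + deg q"
proof -
  have fq: "f * q \<notin> ideal_\<Pi>" using in_ideal_Pi_cong[OF q] g by blast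
  show f: "f \<notin> ideal_\<Pi>" and q': "q \<notin> ideal_\<Pi>"
    using fq ideal_Pi_mult ideal_Pi_mult_right by blast+
  show "deg g = deg f + deg q" using deg_cong[OF q fq] deg_mult[OF f q'] by simp
qed

lemma deg_unit: "dvd_mod f 1 \<Longrightarrow> deg f = 0"
proof -
  assume "dvd_mod f 1"
  then obtain q where "1 - f * q \<in> ideal_\<Pi>" by (auto simp: dvd_mod_def)
  from deg_quotient(3)[OF one_notin_ideal_Pi this] show ?thesis using deg_cst[of 1] by simp
qed

text \<open>Elements of degree 0 are represented by nonzero constants, so the units of R are exactly these.\<close>
lemma dvd_mod_1_if_deg_0:
  assumes "f \<notin> ideal_\<Pi>" "deg f = 0"
  shows "dvd_mod f 1"
proof -
  obtain c where c: "c \<noteq> 0" "f - cst c \<in> ideal_\<Pi>" by (rule deg_eq_0[OF assms])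
  have "1 - f * cst (inverse c) = (- cst (inverse c)) * (f - cst c)"
    using cst_inverse[OF c(1)] by (simp add: algebra_simps)
  also have "\<dots> \<in> ideal_\<Pi>" by (rule ideal_Pi_mult[OF c(2)])
  finally show ?thesis unfolding dvd_mod_def by blast
qed

text \<open>If q divides D^k f and D does not divide q, then D, being prime, divides the cofactor and can be
  cancelled.\<close>
lemma dvd_if_dvd_D_power_mult:
  assumes D: "\<not> dvd_mod D q" and w: "D ^ k * f - q * w \<in> ideal_\<Pi>"
  shows "dvd_mod q f"
  using w
proof (induction k arbitrary: w)
  case 0
  then show ?case by (auto simp: dvd_mod_def)
next
  case (Suc k)
  have "q * w = D * (D ^ k * f) - (D ^ Suc k * f - q * w)" by simp
  also have "\<dots> \<in> ideal_D"
    by (rule ideal_D_diff[OF D_mult_in_ideal_D ideal_Pi_subset_ideal_D[OF Suc.prems]])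
  finally have "w \<in> ideal_D" using ideal_D_prime D by (metis dvd_mod_D)
  then obtain v where v: "w - D * v \<in> ideal_\<Pi>" by (auto simp: ideal_D_def)
  have "D * (D ^ k * f - q * v) = (D ^ Suc k * f - q * w) + q * (w - D * v)"
    by (simp add: algebra_simps)
  also have "\<dots> \<in> ideal_\<Pi>" by (rule ideal_Pi_add[OF Suc.prems ideal_Pi_mult[OF v]])
  finally show ?case by (rule Suc.IH[OF D_regular])
qed

lemma prime_mod_D: "prime_mod D"
  unfolding prime_mod_def
proof (intro conjI allI impI)
  show "\<not> dvd_mod D 1" using deg_unit[of D] deg_D by auto
  show "D \<notin> ideal_\<Pi>" by (rule D_notin_ideal_Pi)
  show "dvd_mod D f \<or> dvd_mod D g" if "dvd_mod D (f * g)" for f g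
    using ideal_D_prime that by (simp only: dvd_mod_D)
qed

text \<open>Dividing by D lowers the degree, so it can be repeated only finitely often.\<close>
lemma split_D_power: "f \<notin> ideal_\<Pi> \<Longrightarrow> \<exists>a g. \<not> dvd_mod D g \<and> f - D ^ a * g \<in> ideal_\<Pi>"
proof (induction "deg f" arbitrary: f rule: less_induct)
  case less
  show ?case
  proof (cases "dvd_mod D f")
    case False
    then show ?thesis by (intro exI[of _ 0] exI[of _ f]) simp
  next
    case True
    then obtain q where q: "f - D * q \<in> ideal_\<Pi>" by (auto simp: dvd_mod_def)
    note dq = deg_quotient[OF less.prems q]
    obtain a g where g: "\<not> dvd_mod D g" "q - D ^ a * g \<in> ideal_\<Pi>"
      using less.hyps[of q] dq deg_D by auto
    have "f - D ^ Suc a * g = (f - D * q) + D * (q - D ^ a * g)" by (simp add: algebra_simps)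
    also have "\<dots> \<in> ideal_\<Pi>" by (rule ideal_Pi_add[OF q ideal_Pi_mult[OF g(2)]])
    finally show ?thesis using g(1) by blast
  qed
qed

lemma free_notin_ideal_Pi: "r \<in> polys_in free_vars \<Longrightarrow> r \<noteq> 0 \<Longrightarrow> r \<notin> ideal_\<Pi>"
  using free_eq_0_if_in_ideal_Pi by blast

lemma free_eq_if_congruent:
  "r \<in> polys_in free_vars \<Longrightarrow> s \<in> polys_in free_vars \<Longrightarrow> r - s \<in> ideal_\<Pi> \<Longrightarrow> r = s"
  using free_eq_0_if_in_ideal_Pi[of "r - s"] polys_in_diff by fastforce

lemma split_D_power_free:
  "h \<in> polys_in free_vars \<Longrightarrow> h \<noteq> 0 \<Longrightarrow>
    \<exists>k g. g \<in> polys_in free_vars \<and> \<not> dvd_in free_vars D g \<and> h = D ^ k * g"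
proof (induction "deg h" arbitrary: h rule: less_induct)
  case less
  show ?case
  proof (cases "dvd_in free_vars D h")
    case False
    then show ?thesis using less.prems(1) by (intro exI[of _ 0] exI[of _ h]) simp
  next
    case True
    then obtain q where q: "q \<in> polys_in free_vars" "h = D * q" by (auto simp: dvd_in_def)
    then have "h - D * q \<in> ideal_\<Pi>" by simp
    note dq = deg_quotient[OF free_notin_ideal_Pi[OF less.prems] this]
    obtain k g where g: "g \<in> polys_in free_vars" "\<not> dvd_in free_vars D g" "q = D ^ k * g"
      using less.hyps[of q] dq deg_D q less.prems by auto
    then show ?thesis using q by (intro exI[of _ "Suc k"] exI[of _ g]) simp
  qed
qed

lemma free_const_if_deg_0:
  assumes "r \<in> polys_in free_vars" "r \<noteq> 0" "deg r = 0"
  obtains c where "c \<noteq> 0" "r = cst c"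
  using deg_eq_0[OF free_notin_ideal_Pi[OF assms(1,2)] assms(3)]
    free_eq_if_congruent[OF assms(1) polys_in.const] that by metis

lemma dvd_in_free_cst_mult:
  assumes "c \<noteq> 0"
  shows "dvd_in free_vars (cst c * r) r"
  unfolding dvd_in_def
  by (rule bexI[of _ "cst (inverse c)"], use cst_inverse[OF assms] in \<open>simp add: mult_ac polys_in.const\<close>)
     (simp add: polys_in.const)

text \<open>The polynomial D is prime in R and hence divides one of the factors in D = q c. By degrees the other
  factor is constant, so q would be an associate of D or a unit.\<close>
lemma prime_not_dvd_D:
  assumes q: "prime_in free_vars q" and D: "\<not> dvd_in free_vars D q"
  shows "\<not> dvd_in free_vars q D"
proof
  assume "dvd_in free_vars q D"
  then obtain c where c: "c \<in> polys_in free_vars" "D = q * c" by (auto simp: dvd_in_def)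
  have qA: "q \<in> polys_in free_vars" "q \<noteq> 0" and q1: "\<not> dvd_in free_vars q 1"
    using q by (auto simp: prime_in_def)
  have c0: "c \<noteq> 0" using c D_neq_0 by auto
  have deg: "deg q + deg c = deg D"
    using deg_mult[OF free_notin_ideal_Pi[OF qA] free_notin_ideal_Pi[OF c(1) c0]] c by simp
  have deg_ge: "deg r \<ge> deg D" if "r \<in> ideal_D" "r \<in> polys_in free_vars" "r \<noteq> 0" for r
    using deg_quotient(3)[OF free_notin_ideal_Pi[OF that(2,3)]] that(1) by (auto simp: ideal_D_def)
  have "q * c \<in> ideal_D" using D_mult_in_ideal_D[of 1] c by simp
  then consider "q \<in> ideal_D" | "c \<in> ideal_D" using ideal_D_prime by blast
  then show False
  proof cases
    case 1
    then have "deg c = 0" using deg deg_ge qA by fastforce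
    then obtain k where "k \<noteq> 0" "c = cst k" using free_const_if_deg_0[OF c(1) c0] by blast
    then show False using D c dvd_in_free_cst_mult[of k q] by (simp add: mult.commute)
  next
    case 2
    then have "deg q = 0" using deg deg_ge c(1) c0 by fastforce
    then obtain k where "k \<noteq> 0" "q = cst k" using free_const_if_deg_0[OF qA] by blast
    then show False using q1 dvd_in_free_cst_mult[of k 1] by simp
  qed
qed

lemma prime_in_D_power_mult:
  assumes q: "prime_in free_vars q" and D: "\<not> dvd_in free_vars q D"
  shows "r \<in> polys_in free_vars \<Longrightarrow> dvd_in free_vars q (D ^ n * r) \<Longrightarrow> dvd_in free_vars q r"
proof (induction n)
  case (Suc n)
  have "dvd_in free_vars q (D * (D ^ n * r))" using Suc.prems by (simp add: mult.assoc)
  moreover have "D ^ n * r \<in> polys_in free_vars"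
    using Suc.prems D_in_free by (intro polys_in.mult polys_in_power)
  ultimately have "dvd_in free_vars q (D ^ n * r)"
    using q D D_in_free by (auto simp: prime_in_def)
  then show ?case by (rule Suc.IH[OF Suc.prems(1)])
qed simp

text \<open>The descent of primes from R[1/D]: a prime q of the polynomial ring, not associated to D, stays
  prime in R after removal of the powers of D that it contains there. Divisibility by q' in R is
  divisibility in R[1/D] by dvd_if_dvd_D_power_mult, and this is divisibility by q in the polynomial
  ring up to powers of D.\<close>
lemma prime_mod_if_prime_in:
  assumes q: "prime_in free_vars q" and Dq: "\<not> dvd_in free_vars D q"
    and a: "q - D ^ a * q' \<in> ideal_\<Pi>" and D: "\<not> dvd_mod D q'"
  shows "prime_mod q'"
  unfolding prime_mod_def
proof (intro conjI allI impI)
  have qA: "q \<in> polys_in free_vars" "q \<noteq> 0" and q1: "\<not> dvd_in free_vars q 1"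
    using q by (auto simp: prime_in_def)
  show q': "q' \<notin> ideal_\<Pi>" by (rule deg_quotient(2)[OF free_notin_ideal_Pi[OF qA] a])
  show "\<not> dvd_mod q' 1"
  proof
    assume "dvd_mod q' 1"
    then obtain c where c: "c \<noteq> 0" "q' - cst c \<in> ideal_\<Pi>" by (rule deg_eq_0[OF q' deg_unit])
    have "q - D ^ a * cst c = (q - D ^ a * q') + D ^ a * (q' - cst c)" by (simp add: algebra_simps)
    also have "\<dots> \<in> ideal_\<Pi>" by (rule ideal_Pi_add[OF a ideal_Pi_mult[OF c(2)]])
    finally have qe: "q = D ^ a * cst c"
      by (rule free_eq_if_congruent[OF qA(1), rotated]) (intro polys_in.mult polys_in_power polys_in.const
          D_in_free)
    show False
    proof (cases a)
      case 0
      then show False using q1 dvd_in_free_cst_mult[OF c(1), of 1] qe by simp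
    next
      case (Suc b)
      have "D ^ b * cst c \<in> polys_in free_vars"
        by (intro polys_in.mult polys_in_power polys_in.const D_in_free)
      then show False using Dq qe Suc by (auto simp: dvd_in_def mult.assoc)
    qed
  qed
  fix f g assume "dvd_mod q' (f * g)"
  then obtain w where w: "f * g - q' * w \<in> ideal_\<Pi>" by (auto simp: dvd_mod_def)
  obtain K r where r: "r \<in> polys_in free_vars" "D ^ K * f - r \<in> ideal_\<Pi>" by (rule clear_D_denominator)
  obtain L s where s: "s \<in> polys_in free_vars" "D ^ L * g - s \<in> ideal_\<Pi>" by (rule clear_D_denominator)
  obtain M t where t: "t \<in> polys_in free_vars" "D ^ M * w - t \<in> ideal_\<Pi>" by (rule clear_D_denominator)
  have "D ^ (M + a) * (r * s) - q * (D ^ (K + L) * t)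
     = D ^ (M + a) * (D ^ K * D ^ L * (f * g - q' * w)
         - ((D ^ L * g) * (D ^ K * f - r) + r * (D ^ L * g - s)))
       + q * D ^ (K + L) * (D ^ M * w - t) - D ^ (K + L) * D ^ M * w * (q - D ^ a * q')"
    by (simp add: algebra_simps power_add)
  also have "\<dots> \<in> ideal_\<Pi>"
    by (intro ideal_Pi_add ideal_Pi_diff ideal_Pi_mult w r s t a)
  finally have "D ^ (M + a) * (r * s) = q * (D ^ (K + L) * t)"
    by (rule free_eq_if_congruent[rotated 2]) (intro polys_in.mult polys_in_power D_in_free r s t qA)+
  moreover have "D ^ (K + L) * t \<in> polys_in free_vars"
    by (intro polys_in.mult polys_in_power D_in_free t)
  ultimately have "dvd_in free_vars q (D ^ (M + a) * (r * s))" unfolding dvd_in_def by blast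
  from prime_in_D_power_mult[OF q prime_not_dvd_D[OF q Dq] _ this]
  have "dvd_in free_vars q (r * s)" using r s by (blast intro: polys_in.mult)
  then have "dvd_in free_vars q r \<or> dvd_in free_vars q s"
    using q r(1) s(1) unfolding prime_in_def by blast
  moreover have "dvd_mod q' h" if qe: "dvd_in free_vars q e" and e: "D ^ N * h - e \<in> ideal_\<Pi>" for h e N
  proof -
    obtain c where c: "e = q * c" using qe unfolding dvd_in_def by blast
    have "D ^ N * h - q' * (D ^ a * c) = (D ^ N * h - e) + c * (q - D ^ a * q')"
      by (simp add: c algebra_simps)
    also have "\<dots> \<in> ideal_\<Pi>" by (rule ideal_Pi_add[OF e ideal_Pi_mult[OF a]])
    finally show ?thesis by (rule dvd_if_dvd_D_power_mult[OF D])
  qed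
  ultimately show "dvd_mod q' f \<or> dvd_mod q' g" using r(2) s(2) by blast
qed

text \<open>If D does not divide f, then f is up to powers of D a polynomial h in the free coordinates. A prime
  factor of h other than D gives the prime divisor of f. It exists, since otherwise f would divide a
  power of D and would be a unit.\<close>
lemma prime_divisor_exists:
  assumes f: "f \<notin> ideal_\<Pi>" and unit: "\<not> dvd_mod f 1"
  shows "\<exists>q. prime_mod q \<and> dvd_mod q f"
proof (cases "dvd_mod D f")
  case True
  then show ?thesis using prime_mod_D by blast
next
  case False
  obtain N h where h: "h \<in> polys_in free_vars" "D ^ N * f - h \<in> ideal_\<Pi>" by (rule clear_D_denominator)
  have "h \<noteq> 0" using h(2) f D_power_regular[of N f] by auto
  from split_D_power_free[OF h(1) this]
  obtain k g where g: "g \<in> polys_in free_vars" "\<not> dvd_in free_vars D g" "h = D ^ k * g" by blast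
  have "\<not> dvd_in free_vars g 1"
  proof
    assume "dvd_in free_vars g 1"
    then obtain c where c: "1 = g * c" by (auto simp: dvd_in_def)
    have "D ^ k * 1 - f * (D ^ N * c) = D ^ k * (1 - g * c) - c * (D ^ N * f - h)"
      by (simp add: g(3) algebra_simps)
    also have "\<dots> \<in> ideal_\<Pi>" using h(2) c by (simp add: ideal_Pi_uminus ideal_Pi_mult)
    finally have "dvd_mod f 1" by (rule dvd_if_dvd_D_power_mult[OF False])
    with unit show False ..
  qed
  moreover have "g \<noteq> 0" using g(3) \<open>h \<noteq> 0\<close> by auto
  ultimately obtain q where q: "prime_in free_vars q" "dvd_in free_vars q g"
    using prime_factor_free g(1) by blast
  then obtain e where e: "e \<in> polys_in free_vars" "g = q * e" by (auto simp: dvd_in_def)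
  have qA: "q \<in> polys_in free_vars" "q \<noteq> 0" using q by (auto simp: prime_in_def)
  have Dq: "\<not> dvd_in free_vars D q"
    using g(2) e unfolding dvd_in_def by (metis mult.assoc polys_in.mult)
  from split_D_power[OF free_notin_ideal_Pi[OF qA]]
  obtain a q' where q': "\<not> dvd_mod D q'" "q - D ^ a * q' \<in> ideal_\<Pi>" by blast
  have "D ^ N * f - q' * (D ^ k * D ^ a * e) = (D ^ N * f - h) + D ^ k * e * (q - D ^ a * q')"
    by (simp add: g(3) e(2) algebra_simps)
  also have "\<dots> \<in> ideal_\<Pi>" by (rule ideal_Pi_add[OF h(2) ideal_Pi_mult[OF q'(2)]])
  finally have "dvd_mod q' f" by (rule dvd_if_dvd_D_power_mult[OF q'(1)])
  with prime_mod_if_prime_in[OF q(1) Dq q'(2,1)] show ?thesis by blast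
qed

definition residue :: "cpoly \<Rightarrow> cpoly set" where
  "residue f = ideal_\<Pi> +>\<^bsub>cpoly_ring\<^esub> f"

lemma carrier_R_Pi: "carrier R_\<Pi> = range residue"
  unfolding R_\<Pi>_def FactRing_def residue_def A_RCOSETS_def' by auto

lemma R_Pi_simps:
  "\<one>\<^bsub>R_\<Pi>\<^esub> = residue 1" "\<zero>\<^bsub>R_\<Pi>\<^esub>
      = ideal_\<Pi>" "residue f \<otimes>\<^bsub>R_\<Pi>\<^esub> residue g = residue (f * g)"
  using ideal.rcoset_mult_add[OF ideal_Pi, of f g]
  by (simp_all add: R_\<Pi>_def FactRing_def residue_def)

lemma residue_eq: "residue f = {g. g - f \<in> ideal_\<Pi>}"
proof -
  have "g \<in> (\<Union>h\<in>ideal_\<Pi>. {h + f})" if "g - f \<in> ideal_\<Pi>" for g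
    using that by (auto intro!: bexI[of _ "g - f"])
  then show ?thesis by (auto simp: residue_def a_r_coset_def r_coset_def)
qed

lemma residue_eq_iff: "residue f = residue g \<longleftrightarrow> f - g \<in> ideal_\<Pi>"
proof
  assume "residue f = residue g"
  moreover have "f \<in> residue f" by (simp add: residue_eq)
  ultimately show "f - g \<in> ideal_\<Pi>" by (simp add: residue_eq)
next
  assume fg: "f - g \<in> ideal_\<Pi>"
  have "h - f \<in> ideal_\<Pi> \<longleftrightarrow> h - g \<in> ideal_\<Pi>" for h
    using ideal_Pi_add[OF _ fg, of "h - f"] ideal_Pi_diff[OF _ fg, of "h - g"] by auto
  then show "residue f = residue g" by (simp add: residue_eq)
qed

lemma residue_eq_0_iff: "residue f = ideal_\<Pi> \<longleftrightarrow> f \<in> ideal_\<Pi>"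
  using residue_eq_iff[of f 0] residue_eq[of 0] by simp

lemma domain_R_Pi: "domain R_\<Pi>"
proof -
  have "primeideal ideal_\<Pi> cpoly_ring"
  proof (rule primeidealI[OF ideal_Pi cring_cpoly_ring])
    show "carrier cpoly_ring \<noteq> ideal_\<Pi>" using one_notin_ideal_Pi by auto
  qed (use ideal_Pi_prime in simp)
  then show ?thesis unfolding R_\<Pi>_def by (rule primeideal.quotient_is_domain)
qed

lemma carrier_mult_R_Pi: "carrier (mult_of R_\<Pi>) = residue ` (- ideal_\<Pi>)"
  using residue_eq_0_iff by (auto simp: carrier_R_Pi R_Pi_simps)

lemma residue_in_mult_R_Pi_iff: "residue f \<in> carrier (mult_of R_\<Pi>) \<longleftrightarrow> f \<notin> ideal_\<Pi>"
  unfolding carrier_mult_of carrier_R_Pi R_Pi_simps using residue_eq_0_iff by blast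

lemma divides_R_Pi:
  assumes "g \<notin> ideal_\<Pi>"
  shows "residue f divides\<^bsub>mult_of R_\<Pi>\<^esub> residue g \<longleftrightarrow> dvd_mod f g"
proof
  assume "residue f divides\<^bsub>mult_of R_\<Pi>\<^esub> residue g"
  then show "dvd_mod f g"
    unfolding factor_def carrier_mult_R_Pi by (auto simp: R_Pi_simps residue_eq_iff dvd_mod_def)
next
  assume "dvd_mod f g"
  then obtain q where q: "g - f * q \<in> ideal_\<Pi>" by (auto simp: dvd_mod_def)
  have "q \<notin> ideal_\<Pi>" by (rule deg_quotient(2)[OF assms q])
  then show "residue f divides\<^bsub>mult_of R_\<Pi>\<^esub> residue g"
    unfolding factor_def carrier_mult_R_Pi using q by (auto simp: R_Pi_simps residue_eq_iff)
qed

text \<open>Every irreducible element is associated to the prime element that divides it, and a proper divisor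
  has smaller degree than the element, since elements of degree 0 are units.\<close>
theorem proposition5p8:
  shows "factorial_domain R_\<Pi>"
proof -
  interpret R: domain R_\<Pi> by (rule domain_R_Pi)
  let ?M = "mult_of R_\<Pi>"
  have unit: "residue f \<in> Units ?M \<longleftrightarrow> dvd_mod f 1" if "f \<notin> ideal_\<Pi>" for f
  proof -
    have f: "residue f \<in> carrier ?M" using that unfolding carrier_mult_R_Pi by blast
    show ?thesis
      using R.mult_of.Unit_eq_dividesone[OF f] divides_R_Pi[OF one_notin_ideal_Pi, of f]
      by (simp only: R_Pi_simps one_mult_of)
  qed
  have chain: "wf {(x, y). x \<in> carrier ?M \<and> y \<in> carrier ?M \<and> properfactor ?M x y}"
  proof (rule wf_subset[OF wf_measure])
    let ?d = "\<lambda>x. deg (SOME f. residue f = x)"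
    show "{(x, y). x \<in> carrier ?M \<and> y \<in> carrier ?M \<and> properfactor ?M x y} \<subseteq> measure ?d"
    proof (rule subrelI)
      fix x y assume "(x, y) \<in> {(x, y). x \<in> carrier ?M \<and> y \<in> carrier ?M \<and> properfactor ?M x y}"
      then have xy: "x \<in> carrier ?M" "y \<in> carrier ?M" "properfactor ?M x y" by simp_all
      define f where "f = (SOME f. residue f = x)"
      define g where "g = (SOME f. residue f = y)"
      have f: "residue f = x" unfolding f_def using xy(1) unfolding carrier_mult_R_Pi
        by (intro someI_ex[of "\<lambda>f. residue f = x"]) blast
      have g: "residue g = y" unfolding g_def using xy(2) unfolding carrier_mult_R_Pi
        by (intro someI_ex[of "\<lambda>f. residue f = y"]) blast
      have fI: "f \<notin> ideal_\<Pi>" and gI: "g \<notin> ideal_\<Pi>"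
        using xy(1,2) unfolding f[symmetric] g[symmetric] residue_in_mult_R_Pi_iff by blast+
      have "dvd_mod f g" and not: "\<not> dvd_mod g f"
        using xy(3) unfolding properfactor_def f[symmetric] g[symmetric] divides_R_Pi[OF fI] divides_R_Pi[OF gI]
        by blast+
      then obtain q where q: "g - f * q \<in> ideal_\<Pi>" by (auto simp: dvd_mod_def)
      note dq = deg_quotient[OF gI q]
      have "deg q \<noteq> 0"
      proof
        assume "deg q = 0"
        then obtain r where r: "1 - q * r \<in> ideal_\<Pi>"
          using dvd_mod_1_if_deg_0[OF dq(2)] by (auto simp: dvd_mod_def)
        have "f - g * r = f * (1 - q * r) - r * (g - f * q)" by (simp add: algebra_simps)
        also have "\<dots> \<in> ideal_\<Pi>" by (intro ideal_Pi_diff ideal_Pi_mult q r)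
        finally show False using not unfolding dvd_mod_def by blast
      qed
      then show "(x, y) \<in> measure ?d"
        unfolding in_measure f_def[symmetric] g_def[symmetric] using dq(3) by linarith
    qed
  qed
  have prime: "Divisibility.prime ?M x" if x: "x \<in> carrier ?M" and irr: "Divisibility.irreducible ?M x" for x
  proof -
    obtain f where f: "f \<notin> ideal_\<Pi>" "x = residue f" using x unfolding carrier_mult_R_Pi by blast
    have "\<not> dvd_mod f 1" using irr unit[OF f(1)] unfolding Divisibility.irreducible_def f(2) by blast
    from prime_divisor_exists[OF f(1) this]
    obtain q where q: "prime_mod q" "dvd_mod q f" by blast
    then have qI: "q \<notin> ideal_\<Pi>" and q1: "\<not> dvd_mod q 1" unfolding prime_mod_def by blast+
    have qM: "residue q \<in> carrier ?M" using qI unfolding carrier_mult_R_Pi by blast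
    have dvd: "residue q divides\<^bsub>?M\<^esub> x" using divides_R_Pi[OF f(1)] q(2) f(2) by blast
    then have "x divides\<^bsub>?M\<^esub> residue q"
      using irr qM unit[OF qI] q1 unfolding Divisibility.irreducible_def properfactor_def by blast
    with dvd have "residue q \<sim>\<^bsub>?M\<^esub> x" by (simp add: associated_def)
    moreover have "Divisibility.prime ?M (residue q)"
    proof (rule Divisibility.primeI)
      show "residue q \<notin> Units ?M" using unit[OF qI] q1 by simp
      fix a b assume a: "a \<in> carrier ?M" and b: "b \<in> carrier ?M"
          and ab: "residue q divides\<^bsub>?M\<^esub> a \<otimes>\<^bsub>?M\<^esub> b"
      obtain g h where g: "g \<notin> ideal_\<Pi>" "a = residue g" and h: "h \<notin> ideal_\<Pi>" "b = residue h"
        using a b unfolding carrier_mult_R_Pi by blast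
      have gh: "g * h \<notin> ideal_\<Pi>" using ideal_Pi_prime g h by blast
      have "dvd_mod q (g * h)" using ab divides_R_Pi[OF gh] unfolding g h mult_mult_of R_Pi_simps by blast
      then have "dvd_mod q g \<or> dvd_mod q h" using q(1) unfolding prime_mod_def by blast
      then show "residue q divides\<^bsub>?M\<^esub> a \<or> residue q divides\<^bsub>?M\<^esub> b"
        unfolding g(2) h(2) divides_R_Pi[OF g(1)] divides_R_Pi[OF h(1)] .
    qed
    ultimately show ?thesis using R.mult_of.prime_cong[OF _ _ qM x] by blast
  qed
  have "divisor_chain_condition_monoid ?M"
    by (intro divisor_chain_condition_monoid.intro divisor_chain_condition_monoid_axioms.intro
        R.mult_of.comm_monoid_cancel_axioms chain)
  moreover have "primeness_condition_monoid ?M"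
    by (intro primeness_condition_monoid.intro primeness_condition_monoid_axioms.intro
        R.mult_of.comm_monoid_cancel_axioms prime)
  ultimately have "factorial_monoid ?M" using factorial_condition_one by blast
  with domain_R_Pi show ?thesis by (simp add: factorial_domain_def)
qed

end
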